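(* Let $M$ be a connected smooth manifold of dimension $n$, let $\mathcal{P}$ be a Lie pseudogroup acting transitively on $M$, and let $I_1,\ldots,I_n\in C^\infty(J^l(\psi_k))$ be rational $\mathcal{P}$-invariants in general position over an open set $\mathcal{O}\subset J^l(\psi_k)$. Let $A,B\in\mathrm{Diff}_k(M)$ and let $\mathcal{O}',\mathcal{O}''\subset M$ be domains such that $(A,\mathcal{O}')$ and $(B,\mathcal{O}'')$ are adjusted pairs for the same set of invariants $I_1,\ldots,I_n$. Then the operators $A$ and $B$ are $\mathcal{P}$-equivalent in the open sets $\mathcal{O}'$ and $\mathcal{O}''$ if and only if their $\mathcal{P}$-models coincide, $$\phi_A(\mathcal{O}')=\phi_B(\mathcal{O}''),$$ and $\psi_{AB}\in\mathcal{P}$, where $\psi_{AB}\colon\mathcal{O}'\to\mathcal{O}''$ is the diffeomorphism with $\psi_{AB}^*(I_i(B))=I_i(A)$, $i=1,\dots,n$.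
   Context: Pseudogroups. A pseudogroup $\mathcal{P}$ on a connected smooth manifold $M$ is a collection of local diffeomorphisms (diffeomorphisms between open sets of $M$) containing $\mathrm{id}_M$, closed under restriction to open subsets, under composition (where defined) and under inverses, and such that a local diffeomorphism belongs to $\mathcal{P}$ if its restrictions to open domains of its domain belong to $\mathcal{P}$. It is transitive if for all $a,b\in M$ there is $\phi\in\mathcal{P}$ with $\phi(a)=b$. Let $D_k(M)\to M$ be the bundle of $k$-jets $[\phi]^k_a$ of local diffeomorphisms, and $G_k=\{[\phi]^k_a:\phi\in\mathcal{P},\ a\in\mathrm{dom}(\phi)\}\subset D_k(M)$. $\mathcal{P}$ is regular if all $G_k$ are smooth submanifolds and smooth subbundles of $D_k(M)$ over $M$. A regular pseudogroup is a Lie pseudogroup if $\cdots\to G_k\to G_{k-1}\to\cdots\to G_1\to M\times M\to M$ is a tower of smooth bundles defining a formally integrable equation, in the sense that the first prolongations satisfy $G_k^{(1)}\subset G_{k+1}$ for all $k\ge1$. Operators, jets, invariants. $\psi_k\colon \mathit{Diff}_k(M)\to M$ is the bundle of scalar linear differential operators of order $\le k$, with module of smooth sections $\mathrm{Diff}_k(M)$; $J^l(\psi_k)$ is the bundle of $l$-jets of its sections. In local coordinates, $\mathit{Diff}_k(M)$ has coordinates $(x_i,u_\alpha)$, $|\alpha|\le k$, with $u_\alpha(A)=A_\alpha$ for $A=\sum_\alpha A_\alpha\partial^\alpha$. Local diffeomorphisms $\phi$ act on operators by $\phi_*(A)=(\phi^{-1})^*\circ A\circ\phi^*$, and this prolongs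 to $J^l(\psi_k)$. A rational $\mathcal{P}$-invariant is a function on $J^l(\psi_k)$ invariant under the prolonged $\mathcal{P}$-action and rational along the fibres of $J^l(\psi_k)\to M$ (in standard jet coordinates). Invariants $I_1,\dots,I_n$ are in general position over $\mathcal{O}$ if $\widehat dI_1\wedge\cdots\wedge\widehat dI_n\neq0$ there, where $\widehat dF=\sum_i\frac{dF}{dx_i}dx_i$ is the total differential and $\frac{d}{dx_i}$ are total derivatives. For an operator $A$ with corresponding section $S_A$ of $\psi_k$, $I(A)$ denotes the function on $M$ obtained by restricting $I$ to the jet of $S_A$. Universal operator. $\square=\sum_{|\alpha|\le k}u_\alpha\frac{d^{|\alpha|}}{dx^\alpha}\colon C^\infty(J^l(\psi_k))\to C^\infty(J^{l+k}(\psi_k))$ (a coordinate-independent operator), and $I_\alpha=\frac1{\alpha!}\square(I_1^{\alpha_1}\cdots I_n^{\alpha_n})$ for $|\alpha|\le k$; these are again $\mathcal{P}$-invariants. Models. Let $\Phi_k=\mathbb{R}^n\times\mathbb{R}^{\binom{n+k}{k}}$ with coordinates $(y_1,\dots,y_n,Y_\alpha,|\alpha|\le k)$. For $A\in\mathrm{Diff}_k(M)$ and a domain $\mathcal{O}'\subset M$ over which the $l$-jet of $S_A$ takes values in $\mathcal{O}$, define $\phi_A\colon\mathcal{O}'\to\Phi_k$ by $y_i=I_i(A)$, $Y_\alpha=I_\alpha(A)$. The pair $(A,\mathcal{O}')$ is adjusted (for $I_1,\dots,I_n$) if $I_1(A),\dots,I_n(A)$ are coordinates in the domain $\mathcal{O}'$;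 then $\phi_A(\mathcal{O}')\subset\Phi_k$ is called the $\mathcal{P}$-model of $A$ in $\mathcal{O}'$. Equivalence. $A$ and $B$ are $\mathcal{P}$-equivalent in $\mathcal{O}'$ and $\mathcal{O}''$ if there is a diffeomorphism $\psi\colon\mathcal{O}'\to\mathcal{O}''$, $\psi\in\mathcal{P}$, with $\psi_*(A|_{\mathcal{O}'})=B|_{\mathcal{O}''}$. When the models coincide, the diffeomorphism $\psi_{AB}$ is $\phi_B^{-1}\circ\phi_A$. *)

theory Defs
  imports "HOL-Analysis.Analysis"
begin

section \<open>Smooth functions on finite-dimensional coordinate spaces\<close>

text \<open>
  Jet spaces have coordinates indexed by multi-indices of bounded order, so their dimension depends
  on the order. A finite-dimensional space with coordinates indexed by a finite set \<open>J\<close> is therefore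
  modelled, as in \<open>Euclidean_space\<close>, by the functions vanishing outside \<open>J\<close>, with the subspace topology
  of the product topology. For a finite type \<open>'n\<close> the model of Euclidean space is \<open>'n \<Rightarrow> real\<close>.
\<close>

definition rspace :: "'i set \<Rightarrow> ('i \<Rightarrow> real) set" where
  "rspace J = {v. \<forall>i. i \<notin> J \<longrightarrow> v i = 0}"

abbreviation ropen :: "'i set \<Rightarrow> ('i \<Rightarrow> real) set \<Rightarrow> bool" where
  "ropen J W \<equiv> openin (top_of_set (rspace J)) W"

definition partial :: "'i \<Rightarrow> (('i \<Rightarrow> real) \<Rightarrow> real) \<Rightarrow> ('i \<Rightarrow> real) \<Rightarrow> real" where
  "partial i f v = deriv (\<lambda>t. f (v(i := t))) (v i)"

text \<open>The following two predicates are only used for \<open>W\<close> with \<open>ropen J W\<close>.\<close>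

fun Ck_on :: "nat \<Rightarrow> 'i set \<Rightarrow> ('i \<Rightarrow> real) set \<Rightarrow> (('i \<Rightarrow> real) \<Rightarrow> real) \<Rightarrow> bool" where
  "Ck_on 0 J W f = continuous_on W f"
| "Ck_on (Suc r) J W f =
    (continuous_on W f \<and>
     (\<forall>i\<in>J. (\<forall>v\<in>W. (\<lambda>t. f (v(i := t))) differentiable (at (v i))) \<and> Ck_on r J W (partial i f)))"

definition smooth_fun :: "'i set \<Rightarrow> ('i \<Rightarrow> real) set \<Rightarrow> (('i \<Rightarrow> real) \<Rightarrow> real) \<Rightarrow> bool" where
  "smooth_fun J W f \<longleftrightarrow> (\<forall>r. Ck_on r J W f)"

inductive poly_fun :: "'i set \<Rightarrow> (('i \<Rightarrow> real) \<Rightarrow> real) \<Rightarrow> bool" for J where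
  const: "poly_fun J (\<lambda>_. c)"
| coord: "i \<in> J \<Longrightarrow> poly_fun J (\<lambda>v. v i)"
| add: "poly_fun J f \<Longrightarrow> poly_fun J g \<Longrightarrow> poly_fun J (\<lambda>v. f v + g v)"
| mult: "poly_fun J f \<Longrightarrow> poly_fun J g \<Longrightarrow> poly_fun J (\<lambda>v. f v * g v)"


section \<open>Multi-indices\<close>

type_synonym 'n midx = "'n \<Rightarrow> nat"

definition midx_le :: "nat \<Rightarrow> ('n::finite) midx set" where
  "midx_le k = {\<alpha>. (\<Sum>i\<in>UNIV. \<alpha> i) \<le> k}"

definition midx_zero :: "'n midx" where
  "midx_zero = (\<lambda>_. 0)"

definition midx_fact :: "('n::finite) midx \<Rightarrow> real" where
  "midx_fact \<alpha> = (\<Prod>i\<in>UNIV. fact (\<alpha> i))"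

definition midx_power :: "('n::finite \<Rightarrow> real) \<Rightarrow> 'n midx \<Rightarrow> real" where
  "midx_power y \<alpha> = (\<Prod>i\<in>UNIV. y i ^ \<alpha> i)"

text \<open>
  \<open>iter_deriv D \<alpha>\<close> is the composition of all \<open>(D i) ^^ (\<alpha> i)\<close>. The linear order on \<open>'n\<close> only fixes the
  order of the factors; partial and total derivatives commute on smooth functions.
\<close>

definition iter_deriv :: "('n::{finite,linorder} \<Rightarrow> 'f \<Rightarrow> 'f) \<Rightarrow> 'n midx \<Rightarrow> 'f \<Rightarrow> 'f" where
  "iter_deriv D \<alpha> F = fold (\<lambda>i. D i ^^ \<alpha> i) (sorted_list_of_set UNIV) F"


section \<open>Smooth manifolds, submanifolds and bundles\<close>

type_synonym ('a, 'i) chart = "'a set \<times> ('a \<Rightarrow> 'i \<Rightarrow> real)"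

definition mcarrier :: "('a, 'i) chart set \<Rightarrow> 'a set" where
  "mcarrier \<A> = (\<Union>c\<in>\<A>. fst c)"

definition is_chart :: "'i set \<Rightarrow> ('a, 'i) chart \<Rightarrow> bool" where
  "is_chart J = (\<lambda>(U, x). inj_on x U \<and> ropen J (x ` U))"

definition compatible :: "'i set \<Rightarrow> ('a, 'i) chart \<Rightarrow> ('a, 'i) chart \<Rightarrow> bool" where
  "compatible J = (\<lambda>(U, x) (V, y).
     ropen J (x ` (U \<inter> V)) \<and> ropen J (y ` (U \<inter> V)) \<and>
     (\<forall>j\<in>J. smooth_fun J (x ` (U \<inter> V)) (\<lambda>v. y (inv_into U x v) j)) \<and>
     (\<forall>j\<in>J. smooth_fun J (y ` (U \<inter> V)) (\<lambda>v. x (inv_into V y v) j)))"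

definition smooth_atlas :: "'i set \<Rightarrow> ('a, 'i) chart set \<Rightarrow> bool" where
  "smooth_atlas J \<A> \<longleftrightarrow>
     finite J \<and> (\<forall>c\<in>\<A>. is_chart J c) \<and> (\<forall>c\<in>\<A>. \<forall>c'\<in>\<A>. compatible J c c')"

definition max_atlas :: "'i set \<Rightarrow> ('a, 'i) chart set \<Rightarrow> ('a, 'i) chart set" where
  "max_atlas J \<A> =
     {c. fst c \<subseteq> mcarrier \<A> \<and> is_chart J c \<and> (\<forall>c'\<in>\<A>. compatible J c c')}"

text \<open>The open sets of the topology induced by an atlas.\<close>

definition mopen :: "'i set \<Rightarrow> ('a, 'i) chart set \<Rightarrow> 'a set \<Rightarrow> bool" where
  "mopen J \<A> S \<longleftrightarrow> S \<subseteq> mcarrier \<A> \<and> (\<forall>(U, x)\<in>\<A>. ropen J (x ` (S \<inter> U)))"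

text \<open>
  Smooth manifolds whose underlying topological space is a type; Hausdorff and second countable by
  the type class, of dimension \<open>CARD('n)\<close>.
\<close>

definition smooth_manifold ::
    "('m::{t2_space,second_countable_topology}, 'n::finite) chart set \<Rightarrow> bool" where
  "smooth_manifold \<A> \<longleftrightarrow>
     smooth_atlas UNIV \<A> \<and> mcarrier \<A> = UNIV \<and>
     (\<forall>(U, x)\<in>\<A>. open U \<and> homeomorphism U (x ` U) x (inv_into U x))"

definition smooth_scalar :: "'i set \<Rightarrow> ('a, 'i) chart set \<Rightarrow> 'a set \<Rightarrow> ('a \<Rightarrow> real) \<Rightarrow> bool" where
  "smooth_scalar J \<A> S f \<longleftrightarrow>
     (\<forall>(U, x)\<in>\<A>. smooth_fun J (x ` (S \<inter> U)) (\<lambda>v. f (inv_into U x v)))"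

text \<open>Openness of the sets \<open>x ` (S \<inter> U \<inter> f -` V)\<close> expresses continuity of \<open>f\<close> on the open set \<open>S\<close>.\<close>

definition smooth_map ::
    "'i set \<Rightarrow> ('a, 'i) chart set \<Rightarrow> 'j set \<Rightarrow> ('b, 'j) chart set \<Rightarrow> 'a set \<Rightarrow> ('a \<Rightarrow> 'b) \<Rightarrow> bool" where
  "smooth_map J \<A> K \<B> S f \<longleftrightarrow>
     mopen J \<A> S \<and> f ` S \<subseteq> mcarrier \<B> \<and>
     (\<forall>(U, x)\<in>\<A>. \<forall>(V, y)\<in>\<B>.
        ropen J (x ` (S \<inter> U \<inter> f -` V)) \<and>
        (\<forall>j\<in>K. smooth_fun J (x ` (S \<inter> U \<inter> f -` V)) (\<lambda>v. y (f (inv_into U x v)) j)))"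

definition diffeo_between ::
    "'i set \<Rightarrow> ('a, 'i) chart set \<Rightarrow> 'j set \<Rightarrow> ('b, 'j) chart set \<Rightarrow> 'a set \<Rightarrow> 'b set \<Rightarrow> ('a \<Rightarrow> 'b) \<Rightarrow> bool"
  where
  "diffeo_between J \<A> K \<B> S T h \<longleftrightarrow>
     bij_betw h S T \<and> smooth_map J \<A> K \<B> S h \<and> smooth_map K \<B> J \<A> T (inv_into S h)"

definition prod_atlas ::
    "('a, 'i) chart set \<Rightarrow> ('b, 'j) chart set \<Rightarrow> ('a \<times> 'b, 'i + 'j) chart set" where
  "prod_atlas \<A> \<B> =
     {(U \<times> V, \<lambda>(a, b). case_sum (x a) (y b)) | U x V y. (U, x) \<in> \<A> \<and> (V, y) \<in> \<B>}"

text \<open>Slice charts: \<open>K\<close> is the set of coordinates that remain free on the submanifold \<open>G\<close>.\<close>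

definition sub_atlas ::
    "'i set \<Rightarrow> ('a, 'i) chart set \<Rightarrow> 'i set \<Rightarrow> 'a set \<Rightarrow> ('a, 'i) chart set" where
  "sub_atlas J \<A> K G =
     {(W \<inter> G, z) | W z. (W, z) \<in> max_atlas J \<A> \<and> z ` (W \<inter> G) = z ` W \<inter> rspace K}"

definition submanifold :: "'i set \<Rightarrow> ('a, 'i) chart set \<Rightarrow> 'i set \<Rightarrow> 'a set \<Rightarrow> bool" where
  "submanifold J \<A> K G \<longleftrightarrow>
     K \<subseteq> J \<and> G \<subseteq> mcarrier \<A> \<and> mcarrier (sub_atlas J \<A> K G) = G"

text \<open>
  Smooth locally trivial bundles. Each local fibre \<open>\<F>\<close> may be taken inside the type of the total
  space, since it is diffeomorphic to a fibre of the projection.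
\<close>

definition fibre_bundle ::
    "'i set \<Rightarrow> ('a, 'i) chart set \<Rightarrow> 'j set \<Rightarrow> ('b, 'j) chart set \<Rightarrow> ('a \<Rightarrow> 'b) \<Rightarrow> bool" where
  "fibre_bundle J \<A> K \<B> \<pi> \<longleftrightarrow>
     smooth_map J \<A> K \<B> (mcarrier \<A>) \<pi> \<and> \<pi> ` mcarrier \<A> = mcarrier \<B> \<and>
     (\<forall>b\<in>mcarrier \<B>. \<exists>V. mopen K \<B> V \<and> b \<in> V \<and>
        (\<exists>(L :: 'i set) (\<F> :: ('a, 'i) chart set) h.
           smooth_atlas L \<F> \<and>
           diffeo_between J \<A> (K <+> L) (prod_atlas \<B> \<F>)
             (\<pi> -` V \<inter> mcarrier \<A>) (V \<times> mcarrier \<F>) h \<and>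
           (\<forall>e \<in> \<pi> -` V \<inter> mcarrier \<A>. fst (h e) = \<pi> e)))"


section \<open>Local diffeomorphisms and pseudogroups\<close>

definition pinv :: "('m \<rightharpoonup> 'm) \<Rightarrow> ('m \<rightharpoonup> 'm)" where
  "pinv \<phi> = (\<lambda>q. if q \<in> ran \<phi> then Some (inv_into (dom \<phi>) (\<lambda>p. the (\<phi> p)) q) else None)"

definition local_diffeo ::
    "('m::{t2_space,second_countable_topology}, 'n::finite) chart set \<Rightarrow> ('m \<rightharpoonup> 'm) \<Rightarrow> bool" where
  "local_diffeo charts \<phi> \<longleftrightarrow>
     open (dom \<phi>) \<and> open (ran \<phi>) \<and>
     diffeo_between UNIV charts UNIV charts (dom \<phi>) (ran \<phi>) (\<lambda>p. the (\<phi> p))"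

definition pseudogroup ::
    "('m::{t2_space,second_countable_topology}, 'n::finite) chart set \<Rightarrow> ('m \<rightharpoonup> 'm) set \<Rightarrow> bool" where
  "pseudogroup charts P \<longleftrightarrow>
     (\<forall>\<phi>\<in>P. local_diffeo charts \<phi>) \<and>
     Some \<in> P \<and>
     (\<forall>\<phi>\<in>P. \<forall>U. open U \<longrightarrow> \<phi> |` U \<in> P) \<and>
     (\<forall>\<phi>\<in>P. \<forall>\<xi>\<in>P. \<xi> \<circ>\<^sub>m \<phi> \<in> P) \<and>
     (\<forall>\<phi>\<in>P. pinv \<phi> \<in> P) \<and>
     (\<forall>\<phi>. local_diffeo charts \<phi> \<longrightarrow>
        (\<forall>p\<in>dom \<phi>. \<exists>U. open U \<and> p \<in> U \<and> U \<subseteq> dom \<phi> \<and> \<phi> |` U \<in> P) \<longrightarrow> \<phi> \<in> P)"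

definition transitive_pseudogroup :: "('m \<rightharpoonup> 'm) set \<Rightarrow> bool" where
  "transitive_pseudogroup P \<longleftrightarrow> (\<forall>a b. \<exists>\<phi>\<in>P. \<phi> a = Some b)"


section \<open>Jets of local diffeomorphisms and Lie pseudogroups\<close>

text \<open>A \<open>k\<close>-jet is its source point together with the class of local diffeomorphisms representing it.\<close>

type_synonym 'm djet = "'m \<times> ('m \<rightharpoonup> 'm) set"

definition diffeo_deriv ::
    "('m, 'n::{finite,linorder}) chart \<Rightarrow> ('m, 'n) chart \<Rightarrow> ('m \<rightharpoonup> 'm) \<Rightarrow> 'm \<Rightarrow> 'n \<Rightarrow> 'n midx \<Rightarrow> real" where
  "diffeo_deriv = (\<lambda>(U, x) (V, y) \<phi> a j \<beta>.
     iter_deriv partial \<beta> (\<lambda>v. y (the (\<phi> (inv_into U x v))) j) (x a))"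

definition djet ::
    "('m::{t2_space,second_countable_topology}, 'n::{finite,linorder}) chart set
       \<Rightarrow> nat \<Rightarrow> ('m \<rightharpoonup> 'm) \<Rightarrow> 'm \<Rightarrow> 'm djet" where
  "djet charts k \<phi> a = (a, {\<xi>. local_diffeo charts \<xi> \<and> a \<in> dom \<xi> \<and> \<xi> a = \<phi> a \<and>
     (\<forall>c\<in>charts. \<forall>c'\<in>charts. a \<in> fst c \<longrightarrow> the (\<phi> a) \<in> fst c' \<longrightarrow>
        (\<forall>j. \<forall>\<beta>\<in>midx_le k. diffeo_deriv c c' \<xi> a j \<beta> = diffeo_deriv c c' \<phi> a j \<beta>))})"

definition djet_space ::
    "('m::{t2_space,second_countable_topology}, 'n::{finite,linorder}) chart set
       \<Rightarrow> nat \<Rightarrow> 'm djet set" where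
  "djet_space charts k = {djet charts k \<phi> a | \<phi> a. local_diffeo charts \<phi> \<and> a \<in> dom \<phi>}"

definition djet_rep :: "'m djet \<Rightarrow> ('m \<rightharpoonup> 'm)" where
  "djet_rep \<theta> = (SOME \<phi>. \<phi> \<in> snd \<theta>)"

definition djet_target :: "'m djet \<Rightarrow> 'm" where
  "djet_target \<theta> = the (djet_rep \<theta> (fst \<theta>))"

definition djet_proj ::
    "('m::{t2_space,second_countable_topology}, 'n::{finite,linorder}) chart set
       \<Rightarrow> nat \<Rightarrow> 'm djet \<Rightarrow> 'm djet" where
  "djet_proj charts k \<theta> = djet charts k (djet_rep \<theta>) (fst \<theta>)"

definition djet_idx :: "nat \<Rightarrow> ('n::finite + 'n \<times> 'n midx) set" where
  "djet_idx k = range Inl \<union> Inr ` (UNIV \<times> midx_le k)"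

definition djet_coords ::
    "nat \<Rightarrow> ('m, 'n::{finite,linorder}) chart \<Rightarrow> ('m, 'n) chart
       \<Rightarrow> 'm djet \<Rightarrow> ('n + 'n \<times> 'n midx) \<Rightarrow> real" where
  "djet_coords k c c' \<theta> s =
     (case s of Inl i \<Rightarrow> snd c (fst \<theta>) i
      | Inr (j, \<beta>) \<Rightarrow> if \<beta> \<in> midx_le k then diffeo_deriv c c' (djet_rep \<theta>) (fst \<theta>) j \<beta> else 0)"

definition djet_atlas ::
    "('m::{t2_space,second_countable_topology}, 'n::{finite,linorder}) chart set
       \<Rightarrow> nat \<Rightarrow> ('m djet, 'n + 'n \<times> 'n midx) chart set" where
  "djet_atlas charts k =
     {({\<theta>\<in>djet_space charts k. fst \<theta> \<in> fst c \<and> djet_target \<theta> \<in> fst c'}, djet_coords k c c') | c c'.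
        c \<in> charts \<and> c' \<in> charts}"

definition jets_of ::
    "('m::{t2_space,second_countable_topology}, 'n::{finite,linorder}) chart set
       \<Rightarrow> ('m \<rightharpoonup> 'm) set \<Rightarrow> nat \<Rightarrow> 'm djet set" where
  "jets_of charts P k = {djet charts k \<phi> a | \<phi> a. \<phi> \<in> P \<and> a \<in> dom \<phi>}"

abbreviation jets_of_atlas ::
    "('m::{t2_space,second_countable_topology}, 'n::{finite,linorder}) chart set
       \<Rightarrow> ('m \<rightharpoonup> 'm) set \<Rightarrow> nat \<Rightarrow> ('n + 'n \<times> 'n midx) set
       \<Rightarrow> ('m djet, 'n + 'n \<times> 'n midx) chart set" where
  "jets_of_atlas charts P k K \<equiv> sub_atlas (djet_idx k) (djet_atlas charts k) K (jets_of charts P k)"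

definition regular_pseudogroup ::
    "('m::{t2_space,second_countable_topology}, 'n::{finite,linorder}) chart set
       \<Rightarrow> ('m \<rightharpoonup> 'm) set \<Rightarrow> bool" where
  "regular_pseudogroup charts P \<longleftrightarrow>
     pseudogroup charts P \<and>
     (\<forall>k\<ge>1. \<exists>K.
        submanifold (djet_idx k) (djet_atlas charts k) K (jets_of charts P k) \<and>
        fibre_bundle K (jets_of_atlas charts P k K) UNIV charts fst)"

text \<open>
  The first prolongation of \<open>G\<close>, a subset of the \<open>k\<close>-jets, is the intersection of the space of \<open>1\<close>-jets
  of local sections of \<open>G\<close> with the space of \<open>(k+1)\<close>-jets of local diffeomorphisms, where the
  \<open>(k+1)\<close>-jet of \<open>\<phi>\<close> at \<open>a\<close> is viewed as the \<open>1\<close>-jet at \<open>a\<close> of the section \<open>q \<mapsto> djet charts k \<phi> q\<close>.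
\<close>

definition first_prolongation ::
    "('m::{t2_space,second_countable_topology}, 'n::{finite,linorder}) chart set
       \<Rightarrow> nat \<Rightarrow> 'm djet set \<Rightarrow> 'm djet set" where
  "first_prolongation charts k G =
     {djet charts (Suc k) \<phi> a | \<phi> a. local_diffeo charts \<phi> \<and> a \<in> dom \<phi> \<and>
        (\<exists>V s. open V \<and> a \<in> V \<and>
           smooth_map UNIV charts (djet_idx k) (djet_atlas charts k) V s \<and>
           (\<forall>q\<in>V. s q \<in> G \<and> fst (s q) = q) \<and>
           s a = djet charts k \<phi> a \<and>
           (\<forall>(U, x)\<in>charts. \<forall>c'\<in>charts. a \<in> U \<longrightarrow> the (\<phi> a) \<in> fst c' \<longrightarrow>
              (\<forall>i. \<forall>j\<in>djet_idx k.
                 partial i (\<lambda>v. djet_coords k (U, x) c' (s (inv_into U x v)) j) (x a) =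
                 partial i (\<lambda>v. djet_coords k (U, x) c' (djet charts k \<phi> (inv_into U x v)) j) (x a))))}"

definition lie_pseudogroup ::
    "('m::{t2_space,second_countable_topology}, 'n::{finite,linorder}) chart set
       \<Rightarrow> ('m \<rightharpoonup> 'm) set \<Rightarrow> bool" where
  "lie_pseudogroup charts P \<longleftrightarrow>
     regular_pseudogroup charts P \<and>
     (\<exists>K. (\<forall>k\<ge>1. submanifold (djet_idx k) (djet_atlas charts k) (K k) (jets_of charts P k)) \<and>
        (\<forall>k\<ge>1. fibre_bundle (K (Suc k)) (jets_of_atlas charts P (Suc k) (K (Suc k)))
                  (K k) (jets_of_atlas charts P k (K k)) (djet_proj charts k)) \<and>
        fibre_bundle (K 1) (jets_of_atlas charts P 1 (K 1))
          (UNIV <+> UNIV) (prod_atlas charts charts) (\<lambda>\<theta>. (fst \<theta>, djet_target \<theta>))) \<and>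
     fibre_bundle (UNIV <+> UNIV) (prod_atlas charts charts) UNIV charts fst \<and>
     (\<forall>k\<ge>1. first_prolongation charts k (jets_of charts P k) \<subseteq> jets_of charts P (Suc k))"


section \<open>Scalar linear differential operators and their jets\<close>

text \<open>
  An operator on an open set \<open>V\<close> acts on functions smooth near a point of \<open>V\<close>; its values on other
  arguments are irrelevant.
\<close>

type_synonym 'm oper = "('m \<Rightarrow> real) \<Rightarrow> 'm \<Rightarrow> real"

text \<open>
  If \<open>A\<close> is the sum of the \<open>A\<^sub>\<alpha> \<partial>\<^sup>\<alpha>\<close> in the chart, then \<open>A\<^sub>\<alpha>\<close> at the point with coordinates \<open>v\<close> is the
  value there of \<open>A\<close> on \<open>(x - v)\<^sup>\<alpha> / \<alpha>!\<close>.
\<close>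

definition op_coeff :: "('m, 'n::finite) chart \<Rightarrow> 'm oper \<Rightarrow> 'n midx \<Rightarrow> ('n \<Rightarrow> real) \<Rightarrow> real" where
  "op_coeff = (\<lambda>(U, x) A \<alpha> v.
     A (\<lambda>q. midx_power (\<lambda>i. x q i - v i) \<alpha> / midx_fact \<alpha>) (inv_into U x v))"

definition diff_op ::
    "('m::{t2_space,second_countable_topology}, 'n::{finite,linorder}) chart set
       \<Rightarrow> nat \<Rightarrow> 'm set \<Rightarrow> 'm oper \<Rightarrow> bool" where
  "diff_op charts k V A \<longleftrightarrow>
     (\<forall>(U, x)\<in>charts.
        (\<forall>\<alpha>\<in>midx_le k. smooth_fun UNIV (x ` (U \<inter> V)) (op_coeff (U, x) A \<alpha>)) \<and>
        (\<forall>W f p. open W \<longrightarrow> W \<subseteq> U \<inter> V \<longrightarrow> smooth_scalar UNIV charts W f \<longrightarrow> p \<in> W \<longrightarrow>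
           A f p = (\<Sum>\<alpha>\<in>midx_le k. op_coeff (U, x) A \<alpha> (x p) *
                      iter_deriv partial \<alpha> (\<lambda>v. f (inv_into U x v)) (x p))))"

definition op_equal_on ::
    "('m::{t2_space,second_countable_topology}, 'n::finite) chart set
       \<Rightarrow> 'm set \<Rightarrow> 'm oper \<Rightarrow> 'm oper \<Rightarrow> bool" where
  "op_equal_on charts V A B \<longleftrightarrow>
     (\<forall>W f p. open W \<longrightarrow> W \<subseteq> V \<longrightarrow> smooth_scalar UNIV charts W f \<longrightarrow> p \<in> W \<longrightarrow> A f p = B f p)"

definition pushforward :: "('m \<rightharpoonup> 'm) \<Rightarrow> 'm oper \<Rightarrow> 'm oper" where
  "pushforward \<phi> A f q = A (\<lambda>p. f (the (\<phi> p))) (the (pinv \<phi> q))"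

definition op_deriv ::
    "('m, 'n::{finite,linorder}) chart \<Rightarrow> 'm oper \<Rightarrow> 'm \<Rightarrow> 'n midx \<Rightarrow> 'n midx \<Rightarrow> real" where
  "op_deriv c A p \<alpha> \<beta> = iter_deriv partial \<beta> (op_coeff c A \<alpha>) (snd c p)"

text \<open>The \<open>l\<close>-jet at \<open>p\<close> of the section of the bundle of operators of order \<open>\<le> k\<close> given by \<open>A\<close>.\<close>

type_synonym 'm ojet = "'m \<times> 'm oper set"

definition ojet ::
    "('m::{t2_space,second_countable_topology}, 'n::{finite,linorder}) chart set
       \<Rightarrow> nat \<Rightarrow> nat \<Rightarrow> 'm oper \<Rightarrow> 'm \<Rightarrow> 'm ojet" where
  "ojet charts k l A p = (p, {B. (\<exists>V. open V \<and> p \<in> V \<and> diff_op charts k V B) \<and>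
     (\<forall>c\<in>charts. p \<in> fst c \<longrightarrow>
        (\<forall>\<alpha>\<in>midx_le k. \<forall>\<beta>\<in>midx_le l. op_deriv c B p \<alpha> \<beta> = op_deriv c A p \<alpha> \<beta>))})"

definition ojet_space ::
    "('m::{t2_space,second_countable_topology}, 'n::{finite,linorder}) chart set
       \<Rightarrow> nat \<Rightarrow> nat \<Rightarrow> 'm ojet set" where
  "ojet_space charts k l =
     {ojet charts k l A p | A p. \<exists>V. open V \<and> p \<in> V \<and> diff_op charts k V A}"

definition ojet_rep :: "'m ojet \<Rightarrow> 'm oper" where
  "ojet_rep \<theta> = (SOME A. A \<in> snd \<theta>)"

definition ojet_proj ::
    "('m::{t2_space,second_countable_topology}, 'n::{finite,linorder}) chart set
       \<Rightarrow> nat \<Rightarrow> nat \<Rightarrow> 'm ojet \<Rightarrow> 'm ojet" where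
  "ojet_proj charts k l \<theta> = ojet charts k l (ojet_rep \<theta>) (fst \<theta>)"

text \<open>
  Standard jet coordinates: \<open>Inl i\<close> indexes \<open>x\<^sub>i\<close>, and \<open>Inr (\<alpha>, \<beta>)\<close> indexes the coordinate whose value
  on the jet of \<open>A\<close> is \<open>\<partial>\<^sup>\<beta> A\<^sub>\<alpha>\<close>; in particular \<open>u\<^sub>\<alpha>\<close> has index \<open>Inr (\<alpha>, midx_zero)\<close>.
\<close>

type_synonym 'n ojidx = "'n + 'n midx \<times> 'n midx"

definition ojet_fibre_idx :: "nat \<Rightarrow> nat \<Rightarrow> ('n::finite) ojidx set" where
  "ojet_fibre_idx k l = Inr ` (midx_le k \<times> midx_le l)"

definition ojet_idx :: "nat \<Rightarrow> nat \<Rightarrow> ('n::finite) ojidx set" where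
  "ojet_idx k l = range Inl \<union> ojet_fibre_idx k l"

definition ojet_coords ::
    "nat \<Rightarrow> nat \<Rightarrow> ('m, 'n::{finite,linorder}) chart \<Rightarrow> 'm ojet \<Rightarrow> 'n ojidx \<Rightarrow> real" where
  "ojet_coords k l c \<theta> s =
     (case s of Inl i \<Rightarrow> snd c (fst \<theta>) i
      | Inr (\<alpha>, \<beta>) \<Rightarrow>
          if \<alpha> \<in> midx_le k \<and> \<beta> \<in> midx_le l then op_deriv c (ojet_rep \<theta>) (fst \<theta>) \<alpha> \<beta> else 0)"

definition ojet_over ::
    "('m::{t2_space,second_countable_topology}, 'n::{finite,linorder}) chart set
       \<Rightarrow> nat \<Rightarrow> nat \<Rightarrow> 'm set \<Rightarrow> 'm ojet set" where
  "ojet_over charts k l U = {\<theta>\<in>ojet_space charts k l. fst \<theta> \<in> U}"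

definition ojet_atlas ::
    "('m::{t2_space,second_countable_topology}, 'n::{finite,linorder}) chart set
       \<Rightarrow> nat \<Rightarrow> nat \<Rightarrow> ('m ojet, 'n ojidx) chart set" where
  "ojet_atlas charts k l = {(ojet_over charts k l (fst c), ojet_coords k l c) | c. c \<in> charts}"


section \<open>Total derivatives and the universal operator\<close>

text \<open>
  Expression of a function on the space of \<open>l\<close>-jets in jet coordinates. Coordinates of order greater
  than \<open>l\<close> are discarded, so that it also expresses the pullback to jet spaces of higher order.
\<close>

definition jet_expr ::
    "('m::{t2_space,second_countable_topology}, 'n::{finite,linorder}) chart set
       \<Rightarrow> nat \<Rightarrow> nat \<Rightarrow> ('m, 'n) chart \<Rightarrow> ('m ojet \<Rightarrow> real) \<Rightarrow> ('n ojidx \<Rightarrow> real) \<Rightarrow> real" where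
  "jet_expr charts k l c F v =
     F (inv_into (ojet_over charts k l (fst c)) (ojet_coords k l c)
          (\<lambda>s. if s \<in> ojet_idx k l then v s else 0))"

text \<open>
  The total derivative \<open>d/dx\<^sub>i\<close> of a function of jets of order at most \<open>r\<close>; terms with \<open>\<beta>\<close> of order
  greater than the order of \<open>F\<close> vanish.
\<close>

definition total_deriv ::
    "nat \<Rightarrow> nat \<Rightarrow> 'n::finite \<Rightarrow> (('n ojidx \<Rightarrow> real) \<Rightarrow> real) \<Rightarrow> ('n ojidx \<Rightarrow> real) \<Rightarrow> real" where
  "total_deriv k r i F v =
     partial (Inl i) F v +
     (\<Sum>\<alpha>\<in>midx_le k. \<Sum>\<beta>\<in>midx_le r. v (Inr (\<alpha>, \<beta>(i := Suc (\<beta> i)))) * partial (Inr (\<alpha>, \<beta>)) F v)"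

definition universal_expr ::
    "nat \<Rightarrow> nat \<Rightarrow> (('n::{finite,linorder} ojidx \<Rightarrow> real) \<Rightarrow> real) \<Rightarrow> ('n ojidx \<Rightarrow> real) \<Rightarrow> real" where
  "universal_expr k l F v =
     (\<Sum>\<alpha>\<in>midx_le k. v (Inr (\<alpha>, midx_zero)) * iter_deriv (total_deriv k (l + k)) \<alpha> F v)"

definition chart_at :: "('m, 'n) chart set \<Rightarrow> 'm \<Rightarrow> ('m, 'n) chart" where
  "chart_at charts p = (SOME c. c \<in> charts \<and> p \<in> fst c)"

text \<open>
  The universal operator takes functions of \<open>l\<close>-jets to functions of \<open>(l+k)\<close>-jets. Its coordinate
  expression does not depend on the chart, hence the arbitrary choice of one around the base point.
\<close>

definition universal_op ::
    "('m::{t2_space,second_countable_topology}, 'n::{finite,linorder}) chart set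
       \<Rightarrow> nat \<Rightarrow> nat \<Rightarrow> ('m ojet \<Rightarrow> real) \<Rightarrow> 'm ojet \<Rightarrow> real" where
  "universal_op charts k l F \<theta> =
     (let c = chart_at charts (fst \<theta>)
      in universal_expr k l (jet_expr charts k l c F) (ojet_coords k (l + k) c \<theta>))"


section \<open>Rational invariants\<close>

text \<open>
  A rational function may have poles, so invariants are partial functions. Along each fibre the domain
  is the set where the denominator does not vanish. The equation expressing invariance is an equation
  between options: it includes invariance of the domain.
\<close>

definition rational_invariant ::
    "('m::{t2_space,second_countable_topology}, 'n::{finite,linorder}) chart set
       \<Rightarrow> ('m \<rightharpoonup> 'm) set \<Rightarrow> nat \<Rightarrow> nat \<Rightarrow> ('m ojet \<rightharpoonup> real) \<Rightarrow> bool" where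
  "rational_invariant charts P k l I \<longleftrightarrow>
     mopen (ojet_idx k l) (ojet_atlas charts k l) (dom I) \<and>
     smooth_scalar (ojet_idx k l) (ojet_atlas charts k l) (dom I) (\<lambda>\<theta>. the (I \<theta>)) \<and>
     (\<forall>c\<in>charts. \<forall>p\<in>fst c. \<exists>N D.
        poly_fun (ojet_fibre_idx k l) N \<and> poly_fun (ojet_fibre_idx k l) D \<and>
        (\<exists>\<theta>\<in>ojet_over charts k l {p}. D (ojet_coords k l c \<theta>) \<noteq> 0) \<and>
        (\<forall>\<theta>\<in>ojet_over charts k l {p}.
           I \<theta> = (let v = ojet_coords k l c \<theta> in if D v = 0 then None else Some (N v / D v)))) \<and>
     (\<forall>\<phi>\<in>P. \<forall>V A p. open V \<longrightarrow> diff_op charts k V A \<longrightarrow> p \<in> V \<inter> dom \<phi> \<longrightarrow>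
        I (ojet charts k l (pushforward \<phi> A) (the (\<phi> p))) = I (ojet charts k l A p))"

text \<open>
  The wedge product of the total differentials of the \<open>I i\<close> is the determinant of the total derivatives
  times the coordinate volume form. It is a form along the projection from \<open>(l+1)\<close>-jets: at \<open>\<theta> \<in> S\<close> its
  coefficient is a function on the fibre of \<open>(l+1)\<close>-jets over \<open>\<theta>\<close>, required not to be the zero function.
\<close>

definition general_position ::
    "('m::{t2_space,second_countable_topology}, 'n::{finite,linorder}) chart set
       \<Rightarrow> nat \<Rightarrow> nat \<Rightarrow> ('n \<Rightarrow> 'm ojet \<rightharpoonup> real) \<Rightarrow> 'm ojet set \<Rightarrow> bool" where
  "general_position charts k l I S \<longleftrightarrow>
     (\<forall>\<theta>\<in>S. (\<forall>i. \<theta> \<in> dom (I i)) \<and>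
        (\<exists>\<theta>'\<in>ojet_space charts k (Suc l). ojet_proj charts k l \<theta>' = \<theta> \<and>
           (let c = chart_at charts (fst \<theta>)
            in det (\<chi> i j. total_deriv k l j (jet_expr charts k l c (\<lambda>\<eta>. the (I i \<eta>)))
                             (ojet_coords k (Suc l) c \<theta>')) \<noteq> 0)))"


section \<open>Models and equivalence of operators\<close>

definition inv_value ::
    "('m::{t2_space,second_countable_topology}, 'n::{finite,linorder}) chart set
       \<Rightarrow> nat \<Rightarrow> nat \<Rightarrow> ('n \<Rightarrow> 'm ojet \<rightharpoonup> real) \<Rightarrow> 'm oper \<Rightarrow> 'm \<Rightarrow> 'n \<Rightarrow> real" where
  "inv_value charts k l I A p i = the (I i (ojet charts k l A p))"

definition inv_multi ::
    "('m::{t2_space,second_countable_topology}, 'n::{finite,linorder}) chart set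
       \<Rightarrow> nat \<Rightarrow> nat \<Rightarrow> ('n \<Rightarrow> 'm ojet \<rightharpoonup> real) \<Rightarrow> 'n midx \<Rightarrow> 'm ojet \<Rightarrow> real" where
  "inv_multi charts k l I \<alpha> \<theta> =
     universal_op charts k l (\<lambda>\<eta>. midx_power (\<lambda>i. the (I i \<eta>)) \<alpha>) \<theta> / midx_fact \<alpha>"

definition adjusted ::
    "('m::{t2_space,second_countable_topology}, 'n::{finite,linorder}) chart set
       \<Rightarrow> nat \<Rightarrow> nat \<Rightarrow> ('n \<Rightarrow> 'm ojet \<rightharpoonup> real) \<Rightarrow> 'm ojet set \<Rightarrow> 'm oper \<Rightarrow> 'm set \<Rightarrow> bool" where
  "adjusted charts k l I S A V \<longleftrightarrow>
     (\<forall>p\<in>V. ojet charts k l A p \<in> S) \<and>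
     (V, inv_value charts k l I A) \<in> max_atlas UNIV charts"

text \<open>The map to the space with coordinates \<open>y\<^sub>i\<close> and \<open>Y\<^sub>\<alpha>\<close> for \<open>\<alpha>\<close> of order at most \<open>k\<close>.\<close>

definition model_map ::
    "('m::{t2_space,second_countable_topology}, 'n::{finite,linorder}) chart set
       \<Rightarrow> nat \<Rightarrow> nat \<Rightarrow> ('n \<Rightarrow> 'm ojet \<rightharpoonup> real) \<Rightarrow> 'm oper \<Rightarrow> 'm
       \<Rightarrow> ('n \<Rightarrow> real) \<times> ('n midx \<Rightarrow> real)" where
  "model_map charts k l I A p =
     (inv_value charts k l I A p,
      \<lambda>\<alpha>. if \<alpha> \<in> midx_le k then inv_multi charts k l I \<alpha> (ojet charts k (l + k) A p) else 0)"

definition psi_map ::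
    "('m::{t2_space,second_countable_topology}, 'n::{finite,linorder}) chart set
       \<Rightarrow> nat \<Rightarrow> nat \<Rightarrow> ('n \<Rightarrow> 'm ojet \<rightharpoonup> real) \<Rightarrow> 'm oper \<Rightarrow> 'm set \<Rightarrow> 'm oper \<Rightarrow> 'm set
       \<Rightarrow> ('m \<rightharpoonup> 'm)" where
  "psi_map charts k l I A V B W =
     (\<lambda>p. if p \<in> V
          then Some (inv_into W (model_map charts k l I B) (model_map charts k l I A p)) else None)"

definition op_equivalent ::
    "('m::{t2_space,second_countable_topology}, 'n::{finite,linorder}) chart set
       \<Rightarrow> ('m \<rightharpoonup> 'm) set \<Rightarrow> 'm oper \<Rightarrow> 'm set \<Rightarrow> 'm oper \<Rightarrow> 'm set \<Rightarrow> bool" where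
  "op_equivalent charts P A V B W \<longleftrightarrow>
     (\<exists>\<psi>\<in>P. dom \<psi> = V \<and> ran \<psi> = W \<and> op_equal_on charts W (pushforward \<psi> A) B)"

end

theory Submission
  imports Defs
begin

text \<open>
  Why the theorem holds. Since \<open>I\<^sub>1(A), \<dots>, I\<^sub>n(A)\<close> are coordinates on \<open>Oa\<close> and \<open>I\<^sub>1(B), \<dots>, I\<^sub>n(B)\<close> are
  coordinates on \<open>Ob\<close>, coinciding models match the points of \<open>Oa\<close> and \<open>Ob\<close> with the same coordinates,
  which defines a diffeomorphism \<open>\<psi>\<close>, the only map preserving all the invariants
  (\<open>psi_map_of_equal_models\<close>).

  The key fact is that the remaining coordinates \<open>Y\<^sub>\<alpha>\<close> of the model are the values of \<open>A\<close> on the divided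
  powers of \<open>I(A)\<close> (\<open>inv_multi_eq\<close>). This is the defining property of the universal operator: by the
  chain rule, the total derivative of a function of jets, restricted to the jet of a section, is the
  partial derivative of the restriction (\<open>total_deriv_section\<close>).

  An operator is determined by these values. In a chart \<open>y\<close> of the maximal atlas, \<open>A\<close> has the coefficients
  \<open>A((y - v)\<^sup>\<alpha>/\<alpha>!)\<close> at the point with coordinates \<open>v\<close> (\<open>diff_op_taylor\<close>): \<open>f\<close> and its Taylor polynomial
  in \<open>y\<close> differ by a function all of whose derivatives of order at most \<open>k\<close> vanish at the point, and this
  property is independent of coordinates (\<open>flat_comp\<close>). For \<open>y = I(A)\<close>, binomial expansion expresses the
  coefficients through \<open>v\<close> and the \<open>Y\<^sub>\<gamma>\<close>, so operators with the same model have the same coefficients in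
  the coordinates given by the invariants, that is, \<open>\<psi>\<close> carries \<open>A\<close> to \<open>B\<close> (\<open>equivalent_of_models\<close>).

  Conversely, an element of the pseudogroup carrying \<open>A\<close> to \<open>B\<close> preserves the invariants and the values of
  the operators on their monomials, hence the models, and so it is equal to \<open>\<psi>\<close>
  (\<open>models_of_equivalent\<close>).
\<close>

section \<open>Calculus in finitely many coordinates\<close>

text \<open>
  Regularity is defined through iterated partial derivatives, so the chain rule, the closure properties
  and the symmetry of second derivatives are derived from the mean value theorem in one variable.
\<close>

lemma rspace_upd: "v \<in> rspace J \<Longrightarrow> i \<in> J \<Longrightarrow> v(i := t) \<in> rspace J"
  by (auto simp: rspace_def)

lemma ropen_subset: "ropen J W \<Longrightarrow> W \<subseteq> rspace J"
  by (auto dest: openin_imp_subset)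

lemma ropen_UNIV: "ropen UNIV W = open W"
  by (simp add: rspace_def)

lemma continuous_on_upd: "continuous_on S (\<lambda>t::real. v(i := t))"
proof (rule continuous_on_coordinatewise_then_product)
  show "continuous_on S (\<lambda>t::real. (v(i := t)) j)" for j
    by (cases "j = i") (simp_all add: continuous_on_const continuous_on_id)
qed

lemma ropen_box:
  fixes v :: "'i \<Rightarrow> real"
  assumes "finite J" "ropen J W" "v \<in> W"
  obtains d where "d > 0" "\<And>w. w \<in> rspace J \<Longrightarrow> (\<And>j. j \<in> J \<Longrightarrow> \<bar>w j - v j\<bar> < d) \<Longrightarrow> w \<in> W"
proof -
  obtain T where T: "open T" "W = rspace J \<inter> T"
    using assms(2) by (auto simp: openin_open)
  have "openin (product_topology (\<lambda>_. euclidean) UNIV) T"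
    using T(1) by (simp add: open_fun_def)
  from product_topology_open_contains_basis[OF this, of v]
  obtain X where X: "v \<in> Pi\<^sub>E UNIV X" "\<And>i. open (X i)" "Pi\<^sub>E UNIV X \<subseteq> T"
    using assms(3) T(2) by auto
  have "\<exists>e>0. \<forall>t. \<bar>t - v j\<bar> < e \<longrightarrow> t \<in> X j" for j
    using X(1,2) unfolding open_dist dist_real_def by (auto simp: PiE_def Pi_def)
  then obtain e where e: "\<And>j. e j > 0" "\<And>j t. \<bar>t - v j\<bar> < e j \<Longrightarrow> t \<in> X j"
    by metis
  define d where "d = Min (insert 1 (e ` J))"
  have d: "d > 0" "\<And>j. j \<in> J \<Longrightarrow> d \<le> e j"
    using assms(1) e(1) by (auto simp: d_def)
  show ?thesis
  proof (rule that[OF d(1)])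
    fix w assume w: "w \<in> rspace J" "\<And>j. j \<in> J \<Longrightarrow> \<bar>w j - v j\<bar> < d"
    have "w j \<in> X j" for j
    proof (cases "j \<in> J")
      case True then show ?thesis using w(2) d(2) e(2) by force
    next
      case False
      then have "w j = v j" using w(1) assms(3) T(2) by (auto simp: rspace_def)
      then show ?thesis using X(1) by (auto simp: PiE_def Pi_def)
    qed
    then show "w \<in> W" using w(1) X(3) T(2) by (auto simp: PiE_def Pi_def)
  qed
qed

lemma continuous_on_box:
  fixes f :: "('i \<Rightarrow> real) \<Rightarrow> real"
  assumes "finite J" "ropen J W" "v \<in> W" "continuous_on W f" "e > 0"
  shows "\<exists>d>0. \<forall>w\<in>rspace J. (\<forall>j\<in>J. \<bar>w j - v j\<bar> < d) \<longrightarrow> w \<in> W \<and> \<bar>f w - f v\<bar> < e"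
proof -
  have "openin (top_of_set W) (W \<inter> f -` ball (f v) e)"
    using assms(4) by (intro continuous_openin_preimage_gen) auto
  then have "ropen J (W \<inter> f -` ball (f v) e)"
    using assms(2) openin_trans by blast
  from ropen_box[OF assms(1) this, of v] assms(3,5)
  obtain d where "d > 0" "\<And>w. w \<in> rspace J \<Longrightarrow> (\<And>j. j \<in> J \<Longrightarrow> \<bar>w j - v j\<bar> < d) \<Longrightarrow> w \<in> W \<inter> f -` ball (f v) e"
    by auto
  then show ?thesis by (auto simp: dist_real_def abs_minus_commute intro!: exI[of _ d])
qed

lemma eventually_line:
  assumes "ropen J W" "v \<in> W" "i \<in> J"
  shows "eventually (\<lambda>t. v(i := t) \<in> W) (nhds (v i))"
proof -
  obtain T where T: "open T" "W = rspace J \<inter> T"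
    using assms(1) by (auto simp: openin_open)
  have "open ((\<lambda>t. v(i := t)) -` T)"
    using T(1) continuous_on_upd by (intro open_vimage) auto
  moreover have "v i \<in> (\<lambda>t. v(i := t)) -` T" using assms T by auto
  ultimately have "eventually (\<lambda>t. t \<in> (\<lambda>t. v(i := t)) -` T) (nhds (v i))"
    by (rule eventually_nhds_in_open)
  then show ?thesis
    by (rule eventually_mono) (use assms T in \<open>auto intro: rspace_upd\<close>)
qed

lemma partial_cong_on:
  assumes "ropen J W" "v \<in> W" "i \<in> J" "\<And>w. w \<in> W \<Longrightarrow> f w = g w"
  shows "partial i f v = partial i g v"
  unfolding partial_def
  by (rule deriv_cong_ev) (use eventually_line[OF assms(1-3)] assms(4) in \<open>auto elim: eventually_mono\<close>)

lemma differentiable_line_cong_on: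
  fixes f g :: "('i \<Rightarrow> real) \<Rightarrow> real"
  assumes "ropen J W" "v \<in> W" "i \<in> J" "\<And>w. w \<in> W \<Longrightarrow> f w = g w"
    and "(\<lambda>t. f (v(i := t))) differentiable at (v i)"
  shows "(\<lambda>t. g (v(i := t))) differentiable at (v i)"
proof -
  obtain D where "((\<lambda>t. f (v(i := t))) has_real_derivative D) (at (v i))"
    using assms(5) real_differentiable_def by blast
  then have "((\<lambda>t. g (v(i := t))) has_real_derivative D) (at (v i))"
    by (rule DERIV_cong_ev[THEN iffD1, rotated -1])
      (use eventually_line[OF assms(1-3)] assms(4) in \<open>auto elim: eventually_mono\<close>)
  then show ?thesis using real_differentiable_def by blast
qed

lemma Ck_on_mono: "Ck_on r J W f \<Longrightarrow> W' \<subseteq> W \<Longrightarrow> Ck_on r J W' f"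
  by (induction r arbitrary: f) (auto intro: continuous_on_subset)

lemma Ck_on_imp_continuous: "Ck_on r J W f \<Longrightarrow> continuous_on W f"
  by (cases r) auto

lemma Ck_on_SucD: "Ck_on (Suc r) J W f \<Longrightarrow> Ck_on r J W f"
  by (induction r arbitrary: f) auto

lemma Ck_on_le: "Ck_on n J W f \<Longrightarrow> m \<le> n \<Longrightarrow> Ck_on m J W f"
proof (induction n)
  case (Suc n)
  then show ?case using Ck_on_SucD[of n J W f] by (cases "m = Suc n") (simp_all del: Ck_on.simps)
qed simp

lemma Ck_on_cong:
  assumes "ropen J W" "\<And>w. w \<in> W \<Longrightarrow> f w = g w" "Ck_on r J W f"
  shows "Ck_on r J W g"
  using assms(2,3)
proof (induction r arbitrary: f g)
  case 0 then show ?case by (simp add: continuous_on_cong[of W W f g])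
next
  case (Suc r)
  have f: "continuous_on W f" "\<And>i v. i \<in> J \<Longrightarrow> v \<in> W \<Longrightarrow> (\<lambda>t. f (v(i := t))) differentiable at (v i)"
    "\<And>i. i \<in> J \<Longrightarrow> Ck_on r J W (partial i f)"
    using Suc.prems(2) by simp_all
  have "Ck_on r J W (partial i g)" if "i \<in> J" for i
    by (rule Suc.IH[OF _ f(3)[OF that]]) (rule partial_cong_on[OF assms(1) _ that Suc.prems(1)])
  moreover have "continuous_on W g"
    using f(1) continuous_on_cong[OF refl Suc.prems(1), of W] by simp
  moreover have "(\<lambda>t. g (v(i := t))) differentiable at (v i)" if "i \<in> J" "v \<in> W" for i v
    using differentiable_line_cong_on[OF assms(1) that(2,1) Suc.prems(1) f(2)[OF that]] .
  ultimately show ?case by simp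
qed

lemma has_partial:
  assumes "Ck_on (Suc r) J W f" "v \<in> W" "i \<in> J"
  shows "((\<lambda>t. f (v(i := t))) has_real_derivative partial i f v) (at (v i))"
  using assms unfolding partial_def by (auto simp: DERIV_deriv_iff_real_differentiable)

lemma has_partial_upd:
  assumes "Ck_on (Suc r) J W f" "v(i := s) \<in> W" "i \<in> J"
  shows "((\<lambda>t. f (v(i := t))) has_real_derivative partial i f (v(i := s))) (at s)"
  using has_partial[OF assms] by simp

lemma partial_eqI:
  "((\<lambda>t. f (v(i := t))) has_real_derivative D) (at (v i)) \<Longrightarrow> partial i f v = D"
  unfolding partial_def by (rule DERIV_imp_deriv)

lemma mvt_line:
  fixes g :: "real \<Rightarrow> real"
  assumes "\<And>t. t \<in> closed_segment a b \<Longrightarrow> (g has_real_derivative g' t) (at t)"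
  obtains x where "x \<in> closed_segment a b" "g b - g a = (b - a) * g' x"
proof -
  consider "a < b" | "a = b" | "b < a" by linarith
  then show ?thesis
  proof cases
    case 1
    with MVT2[of a b g g'] assms obtain z where "z > a" "z < b" "g b - g a = (b - a) * g' z"
      by (auto simp: closed_segment_eq_real_ivl)
    then show ?thesis using 1 that[of z] by (auto simp: closed_segment_eq_real_ivl)
  next
    case 2 then show ?thesis using that[of a] by auto
  next
    case 3
    with MVT2[of b a g g'] assms obtain z where "z > b" "z < a" "g a - g b = (a - b) * g' z"
      by (auto simp: closed_segment_eq_real_ivl)
    then show ?thesis using 3 that[of z] by (auto simp: closed_segment_eq_real_ivl algebra_simps)
  qed
qed

text \<open>A function with continuous partial derivatives is differentiable at \<open>v\<close>.\<close>

lemma C1_increment: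
  assumes J: "finite J" "ropen J W" and f: "Ck_on (Suc 0) J W f" and v: "v \<in> W" and e: "e > 0"
  shows "\<exists>d>0. \<forall>w\<in>rspace J. (\<forall>j\<in>J. \<bar>w j - v j\<bar> < d) \<longrightarrow>
       \<bar>f w - f v - (\<Sum>j\<in>J. partial j f v * (w j - v j))\<bar> \<le> e * (\<Sum>j\<in>J. \<bar>w j - v j\<bar>)"
proof -
  have "\<exists>d>0. \<forall>w. w \<in> rspace J \<longrightarrow> (\<forall>j\<in>J. \<bar>w j - v j\<bar> < d) \<longrightarrow>
      w \<in> W \<and> \<bar>partial i f w - partial i f v\<bar> < e" if "i \<in> J" for i
  proof -
    have "continuous_on W (partial i f)" using f that by auto
    from continuous_on_box[OF J v this e] show ?thesis by blast
  qed
  then obtain D where D: "\<And>i. i \<in> J \<Longrightarrow> D i > 0"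
    "\<And>i w. i \<in> J \<Longrightarrow> w \<in> rspace J \<Longrightarrow> (\<forall>j\<in>J. \<bar>w j - v j\<bar> < D i) \<Longrightarrow>
       w \<in> W \<and> \<bar>partial i f w - partial i f v\<bar> < e"
    by metis
  define d where "d = Min (insert 1 (D ` J))"
  have d: "d > 0" "\<And>j. j \<in> J \<Longrightarrow> d \<le> D j"
    using J(1) D(1) by (auto simp: d_def)
  have box: "w \<in> W \<and> \<bar>partial i f w - partial i f v\<bar> < e"
    if "i \<in> J" "w \<in> rspace J" "\<And>j. j \<in> J \<Longrightarrow> \<bar>w j - v j\<bar> < d" for i w
    using D(2)[OF that(1,2)] d(2)[OF that(1)] that(3) by (meson less_le_trans)
  have vJ: "v \<in> rspace J" using v J(2) ropen_subset by blast
  \<comment> \<open>The coordinates in \<open>S\<close> are moved one at a time.\<close>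
  have step: "\<bar>f w - f v - (\<Sum>j\<in>S. partial j f v * (w j - v j))\<bar> \<le> e * (\<Sum>j\<in>S. \<bar>w j - v j\<bar>)"
    if "finite S" "S \<subseteq> J" "w \<in> rspace J" "\<And>j. j \<in> J \<Longrightarrow> \<bar>w j - v j\<bar> < d"
      "\<And>j. j \<notin> S \<Longrightarrow> w j = v j" for S w
    using that
  proof (induction S arbitrary: w rule: finite_induct)
    case empty
    then have "w = v" by auto
    then show ?case by simp
  next
    case (insert i S)
    define w' where "w' = w(i := v i)"
    have i: "i \<in> J" using insert.prems by auto
    have w': "w' \<in> rspace J" "\<And>j. j \<in> J \<Longrightarrow> \<bar>w' j - v j\<bar> < d" "\<And>j. j \<notin> S \<Longrightarrow> w' j = v j"
      using insert.prems i d(1) by (auto simp: w'_def intro: rspace_upd)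
    have IH: "\<bar>f w' - f v - (\<Sum>j\<in>S. partial j f v * (w' j - v j))\<bar> \<le> e * (\<Sum>j\<in>S. \<bar>w' j - v j\<bar>)"
      using insert.prems w' by (intro insert.IH) auto
    have S: "(\<Sum>j\<in>S. partial j f v * (w' j - v j)) = (\<Sum>j\<in>S. partial j f v * (w j - v j))"
      "(\<Sum>j\<in>S. \<bar>w' j - v j\<bar>) = (\<Sum>j\<in>S. \<bar>w j - v j\<bar>)"
      using insert.hyps by (auto simp: w'_def intro!: sum.cong)
    have seg: "w(i := t) \<in> W \<and> \<bar>partial i f (w(i := t)) - partial i f v\<bar> < e"
      if "t \<in> closed_segment (v i) (w i)" for t
    proof (rule box[OF i])
      show "w(i := t) \<in> rspace J" using insert.prems i by (auto intro: rspace_upd)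
      have "\<bar>t - v i\<bar> \<le> \<bar>w i - v i\<bar>" using that by (auto simp: closed_segment_eq_real_ivl split: if_splits)
      then show "\<bar>(w(i := t)) j - v j\<bar> < d" if "j \<in> J" for j
        using insert.prems(3)[OF that] by auto
    qed
    obtain x where x: "x \<in> closed_segment (v i) (w i)"
      "f (w(i := w i)) - f (w(i := v i)) = (w i - v i) * partial i f (w(i := x))"
      using mvt_line[of "v i" "w i" "\<lambda>t. f (w(i := t))" "\<lambda>t. partial i f (w(i := t))"]
        has_partial_upd[OF f _ i] seg by metis
    have tri: "\<bar>a + b * c\<bar> \<le> \<bar>a\<bar> + \<bar>b\<bar> * \<bar>c\<bar>" for a b c :: real
      by (metis abs_mult abs_triangle_ineq)
    have eq: "f w - f v - (\<Sum>j\<in>insert i S. partial j f v * (w j - v j)) =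
        (f w' - f v - (\<Sum>j\<in>S. partial j f v * (w' j - v j)))
        + (w i - v i) * (partial i f (w(i := x)) - partial i f v)"
      using x(2) insert.hyps unfolding S(1) by (simp add: w'_def algebra_simps)
    have "\<bar>f w - f v - (\<Sum>j\<in>insert i S. partial j f v * (w j - v j))\<bar> \<le> \<bar>f w' - f v - (\<Sum>j\<in>S. partial j f v * (w' j - v j))\<bar>
        + \<bar>w i - v i\<bar> * \<bar>partial i f (w(i := x)) - partial i f v\<bar>"
      unfolding eq by (rule tri)
    also have "\<dots> \<le> e * (\<Sum>j\<in>S. \<bar>w j - v j\<bar>) + \<bar>w i - v i\<bar> * e"
    proof (rule add_mono)
      show "\<bar>w i - v i\<bar> * \<bar>partial i f (w(i := x)) - partial i f v\<bar> \<le> \<bar>w i - v i\<bar> * e"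
        using seg[OF x(1)] by (intro mult_left_mono) simp_all
    qed (rule IH[unfolded S(2)])
    also have "\<dots> = e * (\<Sum>j\<in>insert i S. \<bar>w j - v j\<bar>)"
      using insert.hyps by (simp add: distrib_left)
    finally show ?case .
  qed
  show ?thesis
  proof (intro exI[of _ d] conjI ballI impI d(1))
    fix w assume w: "w \<in> rspace J" "\<forall>j\<in>J. \<bar>w j - v j\<bar> < d"
    show "\<bar>f w - f v - (\<Sum>j\<in>J. partial j f v * (w j - v j))\<bar> \<le> e * (\<Sum>j\<in>J. \<bar>w j - v j\<bar>)"
      by (rule step[OF J(1) order_refl w(1)]) (use w vJ in \<open>auto simp: rspace_def\<close>)
  qed
qed


lemma Ck_on_partial: "Ck_on (Suc r) J W f \<Longrightarrow> i \<in> J \<Longrightarrow> Ck_on r J W (partial i f)"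
  by simp

text \<open>The inductive step of every regularity proof: it suffices to exhibit the partial derivatives.\<close>

lemma Ck_on_SucI:
  fixes f :: "('i \<Rightarrow> real) \<Rightarrow> real"
  assumes "ropen J W" "continuous_on W f"
    and D: "\<And>i v. i \<in> J \<Longrightarrow> v \<in> W \<Longrightarrow> ((\<lambda>t. f (v(i := t))) has_real_derivative D i v) (at (v i))"
    and "\<And>i. i \<in> J \<Longrightarrow> Ck_on r J W (D i)"
  shows "Ck_on (Suc r) J W f"
proof -
  have "Ck_on r J W (partial i f)" if "i \<in> J" for i
    by (rule Ck_on_cong[OF assms(1) _ assms(4)[OF that]]) (simp add: partial_eqI[OF D[OF that]])
  moreover have "(\<lambda>t. f (v(i := t))) differentiable at (v i)" if "i \<in> J" "v \<in> W" for i v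
    using D[OF that] real_differentiable_def by blast
  ultimately show ?thesis using assms(2) by simp
qed

declare Ck_on.simps(2) [simp del]

text \<open>
  The curve need only be differentiable at the parameter \<open>a\<close>; partial derivatives of a composition are
  the case of the curves obtained by varying one coordinate.
\<close>

lemma chain_rule_curve:
  fixes g :: "real \<Rightarrow> 'i \<Rightarrow> real"
  assumes J: "finite J" "ropen J W" and f: "Ck_on (Suc 0) J W f" and v: "g a \<in> W"
    and g: "eventually (\<lambda>t. g t \<in> rspace J) (nhds a)"
    and g': "\<And>j. j \<in> J \<Longrightarrow> ((\<lambda>t. g t j) has_real_derivative g' j) (at a)"
  shows "((\<lambda>t. f (g t)) has_real_derivative (\<Sum>j\<in>J. partial j f (g a) * g' j)) (at a)"
proof -
  define q where "q j t = (g t j - g a j) / (t - a)" for j t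
  define L where "L t = (\<Sum>j\<in>J. partial j f (g a) * q j t)" for t
  have q: "(q j \<longlongrightarrow> g' j) (at a)" if "j \<in> J" for j
    using g'[OF that] unfolding has_field_derivative_iff q_def by simp
  have L: "(L \<longlongrightarrow> (\<Sum>j\<in>J. partial j f (g a) * g' j)) (at a)"
    unfolding L_def by (intro tendsto_sum tendsto_mult tendsto_const q)
  define M where "M = (\<Sum>j\<in>J. \<bar>g' j\<bar>) + 1"
  have M: "M > 0" unfolding M_def by (smt (verit) sum_nonneg abs_ge_zero)
  have "((\<lambda>t. \<Sum>j\<in>J. \<bar>q j t\<bar>) \<longlongrightarrow> (\<Sum>j\<in>J. \<bar>g' j\<bar>)) (at a)"
    by (intro tendsto_sum tendsto_rabs q)
  then have qM: "eventually (\<lambda>t. (\<Sum>j\<in>J. \<bar>q j t\<bar>) < M) (at a)"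
    by (rule order_tendstoD) (simp add: M_def)
  have "((\<lambda>t. (f (g t) - f (g a)) / (t - a) - L t) \<longlongrightarrow> 0) (at a)"
  proof (rule tendstoI)
    fix e :: real assume "e > 0"
    then have "e / M > 0" using M by simp
    from C1_increment[OF J f v this] obtain d where d: "d > 0"
      "\<And>w. w \<in> rspace J \<Longrightarrow> \<forall>j\<in>J. \<bar>w j - g a j\<bar> < d \<Longrightarrow>
       \<bar>f w - f (g a) - (\<Sum>j\<in>J. partial j f (g a) * (w j - g a j))\<bar> \<le> e / M * (\<Sum>j\<in>J. \<bar>w j - g a j\<bar>)"
      by blast
    have e1: "eventually (\<lambda>t. \<forall>j\<in>J. \<bar>g t j - g a j\<bar> < d) (at a)"
    proof (rule eventually_ball_finite[OF J(1)], intro ballI)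
      fix j assume "j \<in> J"
      then have "((\<lambda>t. g t j) \<longlongrightarrow> g a j) (at a)"
        using DERIV_isCont[OF g'] by (simp add: isCont_def)
      from tendstoD[OF this d(1)] show "eventually (\<lambda>t. \<bar>g t j - g a j\<bar> < d) (at a)"
        by (simp add: dist_real_def)
    qed
    have e2: "eventually (\<lambda>t. g t \<in> rspace J) (at a)"
      using g by (simp add: eventually_nhds_conv_at)
    have est: "dist ((f (g t) - f (g a)) / (t - a) - L t) 0 < e"
      if "\<forall>j\<in>J. \<bar>g t j - g a j\<bar> < d" "g t \<in> rspace J" "(\<Sum>j\<in>J. \<bar>q j t\<bar>) < M" for t
    proof -
      have Lq': "(\<Sum>j\<in>J. \<bar>q j t\<bar>) = (\<Sum>j\<in>J. \<bar>g t j - g a j\<bar>) / \<bar>t - a\<bar>"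
        by (simp add: q_def abs_divide sum_divide_distrib)
      have Lq: "L t = (\<Sum>j\<in>J. partial j f (g a) * (g t j - g a j)) / (t - a)"
        by (simp add: L_def q_def sum_divide_distrib)
      have "(f (g t) - f (g a)) / (t - a) - L t
          = (f (g t) - f (g a) - (\<Sum>j\<in>J. partial j f (g a) * (g t j - g a j))) / (t - a)"
        by (simp only: Lq diff_divide_distrib)
      then have "\<bar>(f (g t) - f (g a)) / (t - a) - L t\<bar>
          = \<bar>f (g t) - f (g a) - (\<Sum>j\<in>J. partial j f (g a) * (g t j - g a j))\<bar> / \<bar>t - a\<bar>"
        by (simp only: abs_divide)
      also have "\<dots> \<le> e / M * (\<Sum>j\<in>J. \<bar>g t j - g a j\<bar>) / \<bar>t - a\<bar>"
        by (rule divide_right_mono[OF d(2)]) (use that in auto)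
      also have "\<dots> = e / M * (\<Sum>j\<in>J. \<bar>q j t\<bar>)"
        by (simp only: Lq' times_divide_eq_right)
      also have "\<dots> < e / M * M"
        using that(3) \<open>e / M > 0\<close> by (rule mult_strict_left_mono)
      finally show ?thesis using M by (simp add: dist_real_def)
    qed
    show "eventually (\<lambda>t. dist ((f (g t) - f (g a)) / (t - a) - L t) 0 < e) (at a)"
      by (rule eventually_mono[OF eventually_conj[OF e1 eventually_conj[OF e2 qM]]])
        (use est in blast)
  qed
  from tendsto_add[OF this L] show ?thesis
    unfolding has_field_derivative_iff by simp
qed

lemma Ck_on_const: "Ck_on r J W (\<lambda>_. c)"
proof (induction r arbitrary: c)
  case (Suc r)
  have "partial i (\<lambda>_. c) = (\<lambda>_. 0)" for i :: 'a by (auto simp: partial_def)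
  then show ?case using Suc by (simp add: Ck_on.simps(2))
qed simp

lemma partial_coord: "partial i (\<lambda>v. v c) = (\<lambda>_. if i = c then 1 else 0)"
  by (auto simp: partial_def fun_eq_iff)

lemma Ck_on_coord: "Ck_on r J W (\<lambda>v. v c)"
proof -
  have "continuous_on W (\<lambda>v. v c)"
    by (rule continuous_on_product_then_coordinatewise[OF continuous_on_id])
  moreover have "(\<lambda>t. (v(i := t)) c) differentiable at (v i)" for v :: "'a \<Rightarrow> real" and i
    by (cases "i = c") auto
  ultimately show ?thesis
    by (cases r) (simp_all add: Ck_on.simps(2) partial_coord Ck_on_const)
qed

lemma Ck_on_add:
  assumes "ropen J W" "Ck_on r J W f" "Ck_on r J W g"
  shows "Ck_on r J W (\<lambda>v. f v + g v)"
  using assms(2,3)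
proof (induction r arbitrary: f g)
  case 0 then show ?case by (auto intro: continuous_intros)
next
  case (Suc r)
  show ?case
  proof (rule Ck_on_SucI[OF assms(1), where D = "\<lambda>i v. partial i f v + partial i g v"])
    show "continuous_on W (\<lambda>v. f v + g v)"
      by (intro continuous_on_add Suc.prems[THEN Ck_on_imp_continuous])
  next
    fix i assume i: "i \<in> J"
    show "Ck_on r J W (\<lambda>v. partial i f v + partial i g v)"
      by (intro Suc.IH Suc.prems[THEN Ck_on_partial] i)
    show "((\<lambda>t. f (v(i := t)) + g (v(i := t))) has_real_derivative partial i f v + partial i g v) (at (v i))"
      if "v \<in> W" for v
      by (intro DERIV_add Suc.prems[THEN has_partial] that i)
  qed
qed

lemma Ck_on_mult:
  assumes "ropen J W" "Ck_on r J W f" "Ck_on r J W g"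
  shows "Ck_on r J W (\<lambda>v. f v * g v)"
  using assms(2,3)
proof (induction r arbitrary: f g)
  case 0 then show ?case by (auto intro: continuous_intros)
next
  case (Suc r)
  show ?case
  proof (rule Ck_on_SucI[OF assms(1), where D = "\<lambda>i v. partial i f v * g v + partial i g v * f v"])
    show "continuous_on W (\<lambda>v. f v * g v)"
      by (intro continuous_on_mult Suc.prems[THEN Ck_on_imp_continuous])
  next
    fix i assume i: "i \<in> J"
    show "Ck_on r J W (\<lambda>v. partial i f v * g v + partial i g v * f v)"
      by (intro Ck_on_add assms(1) Suc.IH Suc.prems[THEN Ck_on_partial] Suc.prems[THEN Ck_on_SucD] i)
    show "((\<lambda>t. f (v(i := t)) * g (v(i := t))) has_real_derivative
        partial i f v * g v + partial i g v * f v) (at (v i))" if "v \<in> W" for v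
      using DERIV_mult[OF has_partial[OF Suc.prems(1) that i] has_partial[OF Suc.prems(2) that i]]
      by (simp only: fun_upd_triv)
  qed
qed

lemma Ck_on_sum:
  assumes "ropen J W" "\<And>a. a \<in> S \<Longrightarrow> Ck_on r J W (f a)"
  shows "Ck_on r J W (\<lambda>v. \<Sum>a\<in>S. f a v)"
  using assms(2) by (induction S rule: infinite_finite_induct) (auto intro!: Ck_on_const Ck_on_add assms(1))

lemma Ck_on_prod:
  assumes "ropen J W" "\<And>a. a \<in> S \<Longrightarrow> Ck_on r J W (f a)"
  shows "Ck_on r J W (\<lambda>v. \<Prod>a\<in>S. f a v)"
  using assms(2) by (induction S rule: infinite_finite_induct) (auto intro!: Ck_on_const Ck_on_mult assms(1))

lemma partial_comp:
  assumes "finite K" "ropen K W" "ropen J V" "Ck_on (Suc 0) K W f"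
    and "\<And>v. v \<in> V \<Longrightarrow> h v \<in> W" and "\<And>j. j \<in> K \<Longrightarrow> Ck_on (Suc 0) J V (\<lambda>v. h v j)"
    and "v \<in> V" "i \<in> J"
  shows "((\<lambda>t. f (h (v(i := t)))) has_real_derivative
      (\<Sum>j\<in>K. partial j f (h v) * partial i (\<lambda>v. h v j) v)) (at (v i))"
proof -
  have "((\<lambda>t. f (h (v(i := t)))) has_real_derivative
      (\<Sum>j\<in>K. partial j f (h (v(i := v i))) * partial i (\<lambda>v. h v j) v)) (at (v i))"
  proof (rule chain_rule_curve[OF assms(1,2,4)])
    show "eventually (\<lambda>t. h (v(i := t)) \<in> rspace K) (nhds (v i))"
      using eventually_line[OF assms(3,7,8)]
      by (rule eventually_mono) (use assms(5) ropen_subset[OF assms(2)] in auto)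
    show "((\<lambda>t. h (v(i := t)) j) has_real_derivative partial i (\<lambda>v. h v j) v) (at (v i))"
      if "j \<in> K" for j
      by (rule has_partial[OF assms(6)[OF that] assms(7,8)])
    show "h (v(i := v i)) \<in> W" using assms(5,7) by simp
  qed
  then show ?thesis by simp
qed

lemma Ck_on_comp:
  assumes "finite K" "ropen K W" "ropen J V" "Ck_on r K W f"
    and "\<And>v. v \<in> V \<Longrightarrow> h v \<in> W" and "\<And>j. j \<in> K \<Longrightarrow> Ck_on r J V (\<lambda>v. h v j)"
  shows "Ck_on r J V (\<lambda>v. f (h v))"
  using assms(4,6)
proof (induction r arbitrary: f)
  have cont: "continuous_on V (\<lambda>v. f (h v))" if "continuous_on W f"
    "\<And>j. j \<in> K \<Longrightarrow> continuous_on V (\<lambda>v. h v j)" for f :: "('a \<Rightarrow> real) \<Rightarrow> real"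
  proof (rule continuous_on_compose2[OF that(1)])
    show "continuous_on V h"
    proof (rule continuous_on_coordinatewise_then_product)
      fix j
      show "continuous_on V (\<lambda>v. h v j)"
      proof (cases "j \<in> K")
        case False
        then have "h v j = 0" if "v \<in> V" for v
          using assms(5)[OF that] ropen_subset[OF assms(2)] by (auto simp: rspace_def)
        then show ?thesis
          using continuous_on_cong[of V V "\<lambda>v. h v j" "\<lambda>_. 0"] by (simp add: continuous_on_const)
      qed (rule that(2))
    qed
  qed (use assms(5) in auto)
  {
    case 0 then show ?case using cont by simp
  next
    case (Suc r)
    have C1: "Ck_on (Suc 0) K W f" "\<And>j. j \<in> K \<Longrightarrow> Ck_on (Suc 0) J V (\<lambda>v. h v j)"
      using Suc.prems by (auto intro: Ck_on_le[of "Suc r"])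
    show ?case
    proof (rule Ck_on_SucI[OF assms(3),
          where D = "\<lambda>i v. \<Sum>j\<in>K. partial j f (h v) * partial i (\<lambda>v. h v j) v"])
      show "continuous_on V (\<lambda>v. f (h v))"
        using Ck_on_imp_continuous[OF Suc.prems(1)] Ck_on_imp_continuous[OF Suc.prems(2)] by (rule cont)
    next
      fix i v assume "i \<in> J" "v \<in> V"
      then show "((\<lambda>t. f (h (v(i := t)))) has_real_derivative
          (\<Sum>j\<in>K. partial j f (h v) * partial i (\<lambda>v. h v j) v)) (at (v i))"
        using partial_comp[OF assms(1-3) C1(1) assms(5) C1(2)] by blast
    next
      fix i assume i: "i \<in> J"
      show "Ck_on r J V (\<lambda>v. \<Sum>j\<in>K. partial j f (h v) * partial i (\<lambda>v. h v j) v)"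
      proof (intro Ck_on_sum Ck_on_mult assms(3))
        fix j assume j: "j \<in> K"
        show "Ck_on r J V (\<lambda>v. partial j f (h v))"
          by (rule Suc.IH[OF Ck_on_partial[OF Suc.prems(1) j] Ck_on_SucD[OF Suc.prems(2)]])
        show "Ck_on r J V (partial i (\<lambda>v. h v j))"
          by (rule Ck_on_partial[OF Suc.prems(2)[OF j] i])
      qed
    qed
  }
qed

text \<open>
  The mean value theorem, applied in the direction \<open>i\<close> and then in the direction \<open>j\<close>, to the second
  difference, which is symmetric in \<open>i\<close> and \<open>j\<close>.
\<close>

lemma second_difference:
  assumes "Ck_on (Suc (Suc 0)) J W f" "i \<in> J" "j \<in> J" "i \<noteq> j" "h > 0"
    and W: "\<And>s t. v i \<le> s \<Longrightarrow> s \<le> v i + h \<Longrightarrow> v j \<le> t \<Longrightarrow> t \<le> v j + h \<Longrightarrow> v(i := s, j := t) \<in> W"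
  obtains s t where "v i < s" "s < v i + h" "v j < t" "t < v j + h"
    "f (v(i := v i + h, j := v j + h)) - f (v(i := v i + h)) - f (v(j := v j + h)) + f v
       = h * h * partial j (partial i f) (v(i := s, j := t))"
proof -
  define g where "g s = f (v(j := v j + h, i := s)) - f (v(j := v j, i := s))" for s
  define g' where "g' s = partial i f (v(j := v j + h, i := s)) - partial i f (v(j := v j, i := s))" for s
  have tw: "v(j := t, i := s) = v(i := s, j := t)" for s t
    using fun_upd_twist[of j i v t s] assms(4) by simp
  have W': "v(j := t, i := s) \<in> W" if "v i \<le> s" "s \<le> v i + h" "v j \<le> t" "t \<le> v j + h" for s t
    using W[OF that] by (simp only: tw)
  have f1: "Ck_on (Suc 0) J W (partial i f)" using Ck_on_partial[OF assms(1,2)] .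
  have "(g has_real_derivative g' s) (at s)" if "v i \<le> s" "s \<le> v i + h" for s
    unfolding g_def g'_def using that assms(5)
    by (intro DERIV_diff has_partial_upd[OF assms(1) _ assms(2)] W') auto
  from MVT2[of "v i" "v i + h" g g', OF _ this] assms(5)
  obtain s where s: "v i < s" "s < v i + h" "g (v i + h) - g (v i) = h * g' s" by auto
  have "((\<lambda>t. partial i f (v(i := s, j := t))) has_real_derivative
      partial j (partial i f) (v(i := s, j := t))) (at t)" if "v j \<le> t" "t \<le> v j + h" for t
    using that s by (intro has_partial_upd[OF f1 _ assms(3)] W) auto
  from MVT2[of "v j" "v j + h" "\<lambda>t. partial i f (v(i := s, j := t))", OF _ this] assms(5)
  obtain t where t: "v j < t" "t < v j + h"
    "partial i f (v(i := s, j := v j + h)) - partial i f (v(i := s, j := v j))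
       = h * partial j (partial i f) (v(i := s, j := t))" by auto
  have "g' s = h * partial j (partial i f) (v(i := s, j := t))"
    using t(3) unfolding g'_def by (simp only: tw)
  with s(3) have "g (v i + h) - g (v i) = h * h * partial j (partial i f) (v(i := s, j := t))" by simp
  moreover have "v(j := v j + h, i := v i) = v(j := v j + h)" "v(j := v j, i := v i) = v"
    "v(j := v j + h, i := v i + h) = v(i := v i + h, j := v j + h)"
    using assms(4) by (auto simp: fun_eq_iff)
  ultimately show ?thesis using that[OF s(1,2) t(1,2)] by (simp add: g_def)
qed

lemma partial_commute:
  assumes J: "finite J" "ropen J W" and f: "Ck_on (Suc (Suc 0)) J W f"
    and v: "v \<in> W" and i: "i \<in> J" and j: "j \<in> J"
  shows "partial i (partial j f) v = partial j (partial i f) v"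
proof (cases "i = j")
  case False
  have "\<bar>partial i (partial j f) v - partial j (partial i f) v\<bar> \<le> e" if e: "e > 0" for e
  proof -
    have c: "continuous_on W (partial i (partial j f))" "continuous_on W (partial j (partial i f))"
      using f i j by (auto intro!: Ck_on_imp_continuous[of 0] Ck_on_partial simp del: Ck_on.simps)
    obtain d1 where d1: "d1 > 0" "\<And>w. w \<in> rspace J \<Longrightarrow> \<forall>j\<in>J. \<bar>w j - v j\<bar> < d1 \<Longrightarrow>
        w \<in> W \<and> \<bar>partial i (partial j f) w - partial i (partial j f) v\<bar> < e / 2"
      using continuous_on_box[OF J v c(1) half_gt_zero[OF e]] by blast
    obtain d2 where d2: "d2 > 0" "\<And>w. w \<in> rspace J \<Longrightarrow> \<forall>j\<in>J. \<bar>w j - v j\<bar> < d2 \<Longrightarrow>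
        w \<in> W \<and> \<bar>partial j (partial i f) w - partial j (partial i f) v\<bar> < e / 2"
      using continuous_on_box[OF J v c(2) half_gt_zero[OF e]] by blast
    define h where "h = min d1 d2 / 2"
    have h: "h > 0" "h < d1" "h < d2" using d1(1) d2(1) by (auto simp: h_def)
    have vJ: "v \<in> rspace J" using v J(2) ropen_subset by blast
    have box: "v(i := s, j := t) \<in> rspace J"
      "\<And>m. m \<in> J \<Longrightarrow> \<bar>(v(i := s, j := t)) m - v m\<bar> < min d1 d2"
      if "v i \<le> s" "s \<le> v i + h" "v j \<le> t" "t \<le> v j + h" for s t
      using that h vJ i j by (auto intro!: rspace_upd)
    have W: "v(i := s, j := t) \<in> W"
      if "v i \<le> s" "s \<le> v i + h" "v j \<le> t" "t \<le> v j + h" for s t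
      using d1(2)[OF box(1)[OF that]] box(2)[OF that] by auto
    have tw: "v(j := t, i := s) = v(i := s, j := t)" for s t
      using fun_upd_twist[of j i v t s] False by simp
    obtain s t where st: "v i < s" "s < v i + h" "v j < t" "t < v j + h"
      "f (v(i := v i + h, j := v j + h)) - f (v(i := v i + h)) - f (v(j := v j + h)) + f v
       = h * h * partial j (partial i f) (v(i := s, j := t))"
      using second_difference[OF f i j False h(1) W] by blast
    obtain t' s' where st': "v i < s'" "s' < v i + h" "v j < t'" "t' < v j + h"
      "f (v(j := v j + h, i := v i + h)) - f (v(j := v j + h)) - f (v(i := v i + h)) + f v
       = h * h * partial i (partial j f) (v(j := t', i := s'))"
    proof (rule second_difference[OF f j i _ h(1), of v])
      show "v(j := t, i := s) \<in> W"
        if "v j \<le> t" "t \<le> v j + h" "v i \<le> s" "s \<le> v i + h" for t s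
        using W[of s t] that by (simp add: tw)
    qed (use False in auto)
    have "h * h * partial j (partial i f) (v(i := s, j := t))
        = h * h * partial i (partial j f) (v(i := s', j := t'))"
      using st(5) st'(5) unfolding tw by linarith
    then have "partial j (partial i f) (v(i := s, j := t)) = partial i (partial j f) (v(i := s', j := t'))"
      using h(1) by simp
    moreover have "\<bar>partial j (partial i f) (v(i := s, j := t)) - partial j (partial i f) v\<bar> < e / 2"
      using box[of s t] st d2(2)[of "v(i := s, j := t)"] by auto
    moreover have "\<bar>partial i (partial j f) (v(i := s', j := t')) - partial i (partial j f) v\<bar> < e / 2"
      using box[of s' t'] st' d1(2)[of "v(i := s', j := t')"] by auto
    ultimately show ?thesis by linarith
  qed
  note est = this
  have "\<bar>partial i (partial j f) v - partial j (partial i f) v\<bar> \<le> 0"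
  proof (rule field_le_epsilon)
    fix e :: real assume "e > 0"
    from est[OF this] show "\<bar>partial i (partial j f) v - partial j (partial i f) v\<bar> \<le> 0 + e" by simp
  qed
  then show ?thesis by simp
qed auto

lemma smooth_fun_continuous: "smooth_fun J W f \<Longrightarrow> continuous_on W f"
  by (auto simp: smooth_fun_def intro: Ck_on_imp_continuous)

lemma smooth_fun_mono: "smooth_fun J W f \<Longrightarrow> W' \<subseteq> W \<Longrightarrow> smooth_fun J W' f"
  by (auto simp: smooth_fun_def intro: Ck_on_mono)

lemma smooth_fun_cong:
  "smooth_fun J W f \<Longrightarrow> ropen J W \<Longrightarrow> (\<And>w. w \<in> W \<Longrightarrow> f w = g w) \<Longrightarrow> smooth_fun J W g"
  unfolding smooth_fun_def by (metis Ck_on_cong)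

lemma smooth_fun_partial: "smooth_fun J W f \<Longrightarrow> i \<in> J \<Longrightarrow> smooth_fun J W (partial i f)"
  unfolding smooth_fun_def by (metis Ck_on_partial)

lemma smooth_fun_const: "smooth_fun J W (\<lambda>_. c)"
  by (simp add: smooth_fun_def Ck_on_const)

lemma smooth_fun_coord: "smooth_fun J W (\<lambda>v. v c)"
  by (simp add: smooth_fun_def Ck_on_coord)

lemma smooth_fun_add:
  "ropen J W \<Longrightarrow> smooth_fun J W f \<Longrightarrow> smooth_fun J W g \<Longrightarrow> smooth_fun J W (\<lambda>v. f v + g v)"
  by (simp add: smooth_fun_def Ck_on_add)

lemma smooth_fun_mult:
  "ropen J W \<Longrightarrow> smooth_fun J W f \<Longrightarrow> smooth_fun J W g \<Longrightarrow> smooth_fun J W (\<lambda>v. f v * g v)"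
  by (simp add: smooth_fun_def Ck_on_mult)

lemma smooth_fun_diff:
  assumes "ropen J W" "smooth_fun J W f" "smooth_fun J W g"
  shows "smooth_fun J W (\<lambda>v. f v - g v)"
  using smooth_fun_add[OF assms(1,2) smooth_fun_mult[OF assms(1) smooth_fun_const[of J W "-1"] assms(3)]]
  by simp

lemma smooth_fun_sum:
  "ropen J W \<Longrightarrow> (\<And>a. a \<in> S \<Longrightarrow> smooth_fun J W (f a)) \<Longrightarrow> smooth_fun J W (\<lambda>v. \<Sum>a\<in>S. f a v)"
  by (simp add: smooth_fun_def Ck_on_sum)

lemma smooth_fun_prod:
  "ropen J W \<Longrightarrow> (\<And>a. a \<in> S \<Longrightarrow> smooth_fun J W (f a)) \<Longrightarrow> smooth_fun J W (\<lambda>v. \<Prod>a\<in>S. f a v)"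
  by (simp add: smooth_fun_def Ck_on_prod)

lemma smooth_fun_power:
  "ropen J W \<Longrightarrow> smooth_fun J W f \<Longrightarrow> smooth_fun J W (\<lambda>v. f v ^ m)"
  by (induction m) (auto intro: smooth_fun_const smooth_fun_mult)

lemma smooth_fun_comp:
  assumes "finite K" "ropen K W" "ropen J V" "smooth_fun K W f"
    and "\<And>v. v \<in> V \<Longrightarrow> h v \<in> W" and "\<And>j. j \<in> K \<Longrightarrow> smooth_fun J V (\<lambda>v. h v j)"
  shows "smooth_fun J V (\<lambda>v. f (h v))"
  unfolding smooth_fun_def
proof
  show "Ck_on r J V (\<lambda>v. f (h v))" for r
    by (rule Ck_on_comp[OF assms(1-3)]) (use assms(4-6) in \<open>auto simp: smooth_fun_def\<close>)
qed

lemma smooth_has_partial: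
  "smooth_fun J W f \<Longrightarrow> v \<in> W \<Longrightarrow> i \<in> J \<Longrightarrow>
     ((\<lambda>t. f (v(i := t))) has_real_derivative partial i f v) (at (v i))"
  unfolding smooth_fun_def by (metis has_partial)

lemma smooth_partial_commute:
  assumes "finite J" "ropen J W" "smooth_fun J W f" "v \<in> W" "i \<in> J" "j \<in> J"
  shows "partial i (partial j f) v = partial j (partial i f) v"
  using assms(3) unfolding smooth_fun_def by (intro partial_commute[OF assms(1,2) _ assms(4-6)]) simp

lemma partial_mult:
  assumes "smooth_fun J W f" "smooth_fun J W g" "v \<in> W" "i \<in> J"
  shows "partial i (\<lambda>v. f v * g v) v = partial i f v * g v + partial i g v * f v"
  by (rule partial_eqI)
    (use DERIV_mult[OF smooth_has_partial[OF assms(1,3,4)] smooth_has_partial[OF assms(2,3,4)]] in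
      \<open>simp only: fun_upd_triv\<close>)

lemma partial_sum:
  assumes "\<And>a. a \<in> S \<Longrightarrow> smooth_fun J W (f a)" "v \<in> W" "i \<in> J"
  shows "partial i (\<lambda>v. \<Sum>a\<in>S. c a * f a v) v = (\<Sum>a\<in>S. c a * partial i (f a) v)"
  by (rule partial_eqI, intro DERIV_sum DERIV_cmult smooth_has_partial[OF assms])

lemma smooth_partial_comp:
  assumes "finite K" "ropen K W" "ropen J V" "smooth_fun K W f"
    and "\<And>v. v \<in> V \<Longrightarrow> h v \<in> W" and "\<And>j. j \<in> K \<Longrightarrow> smooth_fun J V (\<lambda>v. h v j)"
    and "v \<in> V" "i \<in> J"
  shows "partial i (\<lambda>v. f (h v)) v = (\<Sum>j\<in>K. partial j f (h v) * partial i (\<lambda>v. h v j) v)"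
  by (rule partial_eqI, rule partial_comp[OF assms(1-3) _ assms(5) _ assms(7,8)])
    (use assms(4,6) in \<open>auto simp: smooth_fun_def\<close>)


section \<open>Iterated derivatives and Taylor expansion\<close>

lemma smooth_fun_fold_partial:
  "smooth_fun J W f \<Longrightarrow> set w \<subseteq> J \<Longrightarrow> smooth_fun J W (fold partial w f)"
  by (induction w arbitrary: f) (auto intro: smooth_fun_partial)

lemma fold_partial_cong_on:
  assumes "ropen J W" "set w \<subseteq> J" "\<And>v. v \<in> W \<Longrightarrow> f v = g v" "v \<in> W"
  shows "fold partial w f v = fold partial w g v"
  using assms(2,3)
proof (induction w arbitrary: f g)
  case (Cons i w)
  have "partial i f v = partial i g v" if "v \<in> W" for v
    by (rule partial_cong_on[OF assms(1) that _ Cons.prems(2)]) (use Cons.prems(1) in simp_all)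
  then have "fold partial w (partial i f) v = fold partial w (partial i g) v"
    by (intro Cons.IH) (use Cons.prems(1) in simp_all)
  then show ?case by simp
qed (simp add: assms(4))

lemma fold_partial_move:
  assumes "finite J" "ropen J W" "smooth_fun J W f" "i \<in> J" "set w \<subseteq> J" "v \<in> W"
  shows "partial i (fold partial w f) v = fold partial w (partial i f) v"
  using assms(3,5)
proof (induction w arbitrary: f)
  case (Cons j w)
  have "partial i (fold partial w (partial j f)) v = fold partial w (partial i (partial j f)) v"
    by (rule Cons.IH[OF smooth_fun_partial[OF Cons.prems(1)]]) (use Cons.prems(2) in simp_all)
  also have "\<dots> = fold partial w (partial j (partial i f)) v"
  proof (rule fold_partial_cong_on[OF assms(2) _ _ assms(6)])
    show "partial i (partial j f) v = partial j (partial i f) v" if "v \<in> W" for v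
      by (rule smooth_partial_commute[OF assms(1,2) Cons.prems(1) that assms(4)]) (use Cons.prems(2) in simp)
  qed (use Cons.prems(2) in simp)
  finally show ?case by simp
qed simp

text \<open>Iterated derivatives of smooth functions do not depend on the order of the directions.\<close>

lemma fold_partial_perm:
  assumes "finite J" "ropen J W" "smooth_fun J W f" "set w \<subseteq> J" "mset w = mset w'" "v \<in> W"
  shows "fold partial w f v = fold partial w' f v"
  using assms(3-6)
proof (induction w arbitrary: f w' v)
  case (Cons i w)
  have "i \<in> set w'" using Cons.prems(3) by (metis list.set_intros(1) mset_eq_setD)
  then obtain a b where w': "w' = a @ i # b" by (meson split_list)
  have set: "set w' \<subseteq> J" using Cons.prems(2,3) by (metis mset_eq_setD)
  have "fold partial (i # w) f v = fold partial (a @ b) (partial i f) v"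
    unfolding fold_simps
    by (rule Cons.IH[OF smooth_fun_partial[OF Cons.prems(1)] _ _ Cons.prems(4)]) (use Cons.prems(2,3) w' in simp_all)
  also have "\<dots> = fold partial b (fold partial a (partial i f)) v" by simp
  also have "\<dots> = fold partial b (partial i (fold partial a f)) v"
  proof (rule fold_partial_cong_on[OF assms(2) _ _ Cons.prems(4)])
    show "fold partial a (partial i f) v = partial i (fold partial a f) v" if "v \<in> W" for v
      using fold_partial_move[OF assms(1,2) Cons.prems(1) _ _ that, of i a] set w' by auto
  qed (use set w' in auto)
  finally show ?case by (simp add: w')
qed simp

lemma fold_partial_sum:
  assumes "ropen J W" "\<And>a. a \<in> S \<Longrightarrow> smooth_fun J W (f a)" "set w \<subseteq> J" "v \<in> W"
  shows "fold partial w (\<lambda>v. \<Sum>a\<in>S. c a * f a v) v = (\<Sum>a\<in>S. c a * fold partial w (f a) v)"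
  using assms(2-3)
proof (induction w arbitrary: f)
  case (Cons i w)
  have "fold partial (i # w) (\<lambda>v. \<Sum>a\<in>S. c a * f a v) v
      = fold partial w (\<lambda>v. \<Sum>a\<in>S. c a * partial i (f a) v) v"
    unfolding fold_simps
    by (rule fold_partial_cong_on[OF assms(1) _ _ assms(4)]) (use Cons.prems in \<open>auto intro!: partial_sum\<close>)
  also have "\<dots> = (\<Sum>a\<in>S. c a * fold partial w (partial i (f a)) v)"
    using Cons.prems by (intro Cons.IH smooth_fun_partial) auto
  finally show ?case by simp
qed simp


subsection \<open>Multi-indices as words\<close>

text \<open>The multi-index \<open>\<alpha>\<close> as the word in which every index \<open>i\<close> occurs \<open>\<alpha> i\<close> times.\<close>

definition midx_word :: "('n::{finite,linorder}) midx \<Rightarrow> 'n list" where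
  "midx_word \<alpha> = concat (map (\<lambda>i. replicate (\<alpha> i) i) (sorted_list_of_set UNIV))"

lemma fold_replicate: "fold f (replicate m i) = f i ^^ m"
  by (induction m) (auto simp: funpow_swap1 fun_eq_iff)

lemma iter_deriv_eq_fold: "iter_deriv D \<alpha> F = fold D (midx_word \<alpha>) F"
proof -
  have "fold D (concat (map (\<lambda>i. replicate (\<alpha> i) i) xs)) F = fold (\<lambda>i. D i ^^ \<alpha> i) xs F" for xs
    by (induction xs arbitrary: F) (auto simp: fold_replicate)
  then show ?thesis by (simp add: iter_deriv_def midx_word_def)
qed

lemma count_midx_word: "count (mset (midx_word \<alpha>)) i = \<alpha> i"
proof -
  have "count (mset (concat (map (\<lambda>i. replicate (\<alpha> i) i) xs))) i = (if i \<in> set xs then \<alpha> i else 0)"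
    if "distinct xs" for xs
    using that by (induction xs) (auto simp: count_replicate_mset)
  then show ?thesis by (simp add: midx_word_def)
qed

lemma length_midx_word: "length (midx_word \<alpha>) = (\<Sum>i\<in>UNIV. \<alpha> i)"
proof -
  have "length (midx_word \<alpha>) = size (mset (midx_word \<alpha>))" by simp
  also have "\<dots> = (\<Sum>i\<in>UNIV. count (mset (midx_word \<alpha>)) i)"
    by (rule size_multiset_overloaded_eq[THEN trans]) (auto intro!: sum.mono_neutral_left simp: not_in_iff)
  finally show ?thesis by (simp add: count_midx_word)
qed

lemma mset_midx_word: "mset (midx_word (\<lambda>i. count (mset w) i)) = mset w"
  by (rule multiset_eqI) (simp add: count_midx_word)

lemma midx_count_le:
  fixes w :: "'n::{finite,linorder} list"
  shows "length w \<le> k \<longleftrightarrow> (\<lambda>i. count (mset w) i) \<in> midx_le k"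
  using length_midx_word[of "\<lambda>i. count (mset w) i"] mset_midx_word[of w]
  by (metis (mono_tags, lifting) mem_Collect_eq midx_le_def size_mset)

lemma length_midx_word_le: "\<alpha> \<in> midx_le k \<Longrightarrow> length (midx_word \<alpha>) \<le> k"
  by (simp add: length_midx_word midx_le_def)

lemma finite_midx_le: "finite (midx_le k :: ('n::finite) midx set)"
proof (rule finite_subset)
  show "midx_le k \<subseteq> PiE (UNIV :: 'n set) (\<lambda>_. {..k})"
  proof
    fix \<alpha> :: "'n midx" assume "\<alpha> \<in> midx_le k"
    then have "\<alpha> i \<le> k" for i
      using member_le_sum[of i UNIV \<alpha>] by (simp add: midx_le_def)
    then show "\<alpha> \<in> PiE UNIV (\<lambda>_. {..k})" by (simp add: PiE_UNIV_domain)
  qed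
  show "finite (PiE (UNIV :: 'n set) (\<lambda>_. {..k}))"
    by (rule finite_PiE) simp_all
qed


subsection \<open>Divided powers\<close>

text \<open>The divided power \<open>y\<^sup>\<alpha> / \<alpha>!\<close>.\<close>

definition midx_divpow :: "('n::finite \<Rightarrow> real) \<Rightarrow> 'n midx \<Rightarrow> real" where
  "midx_divpow y \<alpha> = midx_power y \<alpha> / midx_fact \<alpha>"

lemma midx_divpow_eq: "midx_divpow y \<alpha> = (\<Prod>i\<in>UNIV. y i ^ \<alpha> i / fact (\<alpha> i))"
  by (simp add: midx_divpow_def midx_power_def midx_fact_def prod_dividef)

lemma midx_divpow_zero: "midx_divpow (\<lambda>_. 0) \<alpha> = (if \<forall>i. \<alpha> i = 0 then 1 else 0)"
proof (cases "\<forall>i. \<alpha> i = 0")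
  case False
  then obtain i where "\<alpha> i \<noteq> 0" by blast
  then have "\<exists>i\<in>UNIV. (0::real) ^ \<alpha> i / fact (\<alpha> i) = 0" by (intro bexI[of _ i]) auto
  then show ?thesis using False by (simp add: midx_divpow_eq prod_zero)
qed (simp add: midx_divpow_eq)

lemma partial_midx_divpow:
  "partial i (\<lambda>u. midx_divpow (\<lambda>j. u j - v j) \<alpha>) =
     (if \<alpha> i = 0 then (\<lambda>_. 0) else (\<lambda>u. midx_divpow (\<lambda>j. u j - v j) (\<alpha>(i := \<alpha> i - 1))))"
proof
  fix u :: "'a \<Rightarrow> real"
  define c where "c = (\<Prod>j\<in>UNIV - {i}. (u j - v j) ^ \<alpha> j / fact (\<alpha> j))"
  have split: "midx_divpow (\<lambda>j. w j - v j) \<beta> = (w i - v i) ^ \<beta> i / fact (\<beta> i) * c"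
    if "\<And>j. j \<noteq> i \<Longrightarrow> w j = u j \<and> \<beta> j = \<alpha> j" for w \<beta>
    unfolding midx_divpow_eq c_def by (subst prod.remove[of UNIV i]) (auto intro!: prod.cong simp: that)
  have eq: "(\<lambda>t. midx_divpow (\<lambda>j. (u(i := t)) j - v j) \<alpha>) = (\<lambda>t. (t - v i) ^ \<alpha> i / fact (\<alpha> i) * c)"
    by (rule ext, subst split) auto
  show "partial i (\<lambda>u. midx_divpow (\<lambda>j. u j - v j) \<alpha>) u =
     (if \<alpha> i = 0 then (\<lambda>_. 0) else (\<lambda>u. midx_divpow (\<lambda>j. u j - v j) (\<alpha>(i := \<alpha> i - 1)))) u"
  proof (cases "\<alpha> i")
    case 0
    then show ?thesis unfolding partial_def eq by simp
  next
    case (Suc m)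
    have f: "fact (Suc m) = (1 + real m) * fact m" by simp
    have "((\<lambda>t. (t - v i) ^ \<alpha> i / fact (\<alpha> i) * c) has_real_derivative
        (u i - v i) ^ m / fact m * c) (at (u i))"
    proof -
      have "((\<lambda>t. (t - v i) ^ Suc m) has_real_derivative (1 + real m) * (u i - v i) ^ m) (at (u i))"
        by (auto intro!: derivative_eq_intros simp del: power_Suc)
      from DERIV_cmult_right[OF DERIV_cdivide[OF this, of "fact (Suc m)"], of c]
      show ?thesis unfolding Suc f by (simp del: power_Suc)
    qed
    moreover have "midx_divpow (\<lambda>j. u j - v j) (\<alpha>(i := m)) = (u i - v i) ^ m / fact m * c"
      by (subst split) auto
    ultimately show ?thesis
      unfolding partial_def eq using Suc by (simp add: DERIV_imp_deriv)
  qed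
qed

lemma fold_partial_zero: "fold partial w (\<lambda>_. 0) = (\<lambda>_. 0)"
proof (induction w)
  case (Cons i w)
  have "partial i (\<lambda>_. 0) = (\<lambda>_. 0)" by (auto simp: partial_def)
  then show ?case using Cons by simp
qed simp

text \<open>The divided powers centred at \<open>v\<close> are dual to the derivatives at \<open>v\<close>.\<close>

lemma fold_partial_midx_divpow:
  "fold partial w (\<lambda>u. midx_divpow (\<lambda>j. u j - v j) \<alpha>) v = (if \<alpha> = (\<lambda>i. count (mset w) i) then 1 else 0)"
proof (induction w arbitrary: \<alpha>)
  case Nil
  then show ?case by (simp add: midx_divpow_zero fun_eq_iff)
next
  case (Cons i w)
  have "\<alpha>(i := \<alpha> i - 1) = (\<lambda>j. count (mset w) j) \<longleftrightarrow> \<alpha> = (\<lambda>j. count (mset (i # w)) j)" if "\<alpha> i \<noteq> 0"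
  proof -
    have "\<alpha>(i := \<alpha> i - 1) = (\<lambda>j. count (mset w) j) \<longleftrightarrow>
        \<alpha> i - 1 = count (mset w) i \<and> (\<forall>j. j \<noteq> i \<longrightarrow> \<alpha> j = count (mset w) j)"
      unfolding fun_eq_iff by (metis fun_upd_apply)
    moreover have "\<alpha> = (\<lambda>j. count (mset (i # w)) j) \<longleftrightarrow>
        \<alpha> i = Suc (count (mset w) i) \<and> (\<forall>j. j \<noteq> i \<longrightarrow> \<alpha> j = count (mset w) j)"
      by (auto simp: fun_eq_iff)
    ultimately show ?thesis using that by auto
  qed
  moreover have "\<alpha> \<noteq> (\<lambda>j. count (mset (i # w)) j)" if "\<alpha> i = 0"
    using that by (auto simp: fun_eq_iff)
  ultimately show ?case
    by (cases "\<alpha> i = 0") (simp_all only: fold_simps partial_midx_divpow if_True if_False Cons fold_partial_zero simp_thms)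
qed

text \<open>The binomial theorem, with coefficients depending only on \<open>v\<close>.\<close>

lemma midx_divpow_binomial:
  "midx_divpow (\<lambda>i. y i - v i) \<alpha> =
     (\<Sum>\<gamma>\<in>PiE UNIV (\<lambda>i. {..\<alpha> i}). (\<Prod>i\<in>UNIV. (- v i) ^ (\<alpha> i - \<gamma> i) / fact (\<alpha> i - \<gamma> i)) * midx_divpow y \<gamma>)"
proof -
  have 1: "(a - b) ^ m / fact m = (\<Sum>j\<in>{..m}. (- b) ^ (m - j) / fact (m - j) * (a ^ j / fact j))" for a b :: real and m
  proof -
    have "(a - b) ^ m / fact m = (a + - b) ^ m / fact m" by simp
    also have "\<dots> = (\<Sum>j\<le>m. of_nat (m choose j) * a ^ j * (- b) ^ (m - j) / fact m)"
      by (subst binomial_ring) (simp add: sum_divide_distrib)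
    also have "\<dots> = (\<Sum>j\<in>{..m}. (- b) ^ (m - j) / fact (m - j) * (a ^ j / fact j))"
      by (rule sum.cong) (auto simp: binomial_fact field_simps)
    finally show ?thesis .
  qed
  show ?thesis
    unfolding midx_divpow_eq 1 prod_sum_PiE[OF finite finite_atMost]
    by (simp only: prod.distrib)
qed

lemma smooth_midx_power:
  assumes "ropen J W" "\<And>i. smooth_fun J W (\<lambda>v. y v i)"
  shows "smooth_fun J W (\<lambda>v. midx_power (y v) \<alpha>)"
  unfolding midx_power_def by (intro smooth_fun_prod smooth_fun_power assms)

lemma smooth_midx_divpow:
  assumes "ropen J W" "\<And>i. smooth_fun J W (\<lambda>v. y v i)"
  shows "smooth_fun J W (\<lambda>v. midx_divpow (y v) \<alpha>)"
  using smooth_fun_mult[OF assms(1) smooth_midx_power[OF assms] smooth_fun_const[of J W "1 / midx_fact \<alpha>"]]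
  by (simp add: midx_divpow_def)


subsection \<open>Vanishing to finite order\<close>

text \<open>
  All partial derivatives of order at most \<open>k\<close> in the directions \<open>J\<close> vanish at \<open>v\<close>; the recursion on the
  order is the form in which products and compositions are treated.
\<close>

fun flat :: "'i set \<Rightarrow> nat \<Rightarrow> (('i \<Rightarrow> real) \<Rightarrow> real) \<Rightarrow> ('i \<Rightarrow> real) \<Rightarrow> bool" where
  "flat J 0 g v = (g v = 0)"
| "flat J (Suc k) g v = (g v = 0 \<and> (\<forall>i\<in>J. flat J k (partial i g) v))"

lemma flat_iff_fold:
  "flat J k g v \<longleftrightarrow> (\<forall>w. set w \<subseteq> J \<longrightarrow> length w \<le> k \<longrightarrow> fold partial w g v = 0)"
proof (induction k arbitrary: g)
  case (Suc k)
  have "(\<forall>w. set w \<subseteq> J \<longrightarrow> length w \<le> Suc k \<longrightarrow> fold partial w g v = 0) \<longleftrightarrow>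
      g v = 0 \<and> (\<forall>i\<in>J. \<forall>w. set w \<subseteq> J \<longrightarrow> length w \<le> k \<longrightarrow> fold partial w (partial i g) v = 0)"
    (is "?L \<longleftrightarrow> ?R")
  proof
    assume L: ?L
    have "fold partial w (partial i g) v = 0" if "i \<in> J" "set w \<subseteq> J" "length w \<le> k" for i w
      using L[rule_format, of "i # w"] that by simp
    then show ?R using L[rule_format, of "[]"] by simp
  next
    assume R: ?R
    show ?L
    proof (intro allI impI)
      fix w assume "set w \<subseteq> J" "length w \<le> Suc k"
      then show "fold partial w g v = 0" using R by (cases w) auto
    qed
  qed
  then show ?case using Suc by simp
qed simp

lemma flat_SucD: "flat J (Suc k) g v \<Longrightarrow> flat J k g v"
  by (simp only: flat_iff_fold) simp

lemma flat_cong_on: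
  assumes "ropen J W" "\<And>u. u \<in> W \<Longrightarrow> f u = g u" "v \<in> W" "flat J k f v"
  shows "flat J k g v"
  unfolding flat_iff_fold
proof (intro allI impI)
  fix w assume w: "set w \<subseteq> J" "length w \<le> k"
  have "fold partial w f v = fold partial w g v"
    by (rule fold_partial_cong_on[OF assms(1) w(1) assms(2,3)])
  then show "fold partial w g v = 0" using assms(4) w unfolding flat_iff_fold by simp
qed

lemma flat_sum:
  assumes "ropen J W" "\<And>a. a \<in> S \<Longrightarrow> smooth_fun J W (f a)" "v \<in> W" "\<And>a. a \<in> S \<Longrightarrow> flat J k (f a) v"
  shows "flat J k (\<lambda>v. \<Sum>a\<in>S. f a v) v"
  unfolding flat_iff_fold
proof (intro allI impI)
  fix w assume w: "set w \<subseteq> J" "length w \<le> k"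
  have "fold partial w (\<lambda>v. \<Sum>a\<in>S. 1 * f a v) v = (\<Sum>a\<in>S. 1 * fold partial w (f a) v)"
    by (rule fold_partial_sum[OF assms(1,2) w(1) assms(3)])
  also have "\<dots> = 0" using assms(4) w unfolding flat_iff_fold by simp
  finally show "fold partial w (\<lambda>v. \<Sum>a\<in>S. f a v) v = 0" by simp
qed

lemma flat_add:
  assumes "ropen J W" "smooth_fun J W f" "smooth_fun J W g" "v \<in> W" "flat J k f v" "flat J k g v"
  shows "flat J k (\<lambda>v. f v + g v) v"
proof -
  define F where "F b = (if b then f else g)" for b
  have F: "smooth_fun J W (F b)" "flat J k (F b) v" for b
    using assms by (simp_all add: F_def)
  have "flat J k (\<lambda>v. \<Sum>b\<in>UNIV. F b v) v"
    by (rule flat_sum[OF assms(1) F(1) assms(4) F(2)])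
  then show ?thesis by (simp add: UNIV_bool F_def add.commute)
qed

lemma flat_mult:
  assumes "ropen J W" "smooth_fun J W f" "smooth_fun J W g" "v \<in> W" "flat J k f v"
  shows "flat J k (\<lambda>v. f v * g v) v"
  using assms(2,3,5)
proof (induction k arbitrary: f g)
  case (Suc k)
  have "flat J k (partial i (\<lambda>v. f v * g v)) v" if i: "i \<in> J" for i
  proof (rule flat_cong_on[OF assms(1) _ assms(4), of "\<lambda>v. partial i f v * g v + f v * partial i g v"])
    show "flat J k (\<lambda>v. partial i f v * g v + f v * partial i g v) v"
    proof (rule flat_add[OF assms(1) _ _ assms(4)])
      show "flat J k (\<lambda>v. partial i f v * g v) v"
        using Suc.prems i by (intro Suc.IH smooth_fun_partial) auto
      show "flat J k (\<lambda>v. f v * partial i g v) v"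
        by (intro Suc.IH smooth_fun_partial Suc.prems(1,2) i flat_SucD[OF Suc.prems(3)])
    qed (intro smooth_fun_mult smooth_fun_partial assms(1) Suc.prems(1,2) i)+
  qed (simp add: partial_mult[OF Suc.prems(1,2) _ i])
  then show ?case using Suc.prems(3) by simp
qed simp

text \<open>
  Vanishing to order \<open>k\<close> does not depend on coordinates: by the chain rule the derivatives of \<open>g \<circ> h\<close>
  are combinations of derivatives of \<open>g\<close> of no higher order.
\<close>

lemma flat_comp:
  assumes "finite K" "ropen K W" "ropen J V" "smooth_fun K W g"
    and h: "\<And>v. v \<in> V \<Longrightarrow> h v \<in> W" "\<And>j. j \<in> K \<Longrightarrow> smooth_fun J V (\<lambda>v. h v j)"
    and "v \<in> V" "flat K k g (h v)"
  shows "flat J k (\<lambda>v. g (h v)) v"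
  using assms(4,8)
proof (induction k arbitrary: g)
  case (Suc k)
  have "flat J k (partial i (\<lambda>v. g (h v))) v" if i: "i \<in> J" for i
  proof (rule flat_cong_on[OF assms(3) _ assms(7), of "\<lambda>v. \<Sum>j\<in>K. partial j g (h v) * partial i (\<lambda>v. h v j) v"])
    show "flat J k (\<lambda>v. \<Sum>j\<in>K. partial j g (h v) * partial i (\<lambda>v. h v j) v) v"
    proof (rule flat_sum[OF assms(3) _ assms(7)])
      fix j assume j: "j \<in> K"
      have 1: "smooth_fun J V (\<lambda>v. partial j g (h v))"
        by (rule smooth_fun_comp[OF assms(1-3) _ h]) (intro smooth_fun_partial Suc.prems(1) j)
      have 2: "smooth_fun J V (partial i (\<lambda>v. h v j))"
        by (intro smooth_fun_partial h(2) i j)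
      show "smooth_fun J V (\<lambda>v. partial j g (h v) * partial i (\<lambda>v. h v j) v)"
        by (rule smooth_fun_mult[OF assms(3) 1 2])
      have "flat J k (\<lambda>v. partial j g (h v)) v"
        by (rule Suc.IH[OF smooth_fun_partial[OF Suc.prems(1) j]]) (use Suc.prems(2) j in simp)
      then show "flat J k (\<lambda>v. partial j g (h v) * partial i (\<lambda>v. h v j) v) v"
        by (rule flat_mult[OF assms(3) 1 2 assms(7)])
    qed
  qed (rule smooth_partial_comp[OF assms(1-3) Suc.prems(1) h _ i, symmetric])
  then show ?case using Suc.prems(2) by simp
qed simp

text \<open>
  Taylor's formula: \<open>g\<close> and its Taylor polynomial at \<open>v\<close> differ by a function flat at \<open>v\<close>.
  Flatness concerns derivatives along arbitrary words, the Taylor polynomial only those along sorted words,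
  which is where the symmetry of derivatives enters.
\<close>

lemma flat_taylor:
  fixes g :: "('n::{finite,linorder} \<Rightarrow> real) \<Rightarrow> real"
  assumes "ropen UNIV W" "smooth_fun UNIV W g" "v \<in> W"
  shows "flat UNIV k (\<lambda>u. g u - (\<Sum>\<alpha>\<in>midx_le k. iter_deriv partial \<alpha> g v * midx_divpow (\<lambda>j. u j - v j) \<alpha>)) v"
  unfolding flat_iff_fold
proof (intro allI impI)
  fix w :: "'n list" assume w: "length w \<le> k"
  \<comment> \<open>The difference is written as one finite sum, with \<open>None\<close> indexing \<open>g\<close> itself.\<close>
  define T where "T a u = (case a of None \<Rightarrow> g u | Some \<alpha> \<Rightarrow> midx_divpow (\<lambda>j. u j - v j) \<alpha>)" for a u
  define c where "c a = (case a of None \<Rightarrow> 1 | Some \<alpha> \<Rightarrow> - iter_deriv partial \<alpha> g v)" for a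
  define S where "S = insert None (Some ` midx_le k :: 'n midx option set)"
  have diff: "smooth_fun UNIV W (\<lambda>u. u j - v j)" for j
    by (intro smooth_fun_diff assms(1) smooth_fun_coord smooth_fun_const)
  have sm: "smooth_fun UNIV W (T a)" for a
    unfolding T_def using assms(2) smooth_midx_divpow[OF assms(1) diff]
    by (cases a) simp_all
  have fin: "finite (midx_le k :: 'n midx set)" by (rule finite_midx_le)
  have sumS: "(\<Sum>a\<in>S. F a) = F None + (\<Sum>\<alpha>\<in>midx_le k. F (Some \<alpha>))" for F :: "_ \<Rightarrow> real"
    unfolding S_def using fin by (subst sum.insert) (auto simp: sum.reindex)
  have "fold partial w (\<lambda>u. g u - (\<Sum>\<alpha>\<in>midx_le k. iter_deriv partial \<alpha> g v * midx_divpow (\<lambda>j. u j - v j) \<alpha>)) v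
      = fold partial w (\<lambda>u. \<Sum>a\<in>S. c a * T a u) v"
    by (simp add: sumS T_def c_def sum_negf)
  also have "\<dots> = (\<Sum>a\<in>S. c a * fold partial w (T a) v)"
    by (rule fold_partial_sum[OF assms(1) sm _ assms(3)]) simp
  also have "\<dots> = fold partial w g v - (\<Sum>\<alpha>\<in>midx_le k. iter_deriv partial \<alpha> g v *
      fold partial w (\<lambda>u. midx_divpow (\<lambda>j. u j - v j) \<alpha>) v)"
    by (simp add: sumS T_def[abs_def] c_def sum_negf)
  also have "\<dots> = fold partial w g v - iter_deriv partial (\<lambda>i. count (mset w) i) g v"
    using w by (simp add: fold_partial_midx_divpow midx_count_le sum.delta[OF fin] if_distrib cong: if_cong)
  also have "iter_deriv partial (\<lambda>i. count (mset w) i) g v = fold partial w g v"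
    unfolding iter_deriv_eq_fold
    by (rule fold_partial_perm[OF _ assms(1,2) _ _ assms(3)]) (auto simp: mset_midx_word)
  finally show "fold partial w (\<lambda>u. g u - (\<Sum>\<alpha>\<in>midx_le k. iter_deriv partial \<alpha> g v *
      midx_divpow (\<lambda>j. u j - v j) \<alpha>)) v = 0" by simp
qed


section \<open>Charts and differential operators on a manifold\<close>

lemma ropen_preimage:
  assumes "ropen J V" "ropen UNIV W" "\<And>j. smooth_fun J V (\<lambda>v. h v j)"
  shows "ropen J {v \<in> V. h v \<in> W}"
proof -
  have "continuous_on V h"
    by (rule continuous_on_coordinatewise_then_product) (rule smooth_fun_continuous[OF assms(3)])
  moreover have "open W" using assms(2) by (simp only: ropen_UNIV)
  ultimately have "openin (top_of_set V) (V \<inter> h -` W)"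
    by (rule continuous_openin_preimage_gen)
  then have "ropen J (V \<inter> h -` W)" using assms(1) by (rule openin_trans)
  moreover have "V \<inter> h -` W = {v \<in> V. h v \<in> W}" by blast
  ultimately show ?thesis by simp
qed

lemma chart_facts:
  assumes "smooth_manifold charts" "(U, x) \<in> charts"
  shows "open U" "inj_on x U" "\<And>S. open S \<Longrightarrow> ropen UNIV (x ` (S \<inter> U))"
proof -
  have hom: "open U" "homeomorphism U (x ` U) x (inv_into U x)"
    using assms by (auto simp: smooth_manifold_def)
  have ch: "is_chart UNIV (U, x)"
    using assms by (auto simp: smooth_manifold_def smooth_atlas_def)
  show "open U" "inj_on x U" using hom ch by (auto simp: is_chart_def)
  fix S :: "'a set" assume "open S"
  then have "openin (top_of_set U) (S \<inter> U)" by (auto simp: openin_open)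
  from homeomorphism_imp_open_map[OF hom(2) this]
  have "openin (top_of_set (x ` U)) (x ` (S \<inter> U))" .
  moreover have "ropen UNIV (x ` U)" using ch by (simp add: is_chart_def)
  ultimately show "ropen UNIV (x ` (S \<inter> U))" by (rule openin_trans)
qed

lemma chart_exists:
  assumes "smooth_manifold charts"
  obtains U x where "(U, x) \<in> charts" "p \<in> U"
proof -
  have "p \<in> mcarrier charts" using assms by (simp add: smooth_manifold_def)
  then show ?thesis using that by (auto simp: mcarrier_def)
qed

lemma max_chart_facts:
  assumes "(V, y) \<in> max_atlas UNIV charts"
  shows "inj_on y V" "ropen UNIV (y ` V)"
    and "(U, x) \<in> charts \<Longrightarrow> ropen UNIV (x ` (V \<inter> U))"
    and "(U, x) \<in> charts \<Longrightarrow> ropen UNIV (y ` (V \<inter> U))"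
    and "(U, x) \<in> charts \<Longrightarrow> smooth_fun UNIV (x ` (V \<inter> U)) (\<lambda>v. y (inv_into U x v) j)"
    and "(U, x) \<in> charts \<Longrightarrow> smooth_fun UNIV (y ` (V \<inter> U)) (\<lambda>v. x (inv_into V y v) j)"
  using assms by (auto simp: max_atlas_def is_chart_def compatible_def Int_commute)

lemma chart_in_max_atlas:
  assumes "smooth_manifold charts" "(U, x) \<in> charts"
  shows "(U, x) \<in> max_atlas UNIV charts"
  using assms unfolding max_atlas_def smooth_manifold_def smooth_atlas_def mcarrier_def by auto

lemma max_chart_image_open:
  assumes M: "smooth_manifold charts" and y: "(V, y) \<in> max_atlas UNIV charts"
    and x: "(U, x) \<in> charts" and S: "open S" "S \<subseteq> V" "S \<subseteq> U"
  shows "ropen UNIV (y ` S)"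
proof -
  have "y ` S = {u \<in> y ` (V \<inter> U). x (inv_into V y u) \<in> x ` (S \<inter> U)}"
  proof (intro set_eqI iffI)
    fix u assume "u \<in> y ` S"
    then obtain q where q: "q \<in> S" "u = y q" by blast
    then have "inv_into V y u = q" using max_chart_facts(1)[OF y] S(2) by (auto simp: inv_into_f_f)
    then show "u \<in> {u \<in> y ` (V \<inter> U). x (inv_into V y u) \<in> x ` (S \<inter> U)}" using q S by auto
  next
    fix u assume "u \<in> {u \<in> y ` (V \<inter> U). x (inv_into V y u) \<in> x ` (S \<inter> U)}"
    then obtain q s where q: "q \<in> V" "q \<in> U" "u = y q" and s: "s \<in> S" "x (inv_into V y u) = x s" by blast
    have "inv_into V y u = q" using q max_chart_facts(1)[OF y] by (auto simp: inv_into_f_f)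
    then have "x q = x s" using s by simp
    then have "q = s" using inj_onD[OF chart_facts(2)[OF M x]] q(2) s(1) S(3) by blast
    then show "u \<in> y ` S" using q(3) s(1) by blast
  qed
  moreover have "ropen UNIV {u \<in> y ` (V \<inter> U). x (inv_into V y u) \<in> x ` (S \<inter> U)}"
    by (rule ropen_preimage[OF max_chart_facts(4)[OF y x] chart_facts(3)[OF M x S(1)] max_chart_facts(6)[OF y x]])
  ultimately show ?thesis by simp
qed

lemma smooth_scalarD:
  "smooth_scalar UNIV charts S f \<Longrightarrow> (U, x) \<in> charts \<Longrightarrow> smooth_fun UNIV (x ` (S \<inter> U)) (\<lambda>v. f (inv_into U x v))"
  by (auto simp: smooth_scalar_def)

lemma smooth_scalarI:
  "(\<And>U x. (U, x) \<in> charts \<Longrightarrow> smooth_fun UNIV (x ` (S \<inter> U)) (\<lambda>v. f (inv_into U x v))) \<Longrightarrow> smooth_scalar UNIV charts S f"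
  by (auto simp: smooth_scalar_def)

lemma smooth_scalar_mono: "smooth_scalar UNIV charts S f \<Longrightarrow> S' \<subseteq> S \<Longrightarrow> smooth_scalar UNIV charts S' f"
  by (rule smooth_scalarI, rule smooth_fun_mono[OF smooth_scalarD]) auto

lemma smooth_scalar_cong:
  assumes M: "smooth_manifold charts" and f: "smooth_scalar UNIV charts S f" and "open S"
    and eq: "\<And>q. q \<in> S \<Longrightarrow> f q = g q"
  shows "smooth_scalar UNIV charts S g"
proof (rule smooth_scalarI)
  fix U x assume x: "(U, x) \<in> charts"
  show "smooth_fun UNIV (x ` (S \<inter> U)) (\<lambda>v. g (inv_into U x v))"
  proof (rule smooth_fun_cong[OF smooth_scalarD[OF f x] chart_facts(3)[OF M x \<open>open S\<close>]])
    fix v assume "v \<in> x ` (S \<inter> U)"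
    then obtain q where "q \<in> S" "q \<in> U" "v = x q" by blast
    then show "f (inv_into U x v) = g (inv_into U x v)"
      using chart_facts(2)[OF M x] eq by (simp add: inv_into_f_f)
  qed
qed

lemma smooth_scalar_max_chart:
  "(V, y) \<in> max_atlas UNIV charts \<Longrightarrow> smooth_scalar UNIV charts V (\<lambda>q. y q j)"
  by (rule smooth_scalarI) (rule max_chart_facts(5))

lemma smooth_scalar_const: "smooth_scalar UNIV charts S (\<lambda>_. c)"
  by (rule smooth_scalarI) (rule smooth_fun_const)

lemma smooth_scalar_diff:
  assumes "smooth_manifold charts" "open S" "smooth_scalar UNIV charts S f" "smooth_scalar UNIV charts S g"
  shows "smooth_scalar UNIV charts S (\<lambda>q. f q - g q)"
  by (rule smooth_scalarI) (intro smooth_fun_diff chart_facts(3)[OF assms(1)] smooth_scalarD[OF assms(3)] smooth_scalarD[OF assms(4)] assms(2))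

lemma smooth_scalar_mult:
  assumes "smooth_manifold charts" "open S" "smooth_scalar UNIV charts S f" "smooth_scalar UNIV charts S g"
  shows "smooth_scalar UNIV charts S (\<lambda>q. f q * g q)"
  by (rule smooth_scalarI) (intro smooth_fun_mult chart_facts(3)[OF assms(1)] smooth_scalarD[OF assms(3)] smooth_scalarD[OF assms(4)] assms(2))

lemma smooth_scalar_sum:
  assumes "smooth_manifold charts" "open S" "\<And>a. a \<in> A \<Longrightarrow> smooth_scalar UNIV charts S (f a)"
  shows "smooth_scalar UNIV charts S (\<lambda>q. \<Sum>a\<in>A. f a q)"
  by (rule smooth_scalarI) (intro smooth_fun_sum chart_facts(3)[OF assms(1)] smooth_scalarD[OF assms(3)] assms(2))

lemma smooth_scalar_midx_power:
  assumes "smooth_manifold charts" "open S" "\<And>i. smooth_scalar UNIV charts S (\<lambda>q. y q i)"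
  shows "smooth_scalar UNIV charts S (\<lambda>q. midx_power (y q) \<alpha>)"
  by (rule smooth_scalarI) (intro smooth_midx_power chart_facts(3)[OF assms(1)] smooth_scalarD[OF assms(3)] assms(2))

lemma smooth_scalar_midx_divpow:
  assumes "smooth_manifold charts" "open S" "\<And>i. smooth_scalar UNIV charts S (\<lambda>q. y q i)"
  shows "smooth_scalar UNIV charts S (\<lambda>q. midx_divpow (\<lambda>i. y q i - v i) \<alpha>)"
  by (rule smooth_scalarI) (intro smooth_midx_divpow smooth_fun_diff smooth_fun_const
      chart_facts(3)[OF assms(1)] smooth_scalarD[OF assms(3)] assms(2))

text \<open>
  \<open>smooth_scalar\<close> refers to the charts of the atlas only; this is its consequence for the maximal atlas.
\<close>

lemma smooth_fun_of_scalar: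
  assumes M: "smooth_manifold charts" and y: "(V, y) \<in> max_atlas UNIV charts"
    and x: "(U, x) \<in> charts" and S: "open S" "S \<subseteq> V" "S \<subseteq> U" and f: "smooth_scalar UNIV charts S f"
  shows "smooth_fun UNIV (y ` S) (\<lambda>u. f (inv_into V y u))"
proof -
  have op: "ropen UNIV (y ` S)" by (rule max_chart_image_open[OF M y x S])
  have inv: "inv_into V y (y q) = q" if "q \<in> S" for q
    using that S(2) max_chart_facts(1)[OF y] by (auto simp: inv_into_f_f)
  have "smooth_fun UNIV (y ` S) (\<lambda>u. f (inv_into U x (x (inv_into V y u))))"
  proof (rule smooth_fun_comp[OF finite chart_facts(3)[OF M x S(1)] op smooth_scalarD[OF f x]])
    show "x (inv_into V y u) \<in> x ` (S \<inter> U)" if "u \<in> y ` S" for u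
      using that inv S(3) by auto
    show "smooth_fun UNIV (y ` S) (\<lambda>u. x (inv_into V y u) j)" for j
      by (rule smooth_fun_mono[OF max_chart_facts(6)[OF y x]]) (use S in auto)
  qed
  then show ?thesis
  proof (rule smooth_fun_cong[OF _ op])
    fix u assume "u \<in> y ` S"
    then obtain q where "q \<in> S" "u = y q" by blast
    then show "f (inv_into U x (x (inv_into V y u))) = f (inv_into V y u)"
      using inv S(3) chart_facts(2)[OF M x] by (auto simp: inv_into_f_f)
  qed
qed


subsection \<open>Differential operators\<close>

lemma diff_op_eq:
  assumes M: "smooth_manifold charts" and A: "diff_op charts k V A" and x: "(U, x) \<in> charts"
    and W: "open W" "W \<subseteq> V" and f: "smooth_scalar UNIV charts W f" and p: "p \<in> W" "p \<in> U"
  shows "A f p = (\<Sum>\<alpha>\<in>midx_le k. op_coeff (U, x) A \<alpha> (x p) *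
                   iter_deriv partial \<alpha> (\<lambda>v. f (inv_into U x v)) (x p))"
proof -
  have "open (W \<inter> U)" using W(1) chart_facts(1)[OF M x] by blast
  moreover have "smooth_scalar UNIV charts (W \<inter> U) f" by (rule smooth_scalar_mono[OF f]) simp
  moreover have "W \<inter> U \<subseteq> U \<inter> V" "p \<in> W \<inter> U" using W p by auto
  ultimately show ?thesis using A x unfolding diff_op_def by blast
qed

lemma diff_op_cong_on:
  assumes M: "smooth_manifold charts" and A: "diff_op charts k V A"
    and W: "open W" "W \<subseteq> V" and f: "smooth_scalar UNIV charts W f" and p: "p \<in> W"
    and eq: "\<And>q. q \<in> W \<Longrightarrow> f q = g q"
  shows "A f p = A g p"
proof -
  obtain U x where x: "(U, x) \<in> charts" "p \<in> U" by (rule chart_exists[OF M])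
  have g: "smooth_scalar UNIV charts W g" by (rule smooth_scalar_cong[OF M f W(1) eq])
  have "iter_deriv partial \<alpha> (\<lambda>v. f (inv_into U x v)) (x p) = iter_deriv partial \<alpha> (\<lambda>v. g (inv_into U x v)) (x p)" for \<alpha>
    unfolding iter_deriv_eq_fold
  proof (rule fold_partial_cong_on[OF chart_facts(3)[OF M x(1) W(1)]])
    show "f (inv_into U x v) = g (inv_into U x v)" if "v \<in> x ` (W \<inter> U)" for v
      using that eq chart_facts(2)[OF M x(1)] by (auto simp: inv_into_f_f)
  qed (use p x in auto)
  then show ?thesis
    unfolding diff_op_eq[OF M A x(1) W f p x(2)] diff_op_eq[OF M A x(1) W g p x(2)] by simp
qed

lemma diff_op_sum:
  assumes M: "smooth_manifold charts" and A: "diff_op charts k V A"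
    and W: "open W" "W \<subseteq> V" and f: "\<And>a. a \<in> S \<Longrightarrow> smooth_scalar UNIV charts W (f a)" and p: "p \<in> W"
  shows "A (\<lambda>q. \<Sum>a\<in>S. c a * f a q) p = (\<Sum>a\<in>S. c a * A (f a) p)"
proof -
  obtain U x where x: "(U, x) \<in> charts" "p \<in> U" by (rule chart_exists[OF M])
  have xp: "x p \<in> x ` (W \<inter> U)" using p x by auto
  have s: "smooth_scalar UNIV charts W (\<lambda>q. \<Sum>a\<in>S. c a * f a q)"
    by (intro smooth_scalar_sum smooth_scalar_mult smooth_scalar_const M W f)
  have d: "iter_deriv partial \<alpha> (\<lambda>v. \<Sum>a\<in>S. c a * f a (inv_into U x v)) (x p)
      = (\<Sum>a\<in>S. c a * iter_deriv partial \<alpha> (\<lambda>v. f a (inv_into U x v)) (x p))" for \<alpha>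
    unfolding iter_deriv_eq_fold
    by (rule fold_partial_sum[OF chart_facts(3)[OF M x(1) W(1)] smooth_scalarD[OF f x(1)] subset_UNIV xp])
  have "A (\<lambda>q. \<Sum>a\<in>S. c a * f a q) p = (\<Sum>\<alpha>\<in>midx_le k. \<Sum>a\<in>S. c a * (op_coeff (U, x) A \<alpha> (x p) *
      iter_deriv partial \<alpha> (\<lambda>v. f a (inv_into U x v)) (x p)))"
    unfolding diff_op_eq[OF M A x(1) W s p x(2)] d by (simp add: sum_distrib_left mult.left_commute)
  also have "\<dots> = (\<Sum>a\<in>S. c a * (\<Sum>\<alpha>\<in>midx_le k. op_coeff (U, x) A \<alpha> (x p) *
      iter_deriv partial \<alpha> (\<lambda>v. f a (inv_into U x v)) (x p)))"
    by (subst sum.swap) (simp add: sum_distrib_left)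
  also have "\<dots> = (\<Sum>a\<in>S. c a * A (f a) p)"
    by (rule sum.cong) (simp_all add: diff_op_eq[OF M A x(1) W f p x(2)])
  finally show ?thesis .
qed

lemma diff_op_diff:
  assumes M: "smooth_manifold charts" and A: "diff_op charts k V A"
    and W: "open W" "W \<subseteq> V" and f: "smooth_scalar UNIV charts W f" and g: "smooth_scalar UNIV charts W g" and p: "p \<in> W"
  shows "A (\<lambda>q. f q - g q) p = A f p - A g p"
proof -
  \<comment> \<open>The difference is a linear combination indexed by the truth values.\<close>
  define F where "F b = (if b then f else g)" for b
  define c :: "bool \<Rightarrow> real" where "c b = (if b then 1 else -1)" for b
  have "A (\<lambda>q. \<Sum>b\<in>UNIV. c b * F b q) p = (\<Sum>b\<in>UNIV. c b * A (F b) p)"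
    by (rule diff_op_sum[OF M A W _ p]) (simp add: F_def f g)
  then show ?thesis by (simp add: UNIV_bool F_def c_def)
qed

lemma diff_op_flat:
  assumes M: "smooth_manifold charts" and A: "diff_op charts k V A" and x: "(U, x) \<in> charts" "p \<in> U"
    and W: "open W" "W \<subseteq> V" and f: "smooth_scalar UNIV charts W f" and p: "p \<in> W"
    and flat: "flat UNIV k (\<lambda>v. f (inv_into U x v)) (x p)"
  shows "A f p = 0"
proof -
  have "iter_deriv partial \<alpha> (\<lambda>v. f (inv_into U x v)) (x p) = 0" if "\<alpha> \<in> midx_le k" for \<alpha>
    using flat length_midx_word_le[OF that] unfolding iter_deriv_eq_fold flat_iff_fold by simp
  then show ?thesis unfolding diff_op_eq[OF M A x(1) W f p x(2)] by simp
qed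

text \<open>
  The local expression of an operator in an arbitrary chart \<open>y\<close> of the maximal atlas, with coefficients
  the values on divided powers of \<open>y - y(p)\<close>.
\<close>

lemma diff_op_taylor:
  assumes M: "smooth_manifold charts" and A: "diff_op charts k V' A" and y: "(V, y) \<in> max_atlas UNIV charts"
    and W: "open W" "W \<subseteq> V'" "W \<subseteq> V" and f: "smooth_scalar UNIV charts W f" and p: "p \<in> W"
  shows "A f p = (\<Sum>\<alpha>\<in>midx_le k. iter_deriv partial \<alpha> (\<lambda>u. f (inv_into V y u)) (y p) *
                   A (\<lambda>q. midx_divpow (\<lambda>j. y q j - y p j) \<alpha>) p)"
proof -
  obtain U x where x: "(U, x) \<in> charts" "p \<in> U" by (rule chart_exists[OF M])
  \<comment> \<open>\<open>R\<close> is the remainder of the Taylor expansion in the chart \<open>y\<close>, and \<open>r\<close> is its pullback to the manifold.\<close>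
  define W1 where "W1 = W \<inter> U"
  have W1: "open W1" "W1 \<subseteq> V'" "W1 \<subseteq> V" "W1 \<subseteq> U" "p \<in> W1"
    using W p x chart_facts(1)[OF M x(1)] by (auto simp: W1_def)
  have f1: "smooth_scalar UNIV charts W1 f" by (rule smooth_scalar_mono[OF f]) (simp add: W1_def)
  define g where "g u = f (inv_into V y u)" for u
  define c where "c \<alpha> = iter_deriv partial \<alpha> g (y p)" for \<alpha>
  define D where "D \<alpha> u = midx_divpow (\<lambda>j. u j - y p j) \<alpha>" for \<alpha> u
  define R where "R u = g u - (\<Sum>\<alpha>\<in>midx_le k. c \<alpha> * D \<alpha> u)" for u
  define r where "r q = f q - (\<Sum>\<alpha>\<in>midx_le k. c \<alpha> * D \<alpha> (y q))" for q
  have op: "ropen UNIV (y ` W1)" by (rule max_chart_image_open[OF M y x(1) W1(1,3,4)])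
  have opx: "ropen UNIV (x ` W1)"
    using chart_facts(3)[OF M x(1) W1(1)] W1(4) by (simp add: Int_absorb2)
  have g: "smooth_fun UNIV (y ` W1) g"
    unfolding g_def by (rule smooth_fun_of_scalar[OF M y x(1) W1(1,3,4) f1])
  have R: "smooth_fun UNIV (y ` W1) R"
    unfolding R_def D_def
    by (intro smooth_fun_diff g smooth_fun_sum smooth_fun_mult smooth_fun_const smooth_midx_divpow smooth_fun_coord op)
  have flatR: "flat UNIV k R (y p)"
    unfolding R_def c_def D_def by (rule flat_taylor[OF op g]) (use W1(5) in blast)
  have inv: "inv_into U x (x q) = q" if "q \<in> W1" for q
    using that W1(4) chart_facts(2)[OF M x(1)] by (auto simp: inv_into_f_f)
  have invy: "inv_into V y (y q) = q" if "q \<in> W1" for q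
    using that W1(3) max_chart_facts(1)[OF y] by (auto simp: inv_into_f_f)
  have "flat UNIV k (\<lambda>v. R (y (inv_into U x v))) (x p)"
  proof (rule flat_comp[OF finite op opx R])
    show "y (inv_into U x v) \<in> y ` W1" if "v \<in> x ` W1" for v using that inv by auto
    show "smooth_fun UNIV (x ` W1) (\<lambda>v. y (inv_into U x v) j)" for j
      by (rule smooth_fun_mono[OF max_chart_facts(5)[OF y x(1)]]) (use W1 in auto)
    show "x p \<in> x ` W1" using W1(5) by blast
    show "flat UNIV k R (y (inv_into U x (x p)))" using flatR inv[OF W1(5)] by simp
  qed
  then have flatr: "flat UNIV k (\<lambda>v. r (inv_into U x v)) (x p)"
  proof (rule flat_cong_on[OF opx, rotated 2])
    show "R (y (inv_into U x v)) = r (inv_into U x v)" if "v \<in> x ` W1" for v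
      using that inv invy by (auto simp: R_def r_def g_def)
    show "x p \<in> x ` W1" using W1(5) by blast
  qed
  have sD: "smooth_scalar UNIV charts W1 (\<lambda>q. D \<alpha> (y q))" for \<alpha>
    unfolding D_def by (intro smooth_scalar_midx_divpow M W1(1) smooth_scalar_mono[OF smooth_scalar_max_chart[OF y] W1(3)])
  have sS: "smooth_scalar UNIV charts W1 (\<lambda>q. \<Sum>\<alpha>\<in>midx_le k. c \<alpha> * D \<alpha> (y q))"
    by (intro smooth_scalar_sum smooth_scalar_mult smooth_scalar_const M W1(1) sD)
  have "A r p = 0"
    by (rule diff_op_flat[OF M A x W1(1,2) _ W1(5) flatr])
      (unfold r_def, intro smooth_scalar_diff M W1(1) f1 sS)
  moreover have "A r p = A f p - A (\<lambda>q. \<Sum>\<alpha>\<in>midx_le k. c \<alpha> * D \<alpha> (y q)) p"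
    unfolding r_def by (rule diff_op_diff[OF M A W1(1,2) f1 sS W1(5)])
  moreover have "A (\<lambda>q. \<Sum>\<alpha>\<in>midx_le k. c \<alpha> * D \<alpha> (y q)) p = (\<Sum>\<alpha>\<in>midx_le k. c \<alpha> * A (\<lambda>q. D \<alpha> (y q)) p)"
    by (rule diff_op_sum[OF M A W1(1,2) sD W1(5)])
  ultimately show ?thesis by (simp add: c_def D_def g_def[abs_def])
qed


subsection \<open>Local diffeomorphisms matching two charts\<close>

lemma open_max_chart_preimage:
  assumes M: "smooth_manifold charts" and y: "(S, y) \<in> max_atlas UNIV charts"
    and x: "(U, x) \<in> charts" and N: "ropen UNIV N"
  shows "open {q \<in> S \<inter> U. y q \<in> N}"
proof -
  define Q where "Q = {v \<in> x ` (S \<inter> U). y (inv_into U x v) \<in> N}"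
  have "ropen UNIV Q"
    unfolding Q_def by (rule ropen_preimage[OF max_chart_facts(3)[OF y x] N max_chart_facts(5)[OF y x]])
  then have "open Q" by (simp only: ropen_UNIV)
  moreover have "continuous_on U x" "open U"
    using M x by (auto simp: smooth_manifold_def homeomorphism_def)
  ultimately have "open (U \<inter> x -` Q)" using continuous_open_preimage by blast
  moreover have "U \<inter> x -` Q = {q \<in> S \<inter> U. y q \<in> N}"
  proof (intro set_eqI iffI)
    fix q assume "q \<in> U \<inter> x -` Q"
    then obtain q' where q: "q \<in> U" "q' \<in> S" "q' \<in> U" "x q = x q'" "y (inv_into U x (x q)) \<in> N"
      by (auto simp: Q_def)
    then have "q = q'" using inj_onD[OF chart_facts(2)[OF M x]] by blast
    then show "q \<in> {q \<in> S \<inter> U. y q \<in> N}" using q chart_facts(2)[OF M x] by (auto simp: inv_into_f_f)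
  next
    fix q assume "q \<in> {q \<in> S \<inter> U. y q \<in> N}"
    then show "q \<in> U \<inter> x -` Q" using chart_facts(2)[OF M x] by (auto simp: Q_def inv_into_f_f)
  qed
  ultimately show ?thesis by simp
qed

lemma smooth_scalar_comp_max_chart:
  assumes M: "smooth_manifold charts" and y: "(S, y) \<in> max_atlas UNIV charts"
    and N: "ropen UNIV N" and g: "smooth_fun UNIV N g"
    and T: "open T" "T \<subseteq> S" "y ` T \<subseteq> N"
  shows "smooth_scalar UNIV charts T (\<lambda>q. g (y q))"
proof (rule smooth_scalarI)
  fix U x assume x: "(U, x) \<in> charts"
  show "smooth_fun UNIV (x ` (T \<inter> U)) (\<lambda>v. g (y (inv_into U x v)))"
  proof (rule smooth_fun_comp[OF finite N chart_facts(3)[OF M x T(1)] g])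
    show "y (inv_into U x v) \<in> N" if "v \<in> x ` (T \<inter> U)" for v
      using that T(3) chart_facts(2)[OF M x] by (auto simp: inv_into_f_f)
    show "smooth_fun UNIV (x ` (T \<inter> U)) (\<lambda>v. y (inv_into U x v) j)" for j
      by (rule smooth_fun_mono[OF max_chart_facts(5)[OF y x]]) (use T(2) in auto)
  qed
qed

text \<open>A map that is the identity in suitable charts of the maximal atlas is smooth.\<close>

lemma smooth_map_of_charts:
  assumes M: "smooth_manifold charts"
    and y: "(S, y) \<in> max_atlas UNIV charts" "open S" and z: "(T, z) \<in> max_atlas UNIV charts"
    and f: "\<And>p. p \<in> S \<Longrightarrow> f p \<in> T" "\<And>p. p \<in> S \<Longrightarrow> z (f p) = y p"
  shows "smooth_map UNIV charts UNIV charts S f"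
proof -
  have univ: "mcarrier charts = UNIV" using M by (simp add: smooth_manifold_def)
  have main: "ropen UNIV (x ` (S \<inter> U \<inter> f -` V)) \<and>
      smooth_fun UNIV (x ` (S \<inter> U \<inter> f -` V)) (\<lambda>v. x' (f (inv_into U x v)) j)"
    if x: "(U, x) \<in> charts" and x': "(V, x') \<in> charts" for U x V x' j
  proof -
    have invz: "inv_into T z (y q) = f q" if "q \<in> S" for q
      using f[OF that] max_chart_facts(1)[OF z] by (metis inv_into_f_f)
    have inv: "inv_into U x (x q) = q" if "q \<in> U" for q
      using that chart_facts(2)[OF M x] by (simp add: inv_into_f_f)
    have mem: "y q \<in> z ` (T \<inter> V) \<longleftrightarrow> f q \<in> V" if q: "q \<in> S" for q
    proof
      assume "y q \<in> z ` (T \<inter> V)"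
      then obtain t where "t \<in> T" "t \<in> V" "z (f q) = z t" using f(2)[OF q] by auto
      then show "f q \<in> V" using inj_onD[OF max_chart_facts(1)[OF z] _ f(1)[OF q]] by metis
    next
      assume "f q \<in> V"
      then show "y q \<in> z ` (T \<inter> V)" using f[OF q] by (metis IntI imageI)
    qed
    have set: "x ` (S \<inter> U \<inter> f -` V) = {v \<in> x ` (S \<inter> U). y (inv_into U x v) \<in> z ` (T \<inter> V)}"
    proof (intro set_eqI iffI)
      fix v assume "v \<in> x ` (S \<inter> U \<inter> f -` V)"
      then obtain q where "q \<in> S" "q \<in> U" "f q \<in> V" "v = x q" by blast
      then show "v \<in> {v \<in> x ` (S \<inter> U). y (inv_into U x v) \<in> z ` (T \<inter> V)}"
        using inv mem by simp
    next
      fix v assume "v \<in> {v \<in> x ` (S \<inter> U). y (inv_into U x v) \<in> z ` (T \<inter> V)}"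
      then obtain q where q: "q \<in> S" "q \<in> U" "v = x q" "y (inv_into U x v) \<in> z ` (T \<inter> V)" by blast
      then have "f q \<in> V" using inv mem by simp
      then show "v \<in> x ` (S \<inter> U \<inter> f -` V)" using q by blast
    qed
    have op: "ropen UNIV (x ` (S \<inter> U \<inter> f -` V))"
      unfolding set
      by (rule ropen_preimage[OF max_chart_facts(3)[OF y(1) x] max_chart_facts(4)[OF z x'] max_chart_facts(5)[OF y(1) x]])
    have "smooth_fun UNIV (x ` (S \<inter> U \<inter> f -` V)) (\<lambda>v. x' (inv_into T z (y (inv_into U x v))) j)"
    proof (rule smooth_fun_comp[OF finite max_chart_facts(4)[OF z x'] op max_chart_facts(6)[OF z x']])
      show "y (inv_into U x v) \<in> z ` (T \<inter> V)" if "v \<in> x ` (S \<inter> U \<inter> f -` V)" for v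
        using that unfolding set by simp
      show "smooth_fun UNIV (x ` (S \<inter> U \<inter> f -` V)) (\<lambda>v. y (inv_into U x v) i)" for i
        by (rule smooth_fun_mono[OF max_chart_facts(5)[OF y(1) x]]) auto
    qed
    then have "smooth_fun UNIV (x ` (S \<inter> U \<inter> f -` V)) (\<lambda>v. x' (f (inv_into U x v)) j)"
    proof (rule smooth_fun_cong[OF _ op])
      fix v assume "v \<in> x ` (S \<inter> U \<inter> f -` V)"
      then obtain q where "q \<in> S" "q \<in> U" "v = x q" by blast
      then show "x' (inv_into T z (y (inv_into U x v))) j = x' (f (inv_into U x v)) j"
        using inv invz by simp
    qed
    then show ?thesis using op by blast
  qed
  have "mopen UNIV charts S"
    unfolding mopen_def univ using chart_facts(3)[OF M _ y(2)] by auto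
  then show ?thesis unfolding smooth_map_def univ using main by blast
qed

lemma local_diffeo_of_charts:
  assumes M: "smooth_manifold charts"
    and y: "(S, y) \<in> max_atlas UNIV charts" "open S" and z: "(T, z) \<in> max_atlas UNIV charts" "open T"
    and \<psi>: "dom \<psi> = S" "ran \<psi> = T" "bij_betw (\<lambda>p. the (\<psi> p)) S T"
    and eq: "\<And>p. p \<in> S \<Longrightarrow> z (the (\<psi> p)) = y p"
  shows "local_diffeo charts \<psi>"
proof -
  let ?f = "\<lambda>p. the (\<psi> p)"
  have f: "?f p \<in> T" if "p \<in> S" for p using that \<psi>(3) by (auto simp: bij_betw_def)
  have im: "?f ` S = T" using \<psi>(3) by (simp add: bij_betw_def)
  have g: "inv_into S ?f q \<in> S" "?f (inv_into S ?f q) = q" if "q \<in> T" for q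
    using that im by (auto intro: inv_into_into f_inv_into_f)
  have "smooth_map UNIV charts UNIV charts S ?f"
    by (rule smooth_map_of_charts[OF M y z(1) f eq])
  moreover have "smooth_map UNIV charts UNIV charts T (inv_into S ?f)"
  proof (rule smooth_map_of_charts[OF M z y(1) g(1)])
    show "y (inv_into S ?f q) = z q" if "q \<in> T" for q
      using eq[OF g(1)[OF that]] g(2)[OF that] by simp
  qed
  ultimately show ?thesis
    unfolding local_diffeo_def diffeo_between_def using \<psi> y(2) z(2) by simp
qed


section \<open>Jets of operators and the universal operator\<close>

subsection \<open>Jets of operators in coordinates\<close>

lemma ropen_preimage_rspace:
  assumes "ropen J V" "ropen K W" "\<And>j. smooth_fun J V (\<lambda>v. h v j)" "\<And>v. v \<in> V \<Longrightarrow> h v \<in> rspace K"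
  shows "ropen J {v \<in> V. h v \<in> W}"
proof -
  obtain T where T: "open T" "W = rspace K \<inter> T" using assms(2) by (auto simp: openin_open)
  have "ropen UNIV T" using T(1) by (simp only: ropen_UNIV)
  from ropen_preimage[OF assms(1) this assms(3)]
  have "ropen J {v \<in> V. h v \<in> T}" .
  moreover have "{v \<in> V. h v \<in> T} = {v \<in> V. h v \<in> W}" using T(2) assms(4) by auto
  ultimately show ?thesis by simp
qed

text \<open>The coordinates of the \<open>r\<close>-jet of \<open>A\<close> at the point with coordinates \<open>v\<close>.\<close>

definition jet_section ::
    "nat \<Rightarrow> nat \<Rightarrow> ('m, 'n::{finite,linorder}) chart \<Rightarrow> 'm oper \<Rightarrow> ('n \<Rightarrow> real) \<Rightarrow> 'n ojidx \<Rightarrow> real" where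
  "jet_section k r c A v s =
     (case s of Inl i \<Rightarrow> v i
      | Inr (\<alpha>, \<beta>) \<Rightarrow> if \<alpha> \<in> midx_le k \<and> \<beta> \<in> midx_le r then iter_deriv partial \<beta> (op_coeff c A \<alpha>) v else 0)"

text \<open>The projection from jets of higher order to \<open>l\<close>-jets, in coordinates.\<close>

definition jet_clip :: "nat \<Rightarrow> nat \<Rightarrow> ('n::finite ojidx \<Rightarrow> real) \<Rightarrow> 'n ojidx \<Rightarrow> real" where
  "jet_clip k l v = (\<lambda>s. if s \<in> ojet_idx k l then v s else 0)"

lemma ojet_coords_ojet:
  assumes "c \<in> charts" "p \<in> fst c" "open V" "p \<in> V" "diff_op charts k V A"
  shows "ojet_coords k r c (ojet charts k r A p) = jet_section k r c A (snd c p)"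
proof -
  have "A \<in> snd (ojet charts k r A p)" using assms by (auto simp: ojet_def)
  then have "ojet_rep (ojet charts k r A p) \<in> snd (ojet charts k r A p)"
    unfolding ojet_rep_def by (rule someI[where P = "\<lambda>B. B \<in> snd (ojet charts k r A p)"])
  then have "op_deriv c (ojet_rep (ojet charts k r A p)) p \<alpha> \<beta> = op_deriv c A p \<alpha> \<beta>"
    if "\<alpha> \<in> midx_le k" "\<beta> \<in> midx_le r" for \<alpha> \<beta>
    using that assms(1,2) by (simp add: ojet_def)
  then show ?thesis
    by (auto simp: fun_eq_iff ojet_coords_def jet_section_def op_deriv_def ojet_def split: sum.splits)
qed

lemma ojet_in_over:
  assumes "p \<in> U" "open V" "p \<in> V" "diff_op charts k V A"
  shows "ojet charts k r A p \<in> ojet_over charts k r U"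
  using assms by (auto simp: ojet_over_def ojet_space_def ojet_def)

lemma midx_le_mono: "l \<le> r \<Longrightarrow> midx_le l \<subseteq> midx_le r"
  by (auto simp: midx_le_def)

lemma jet_section_rspace: "jet_section k r c A v \<in> rspace (ojet_idx k r)"
  by (auto simp: rspace_def jet_section_def ojet_idx_def ojet_fibre_idx_def split: sum.splits)

lemma jet_clip_rspace: "jet_clip k l v \<in> rspace (ojet_idx k l)"
  by (auto simp: rspace_def jet_clip_def)

lemma jet_clip_section:
  assumes "l \<le> r"
  shows "jet_clip k l (jet_section k r c A v) = jet_section k l c A v"
  using midx_le_mono[OF assms]
  by (auto simp: fun_eq_iff jet_section_def jet_clip_def ojet_idx_def ojet_fibre_idx_def split: sum.splits)

lemma finite_ojet_idx: "finite (ojet_idx k l)"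
  by (simp add: ojet_idx_def ojet_fibre_idx_def finite_midx_le)

lemma smooth_jet_section:
  fixes c :: "('m, 'n::{finite,linorder}) chart"
  assumes "\<And>\<alpha>. \<alpha> \<in> midx_le k \<Longrightarrow> smooth_fun UNIV V (op_coeff c A \<alpha>)"
  shows "smooth_fun UNIV V (\<lambda>v. jet_section k r c A v s)"
proof (cases s)
  case (Inl i)
  then show ?thesis using smooth_fun_coord by (simp add: jet_section_def)
next
  case (Inr ab)
  then obtain \<alpha> \<beta> where s: "s = Inr (\<alpha>, \<beta>)" by (cases ab) auto
  show ?thesis
  proof (cases "\<alpha> \<in> midx_le k \<and> \<beta> \<in> midx_le r")
    case True
    then have "(\<lambda>v. jet_section k r c A v s) = fold partial (midx_word \<beta>) (op_coeff c A \<alpha>)"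
      by (simp add: s jet_section_def iter_deriv_eq_fold fun_eq_iff)
    then show ?thesis using True assms by (simp add: smooth_fun_fold_partial)
  next
    case False
    then have "(\<lambda>v. jet_section k r c A v s) = (\<lambda>_. 0)" by (auto simp: s jet_section_def)
    then show ?thesis by (simp add: smooth_fun_const)
  qed
qed

text \<open>
  The value of a rational invariant depends only on jet coordinates, because along a fibre it is the
  quotient of two functions of them. Hence \<open>inv_into\<close> need not return \<open>\<theta>\<close> itself.
\<close>

lemma rational_invariant_inv_into:
  assumes M: "smooth_manifold charts" and I: "rational_invariant charts P k l I"
    and x: "(U, x) \<in> charts" and \<theta>: "\<theta> \<in> ojet_over charts k l U"
  shows "I (inv_into (ojet_over charts k l U) (ojet_coords k l (U, x)) (ojet_coords k l (U, x) \<theta>)) = I \<theta>"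
proof -
  define \<eta> where "\<eta> = inv_into (ojet_over charts k l U) (ojet_coords k l (U, x)) (ojet_coords k l (U, x) \<theta>)"
  have im: "ojet_coords k l (U, x) \<theta> \<in> ojet_coords k l (U, x) ` ojet_over charts k l U" using \<theta> by blast
  have \<eta>: "\<eta> \<in> ojet_over charts k l U" "ojet_coords k l (U, x) \<eta> = ojet_coords k l (U, x) \<theta>"
    unfolding \<eta>_def using inv_into_into[OF im] f_inv_into_f[OF im] by blast+
  have "x (fst \<eta>) i = x (fst \<theta>) i" for i
    using fun_cong[OF \<eta>(2), of "Inl i"] by (simp add: ojet_coords_def)
  then have "x (fst \<eta>) = x (fst \<theta>)" by (rule ext)
  moreover have U: "fst \<eta> \<in> U" "fst \<theta> \<in> U" using \<eta>(1) \<theta> by (auto simp: ojet_over_def)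
  ultimately have fst: "fst \<eta> = fst \<theta>" using inj_onD[OF chart_facts(2)[OF M x]] by blast
  have over: "\<eta> \<in> ojet_over charts k l {fst \<theta>}" "\<theta> \<in> ojet_over charts k l {fst \<theta>}"
    using \<eta>(1) \<theta> fst by (auto simp: ojet_over_def)
  have "\<forall>p\<in>fst (U, x). \<exists>N D. poly_fun (ojet_fibre_idx k l) N \<and> poly_fun (ojet_fibre_idx k l) D \<and>
        (\<exists>\<theta>\<in>ojet_over charts k l {p}. D (ojet_coords k l (U, x) \<theta>) \<noteq> 0) \<and>
        (\<forall>\<theta>\<in>ojet_over charts k l {p}.
           I \<theta> = (let v = ojet_coords k l (U, x) \<theta> in if D v = 0 then None else Some (N v / D v)))"
    using I x unfolding rational_invariant_def by blast
  then obtain N D where "\<forall>\<theta>'\<in>ojet_over charts k l {fst \<theta>}.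
      I \<theta>' = (let v = ojet_coords k l (U, x) \<theta>' in if D v = 0 then None else Some (N v / D v))"
    using U(2) by force
  then have "I \<eta> = I \<theta>" using over \<eta>(2) by simp
  then show ?thesis by (simp add: \<eta>_def)
qed


subsection \<open>Total derivatives\<close>

text \<open>A function of jet coordinates that only depends on the jet of order \<open>r\<close>.\<close>

definition jet_order_le :: "nat \<Rightarrow> (('n::finite ojidx \<Rightarrow> real) \<Rightarrow> real) \<Rightarrow> bool" where
  "jet_order_le r F \<longleftrightarrow> (\<forall>\<alpha> \<beta> t v. r < (\<Sum>i\<in>UNIV. \<beta> i) \<longrightarrow> F (v(Inr (\<alpha>, \<beta>) := t)) = F v)"

lemma jet_order_le_partial:
  assumes "jet_order_le r F" "r < (\<Sum>i\<in>UNIV. \<beta> i)"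
  shows "partial (Inr (\<alpha>, \<beta>)) F v = 0"
proof -
  have "(\<lambda>t. F (v(Inr (\<alpha>, \<beta>) := t))) = (\<lambda>_. F v)" using assms by (auto simp: jet_order_le_def)
  then show ?thesis by (simp add: partial_def)
qed

lemma sum_midx_Suc: "(\<Sum>j\<in>UNIV. (\<beta>(i := Suc (\<beta> i))) j) = Suc (\<Sum>j\<in>UNIV. (\<beta> :: 'n::finite midx) j)"
  using sum.remove[of UNIV i \<beta>] sum.remove[of UNIV i "\<beta>(i := Suc (\<beta> i))"] by simp

text \<open>The total derivative raises the order by one; the bound \<open>R\<close> on the sum plays no role.\<close>

lemma jet_order_le_total_deriv:
  assumes F: "jet_order_le r F"
  shows "jet_order_le (Suc r) (total_deriv k R i F)"
  unfolding jet_order_le_def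
proof (intro allI impI)
  fix \<alpha>' \<beta>' :: "'a midx" and t :: real and v :: "'a ojidx \<Rightarrow> real"
  assume big: "Suc r < (\<Sum>i\<in>UNIV. \<beta>' i)"
  define s where "s = (Inr (\<alpha>', \<beta>') :: 'a ojidx)"
  have Fs: "F (w(s := u)) = F w" for w u using F big unfolding jet_order_le_def s_def by auto
  have part: "partial j F (v(s := t)) = partial j F v" for j
  proof (cases "j = s")
    case True
    have "(\<lambda>u. F ((v(s := t))(s := u))) = (\<lambda>u. F (v(s := u)))" by simp
    then show ?thesis using True Fs by (simp add: partial_def)
  next
    case False
    have "F ((v(s := t))(j := u)) = F (v(j := u))" for u
      using Fs[of "v(j := u)" t] False by (simp add: fun_upd_twist)
    then show ?thesis using False by (simp add: partial_def)
  qed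
  have summand: "(v(s := t)) (Inr (\<alpha>, \<beta>(i := Suc (\<beta> i)))) * partial (Inr (\<alpha>, \<beta>)) F v
      = v (Inr (\<alpha>, \<beta>(i := Suc (\<beta> i)))) * partial (Inr (\<alpha>, \<beta>)) F v" for \<alpha> \<beta>
  proof (cases "Inr (\<alpha>, \<beta>(i := Suc (\<beta> i))) = s")
    case True
    then have "\<beta>' = \<beta>(i := Suc (\<beta> i))" by (simp add: s_def)
    then have "r < (\<Sum>i\<in>UNIV. \<beta> i)" using big sum_midx_Suc[of \<beta> i] by simp
    then show ?thesis using jet_order_le_partial[OF F] by simp
  qed simp
  show "total_deriv k R i F (v(Inr (\<alpha>', \<beta>') := t)) = total_deriv k R i F v"
    unfolding total_deriv_def s_def[symmetric] part summand ..
qed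

lemma smooth_total_deriv:
  assumes "ropen (ojet_idx k R) W" "smooth_fun (ojet_idx k R) W F"
  shows "smooth_fun (ojet_idx k R) W (total_deriv k R i F)"
proof -
  have "smooth_fun (ojet_idx k R) W (\<lambda>v. partial (Inl i) F v +
     (\<Sum>\<alpha>\<in>midx_le k. \<Sum>\<beta>\<in>midx_le R. v (Inr (\<alpha>, \<beta>(i := Suc (\<beta> i)))) * partial (Inr (\<alpha>, \<beta>)) F v))"
    by (intro smooth_fun_add smooth_fun_sum smooth_fun_mult smooth_fun_coord smooth_fun_partial assms)
      (auto simp: ojet_idx_def ojet_fibre_idx_def)
  then show ?thesis by (simp add: total_deriv_def[abs_def])
qed

lemma mset_midx_word_Suc: "mset (midx_word (\<beta>(i := Suc (\<beta> i)))) = mset (midx_word \<beta> @ [i])"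
  by (rule multiset_eqI) (simp add: count_midx_word)

text \<open>
  The defining property of the total derivative, by the chain rule. The truncation of its sum at the order
  \<open>R\<close> is harmless for \<open>r < R\<close>: in the sections of \<open>R\<close>-jets the coordinates of order \<open>R + 1\<close> are set to
  \<open>0\<close>, but they only multiply derivatives of \<open>F\<close> that vanish.
\<close>

lemma total_deriv_section:
  fixes c :: "('m, 'n::{finite,linorder}) chart"
  assumes V: "ropen UNIV V" and A: "\<And>\<alpha>. \<alpha> \<in> midx_le k \<Longrightarrow> smooth_fun UNIV V (op_coeff c A \<alpha>)"
    and W: "ropen (ojet_idx k R) W" and F: "smooth_fun (ojet_idx k R) W F" "jet_order_le r F" "r < R"
    and VW: "\<And>v. v \<in> V \<Longrightarrow> jet_section k R c A v \<in> W" and v: "v \<in> V"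
  shows "total_deriv k R i F (jet_section k R c A v) = partial i (\<lambda>v. F (jet_section k R c A v)) v"
proof -
  let ?s = "jet_section k R c A"
  have part: "partial (Inr (\<alpha>, \<beta>)) F (?s v) * partial i (\<lambda>v. ?s v (Inr (\<alpha>, \<beta>))) v
      = ?s v (Inr (\<alpha>, \<beta>(i := Suc (\<beta> i)))) * partial (Inr (\<alpha>, \<beta>)) F (?s v)"
    if "\<alpha> \<in> midx_le k" "\<beta> \<in> midx_le R" for \<alpha> \<beta>
  proof (cases "r < (\<Sum>i\<in>UNIV. \<beta> i)")
    case True
    then show ?thesis using jet_order_le_partial[OF F(2)] by simp
  next
    case False
    then have le: "\<beta>(i := Suc (\<beta> i)) \<in> midx_le R" using F(3) sum_midx_Suc[of \<beta> i] by (simp add: midx_le_def)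
    have "partial i (\<lambda>v. ?s v (Inr (\<alpha>, \<beta>))) v = fold partial (midx_word \<beta> @ [i]) (op_coeff c A \<alpha>) v"
      using that by (simp add: jet_section_def iter_deriv_eq_fold)
    also have "\<dots> = fold partial (midx_word (\<beta>(i := Suc (\<beta> i)))) (op_coeff c A \<alpha>) v"
      by (rule fold_partial_perm[OF finite V A[OF that(1)] subset_UNIV _ v]) (simp only: mset_midx_word_Suc)
    also have "\<dots> = ?s v (Inr (\<alpha>, \<beta>(i := Suc (\<beta> i))))"
      using that(1) le by (simp add: jet_section_def iter_deriv_eq_fold)
    finally show ?thesis by simp
  qed
  have "partial i (\<lambda>v. F (?s v)) v
      = (\<Sum>j\<in>ojet_idx k R. partial j F (?s v) * partial i (\<lambda>v. ?s v j) v)"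
    by (rule smooth_partial_comp[OF finite_ojet_idx W V F(1) VW smooth_jet_section[OF A] v UNIV_I])
  also have "\<dots> = (\<Sum>j\<in>range Inl. partial j F (?s v) * partial i (\<lambda>v. ?s v j) v) +
      (\<Sum>j\<in>Inr ` (midx_le k \<times> midx_le R). partial j F (?s v) * partial i (\<lambda>v. ?s v j) v)"
    unfolding ojet_idx_def ojet_fibre_idx_def
    by (rule sum.union_disjoint) (auto simp: finite_midx_le)
  also have "(\<Sum>j\<in>range Inl. partial j F (?s v) * partial i (\<lambda>v. ?s v j) v) = partial (Inl i) F (?s v)"
  proof -
    have d: "partial i (\<lambda>v. ?s v (Inl a)) v = (if i = a then 1 else 0)" for a
      by (simp add: jet_section_def partial_coord)
    have "(\<Sum>j\<in>range Inl. partial j F (?s v) * partial i (\<lambda>v. ?s v j) v)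
        = (\<Sum>a\<in>UNIV. partial (Inl a) F (?s v) * (if i = a then 1 else 0))"
      by (simp only: sum.reindex[OF inj_Inl] o_def d)
    also have "\<dots> = (\<Sum>a\<in>UNIV. if i = a then partial (Inl a) F (?s v) else 0)"
      by (rule sum.cong) simp_all
    also have "\<dots> = partial (Inl i) F (?s v)" by (simp add: sum.delta)
    finally show ?thesis .
  qed
  also have "(\<Sum>j\<in>Inr ` (midx_le k \<times> midx_le R). partial j F (?s v) * partial i (\<lambda>v. ?s v j) v)
      = (\<Sum>\<alpha>\<in>midx_le k. \<Sum>\<beta>\<in>midx_le R. ?s v (Inr (\<alpha>, \<beta>(i := Suc (\<beta> i)))) * partial (Inr (\<alpha>, \<beta>)) F (?s v))"
  proof -
    have "inj_on Inr (midx_le k \<times> midx_le R)" by (simp add: inj_on_def)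
    then have "(\<Sum>j\<in>Inr ` (midx_le k \<times> midx_le R). partial j F (?s v) * partial i (\<lambda>v. ?s v j) v)
        = (\<Sum>(\<alpha>, \<beta>)\<in>midx_le k \<times> midx_le R. partial (Inr (\<alpha>, \<beta>)) F (?s v) * partial i (\<lambda>v. ?s v (Inr (\<alpha>, \<beta>))) v)"
      by (simp add: sum.reindex split_def)
    also have "\<dots> = (\<Sum>(\<alpha>, \<beta>)\<in>midx_le k \<times> midx_le R.
        ?s v (Inr (\<alpha>, \<beta>(i := Suc (\<beta> i)))) * partial (Inr (\<alpha>, \<beta>)) F (?s v))"
      by (rule sum.cong[OF refl]) (auto simp: part)
    finally show ?thesis by (simp only: sum.cartesian_product)
  qed
  finally show ?thesis by (simp add: total_deriv_def)
qed

lemma iter_total_deriv_section: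
  fixes c :: "('m, 'n::{finite,linorder}) chart"
  assumes V: "ropen UNIV V" and A: "\<And>\<alpha>. \<alpha> \<in> midx_le k \<Longrightarrow> smooth_fun UNIV V (op_coeff c A \<alpha>)"
    and W: "ropen (ojet_idx k R) W" and F: "smooth_fun (ojet_idx k R) W F" "jet_order_le l F"
    and VW: "\<And>v. v \<in> V \<Longrightarrow> jet_section k R c A v \<in> W" and w: "l + length w \<le> R" and v: "v \<in> V"
  shows "fold (total_deriv k R) w F (jet_section k R c A v)
      = fold partial w (\<lambda>v. F (jet_section k R c A v)) v"
proof -
  have "smooth_fun (ojet_idx k R) W (fold (total_deriv k R) w F) \<and>
      jet_order_le (l + length w) (fold (total_deriv k R) w F) \<and>
      (\<forall>v\<in>V. fold (total_deriv k R) w F (jet_section k R c A v)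
        = fold partial w (\<lambda>v. F (jet_section k R c A v)) v)"
    using w
  proof (induction w rule: rev_induct)
    case Nil
    then show ?case using F by simp
  next
    case (snoc i w)
    let ?G = "fold (total_deriv k R) w F"
    have IH: "smooth_fun (ojet_idx k R) W ?G" "jet_order_le (l + length w) ?G"
      "\<And>v. v \<in> V \<Longrightarrow> ?G (jet_section k R c A v) = fold partial w (\<lambda>v. F (jet_section k R c A v)) v"
      using snoc by auto
    have "total_deriv k R i ?G (jet_section k R c A v)
        = partial i (fold partial w (\<lambda>v. F (jet_section k R c A v))) v" if "v \<in> V" for v
    proof -
      have "total_deriv k R i ?G (jet_section k R c A v) = partial i (\<lambda>v. ?G (jet_section k R c A v)) v"
        by (rule total_deriv_section[OF V A W IH(1,2) _ VW that]) (use snoc.prems in auto)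
      also have "\<dots> = partial i (fold partial w (\<lambda>v. F (jet_section k R c A v))) v"
        by (rule partial_cong_on[OF V that UNIV_I IH(3)])
      finally show ?thesis .
    qed
    then show ?case
      using smooth_total_deriv[OF W IH(1)] jet_order_le_total_deriv[OF IH(2)] by simp
  qed
  then show ?thesis using v by blast
qed


subsection \<open>The universal operator\<close>

lemma chart_at:
  assumes "smooth_manifold charts"
  shows "chart_at charts p \<in> charts" "p \<in> fst (chart_at charts p)"
proof -
  obtain U x where "(U, x) \<in> charts" "p \<in> U" by (rule chart_exists[OF assms])
  then have "\<exists>c. c \<in> charts \<and> p \<in> fst c" by auto
  then have "chart_at charts p \<in> charts \<and> p \<in> fst (chart_at charts p)"
    unfolding chart_at_def by (rule someI_ex)
  then show "chart_at charts p \<in> charts" "p \<in> fst (chart_at charts p)" by auto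
qed

lemma jet_expr_eq:
  "jet_expr charts k l c F v = F (inv_into (ojet_over charts k l (fst c)) (ojet_coords k l c) (jet_clip k l v))"
  by (simp add: jet_expr_def jet_clip_def)

lemma iter_deriv_midx_zero:
  fixes D :: "'n::{finite,linorder} \<Rightarrow> 'f \<Rightarrow> 'f"
  shows "iter_deriv D midx_zero F = F"
proof -
  have "midx_word (midx_zero :: 'n midx) = []"
    using length_midx_word[of "midx_zero :: 'n midx"] by (simp add: midx_zero_def)
  then show ?thesis by (simp add: iter_deriv_eq_fold)
qed

text \<open>
  The universal operator applied to the monomials in the invariants, on the jet of \<open>A\<close>, is \<open>A\<close> applied
  to the monomials in the values of the invariants on \<open>A\<close>.
\<close>

lemma inv_multi_eq:
  fixes charts :: "('m::{t2_space,second_countable_topology}, 'n::{finite,linorder}) chart set"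
  assumes M: "smooth_manifold charts" and I: "\<And>i. rational_invariant charts P k l (I i)"
    and A: "diff_op charts k UNIV A" and S: "open S" "(S, inv_value charts k l I A) \<in> max_atlas UNIV charts"
    and dom: "\<And>p i. p \<in> S \<Longrightarrow> ojet charts k l A p \<in> dom (I i)" and p: "p \<in> S"
  shows "inv_multi charts k l I \<alpha> (ojet charts k (l + k) A p)
      = A (\<lambda>q. midx_divpow (inv_value charts k l I A q) \<alpha>) p"
proof -
  obtain U x where c: "chart_at charts p = (U, x)" by fastforce
  have x: "(U, x) \<in> charts" and pU: "p \<in> U" using chart_at[OF M, of p] c by auto
  define V where "V = x ` (S \<inter> U)"
  have V: "ropen UNIV V" unfolding V_def by (rule chart_facts(3)[OF M x S(1)])
  have coeff: "smooth_fun UNIV V (op_coeff (U, x) A \<beta>)" if "\<beta> \<in> midx_le k" for \<beta>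
  proof -
    have "smooth_fun UNIV (x ` (U \<inter> UNIV)) (op_coeff (U, x) A \<beta>)"
      using A x that unfolding diff_op_def by blast
    then show ?thesis by (rule smooth_fun_mono) (auto simp: V_def)
  qed
  define inv where "inv = inv_into (ojet_over charts k l U) (ojet_coords k l (U, x))"
  \<comment> \<open>All the invariants are defined on the jets with coordinates in \<open>W0\<close>, and \<open>W\<close> is its preimage in \<open>R\<close>-jets.\<close>
  define W0 where "W0 = (\<Inter>i. ojet_coords k l (U, x) ` (dom (I i) \<inter> ojet_over charts k l U))"
  have oc: "(ojet_over charts k l U, ojet_coords k l (U, x)) \<in> ojet_atlas charts k l"
    using x unfolding ojet_atlas_def by force
  have Wi: "ropen (ojet_idx k l) (ojet_coords k l (U, x) ` (dom (I i) \<inter> ojet_over charts k l U))"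
    "smooth_fun (ojet_idx k l) (ojet_coords k l (U, x) ` (dom (I i) \<inter> ojet_over charts k l U)) (\<lambda>v. the (I i (inv v)))" for i
  proof -
    have "mopen (ojet_idx k l) (ojet_atlas charts k l) (dom (I i))"
      "smooth_scalar (ojet_idx k l) (ojet_atlas charts k l) (dom (I i)) (\<lambda>\<theta>. the (I i \<theta>))"
      using I[of i] by (simp_all add: rational_invariant_def)
    then show "ropen (ojet_idx k l) (ojet_coords k l (U, x) ` (dom (I i) \<inter> ojet_over charts k l U))"
      "smooth_fun (ojet_idx k l) (ojet_coords k l (U, x) ` (dom (I i) \<inter> ojet_over charts k l U)) (\<lambda>v. the (I i (inv v)))"
      using oc unfolding mopen_def smooth_scalar_def inv_def by auto
  qed
  have W0: "ropen (ojet_idx k l) W0"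
    unfolding W0_def by (rule openin_INT2) (simp_all add: Wi(1))
  define F0 where "F0 v = midx_power (\<lambda>i. the (I i (inv v))) \<alpha>" for v
  have F0: "smooth_fun (ojet_idx k l) W0 F0"
    unfolding F0_def by (rule smooth_midx_power[OF W0], rule smooth_fun_mono[OF Wi(2)]) (auto simp: W0_def)
  define R where "R = l + k"
  define F where "F = jet_expr charts k l (U, x) (\<lambda>\<eta>. midx_power (\<lambda>i. the (I i \<eta>)) \<alpha>)"
  have F_eq: "F v = F0 (jet_clip k l v)" for v
    by (simp add: F_def F0_def jet_expr_eq inv_def)
  define W where "W = {v \<in> rspace (ojet_idx k R). jet_clip k l v \<in> W0}"
  have clip: "smooth_fun (ojet_idx k R) W' (\<lambda>v. jet_clip k l v s)" for s W'
    by (cases "s \<in> ojet_idx k l") (simp_all add: jet_clip_def smooth_fun_coord smooth_fun_const)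
  have W: "ropen (ojet_idx k R) W"
    unfolding W_def by (rule ropen_preimage_rspace[OF _ W0 clip jet_clip_rspace]) simp
  have F: "smooth_fun (ojet_idx k R) W F"
  proof (rule smooth_fun_cong[OF _ W])
    show "smooth_fun (ojet_idx k R) W (\<lambda>v. F0 (jet_clip k l v))"
      by (rule smooth_fun_comp[OF finite_ojet_idx W0 W F0 _ clip]) (simp add: W_def)
  qed (simp add: F_eq)
  have ord: "jet_order_le l F"
    unfolding jet_order_le_def
  proof (intro allI impI)
    fix \<gamma> \<beta> :: "'n midx" and t :: real and v :: "'n ojidx \<Rightarrow> real"
    assume "l < (\<Sum>i\<in>UNIV. \<beta> i)"
    then have "Inr (\<gamma>, \<beta>) \<notin> (ojet_idx k l :: 'n ojidx set)"
      by (auto simp: ojet_idx_def ojet_fibre_idx_def midx_le_def)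
    then have "jet_clip k l (v(Inr (\<gamma>, \<beta>) := t)) = jet_clip k l v"
      by (auto simp: jet_clip_def fun_eq_iff)
    then show "F (v(Inr (\<gamma>, \<beta>) := t)) = F v" by (simp add: F_eq)
  qed
  let ?s = "jet_section k R (U, x) A"
  have coords: "ojet_coords k r (U, x) (ojet charts k r A q) = jet_section k r (U, x) A (x q)" if "q \<in> U" for r q
    using ojet_coords_ojet[OF x, of q UNIV k A r] that A by simp
  have over: "ojet charts k l A q \<in> ojet_over charts k l U" if "q \<in> U" for q
    using ojet_in_over[OF that, of UNIV charts k A l] A by simp
  have clip_s: "jet_clip k l (?s v) = jet_section k l (U, x) A v" for v
    by (rule jet_clip_section) (simp add: R_def)
  have sW: "?s v \<in> W" if v: "v \<in> V" for v
  proof -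
    obtain q where q: "q \<in> S" "q \<in> U" "v = x q" using v by (auto simp: V_def)
    have "jet_clip k l (?s v) = ojet_coords k l (U, x) (ojet charts k l A q)"
      using coords[OF q(2)] q(3) by (simp add: clip_s)
    then have "jet_clip k l (?s v) \<in> W0" using dom[OF q(1)] over[OF q(2)] by (auto simp: W0_def)
    then show ?thesis using jet_section_rspace by (simp add: W_def)
  qed
  have Fs: "F (?s v) = midx_power (inv_value charts k l I A (inv_into U x v)) \<alpha>" if v: "v \<in> V" for v
  proof -
    obtain q where q: "q \<in> S" "q \<in> U" "v = x q" using v by (auto simp: V_def)
    have "inv_into U x v = q" using q chart_facts(2)[OF M x] by (simp add: inv_into_f_f)
    moreover have "I i (inv (jet_section k l (U, x) A v)) = I i (ojet charts k l A q)" for i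
      using rational_invariant_inv_into[OF M I x over[OF q(2)], of i] coords[OF q(2)] q(3)
      by (simp add: inv_def)
    ultimately show ?thesis by (simp add: F_eq clip_s F0_def inv_value_def[abs_def])
  qed
  have xp: "x p \<in> V" using p pU by (auto simp: V_def)
  have sm: "smooth_scalar UNIV charts S (\<lambda>q. midx_power (inv_value charts k l I A q) \<alpha>)"
    by (intro smooth_scalar_midx_power M S(1) smooth_scalar_max_chart[OF S(2)])
  have "universal_op charts k l (\<lambda>\<eta>. midx_power (\<lambda>i. the (I i \<eta>)) \<alpha>) (ojet charts k (l + k) A p)
      = (\<Sum>\<beta>\<in>midx_le k. ?s (x p) (Inr (\<beta>, midx_zero)) * iter_deriv (total_deriv k R) \<beta> F (?s (x p)))"
    using coords[OF pU, of R] c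
    by (simp add: universal_op_def universal_expr_def Let_def ojet_def F_def R_def)
  also have "\<dots> = (\<Sum>\<beta>\<in>midx_le k. op_coeff (U, x) A \<beta> (x p) *
      iter_deriv partial \<beta> (\<lambda>v. midx_power (inv_value charts k l I A (inv_into U x v)) \<alpha>) (x p))"
  proof (rule sum.cong[OF refl])
    fix \<beta> :: "'n midx" assume \<beta>: "\<beta> \<in> midx_le k"
    have "?s (x p) (Inr (\<beta>, midx_zero)) = op_coeff (U, x) A \<beta> (x p)"
      using \<beta> by (simp add: jet_section_def iter_deriv_midx_zero) (simp add: midx_le_def midx_zero_def)
    moreover have "iter_deriv (total_deriv k R) \<beta> F (?s (x p)) = iter_deriv partial \<beta> (\<lambda>v. F (?s v)) (x p)"
      unfolding iter_deriv_eq_fold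
      by (rule iter_total_deriv_section[OF V coeff W F ord sW _ xp])
        (use length_midx_word_le[OF \<beta>] in \<open>simp_all add: R_def\<close>)
    moreover have "iter_deriv partial \<beta> (\<lambda>v. F (?s v)) (x p)
        = iter_deriv partial \<beta> (\<lambda>v. midx_power (inv_value charts k l I A (inv_into U x v)) \<alpha>) (x p)"
      unfolding iter_deriv_eq_fold by (rule fold_partial_cong_on[OF V subset_UNIV Fs xp])
    ultimately show "?s (x p) (Inr (\<beta>, midx_zero)) * iter_deriv (total_deriv k R) \<beta> F (?s (x p))
        = op_coeff (U, x) A \<beta> (x p) *
          iter_deriv partial \<beta> (\<lambda>v. midx_power (inv_value charts k l I A (inv_into U x v)) \<alpha>) (x p)" by simp
  qed
  also have "\<dots> = A (\<lambda>q. midx_power (inv_value charts k l I A q) \<alpha>) p"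
    by (rule diff_op_eq[OF M A x S(1) subset_UNIV sm p pU, symmetric])
  finally have "inv_multi charts k l I \<alpha> (ojet charts k (l + k) A p)
      = 1 / midx_fact \<alpha> * A (\<lambda>q. midx_power (inv_value charts k l I A q) \<alpha>) p"
    by (simp add: inv_multi_def)
  \<comment> \<open>Homogeneity of \<open>A\<close> is the case of one summand of its additivity.\<close>
  also have "\<dots> = A (\<lambda>q. \<Sum>a\<in>{()}. 1 / midx_fact \<alpha> * midx_power (inv_value charts k l I A q) \<alpha>) p"
    by (subst diff_op_sum[OF M A S(1) subset_UNIV sm p]) simp
  finally show ?thesis by (simp add: midx_divpow_def)
qed


section \<open>Models and equivalence\<close>

subsection \<open>Pushforward\<close>

lemma pinv_apply:
  assumes "local_diffeo charts \<psi>" "\<psi> p = Some q"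
  shows "the (pinv \<psi> q) = p"
proof -
  have inj: "inj_on (\<lambda>p. the (\<psi> p)) (dom \<psi>)"
    using assms(1) by (auto simp: local_diffeo_def diffeo_between_def bij_betw_def)
  have "q \<in> ran \<psi>" "p \<in> dom \<psi>" using assms(2) by (auto intro: ranI)
  then show ?thesis using inv_into_f_f[OF inj, of p] assms(2) by (simp add: pinv_def)
qed

lemma ojet_cong_op:
  assumes M: "smooth_manifold charts" and S: "open S" "p \<in> S" and eq: "op_equal_on charts S A B"
  shows "ojet charts k r A p = ojet charts k r B p"
proof -
  have "op_deriv c A p \<alpha> \<beta> = op_deriv c B p \<alpha> \<beta>" if c: "c \<in> charts" "p \<in> fst c" for c \<alpha> \<beta>
  proof -
    obtain U x where [simp]: "c = (U, x)" by fastforce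
    have x: "(U, x) \<in> charts" "p \<in> U" using c by auto
    have op: "open (S \<inter> U)" using S chart_facts(1)[OF M x(1)] by blast
    have sm: "smooth_scalar UNIV charts (S \<inter> U) (\<lambda>q. midx_power (\<lambda>i. x q i - v i) \<alpha> / midx_fact \<alpha>)" for v
      unfolding midx_divpow_def[symmetric]
      by (intro smooth_scalar_midx_divpow M op smooth_scalar_mono[OF smooth_scalar_max_chart[OF chart_in_max_atlas[OF M x(1)]]]) simp
    have "op_coeff c A \<alpha> v = op_coeff c B \<alpha> v" if v: "v \<in> x ` (S \<inter> U)" for v
    proof -
      obtain q where q: "q \<in> S \<inter> U" "v = x q" using v by blast
      then have "inv_into U x v = q" using chart_facts(2)[OF M x(1)] by (simp add: inv_into_f_f)
      then show ?thesis using eq op sm[of v] q(1) unfolding op_equal_on_def op_coeff_def by auto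
    qed
    then show ?thesis
      unfolding op_deriv_def iter_deriv_eq_fold
      by (intro fold_partial_cong_on[OF chart_facts(3)[OF M x(1) S(1)]]) (use S x in auto)
  qed
  then show ?thesis by (simp add: ojet_def cong: conj_cong)
qed


subsection \<open>Comparison of models\<close>

lemma model_map_fst: "fst (model_map charts k l I A p) = inv_value charts k l I A p"
  by (simp add: model_map_def)

lemma inj_on_model_map:
  assumes "(S, inv_value charts k l I A) \<in> max_atlas UNIV charts"
  shows "inj_on (model_map charts k l I A) S"
proof (rule inj_onI)
  fix p q assume "p \<in> S" "q \<in> S" "model_map charts k l I A p = model_map charts k l I A q"
  then show "p = q"
    using inj_onD[OF max_chart_facts(1)[OF assms]] by (metis model_map_fst)
qed

text \<open>
  When the models coincide, \<open>psi_map\<close> is the local diffeomorphism matching points with the same model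
  coordinates; it is the identity in the coordinates given by the invariants.
\<close>

lemma psi_map_of_equal_models:
  assumes M: "smooth_manifold charts" and "open S" "open T"
    and y: "(S, inv_value charts k l I A) \<in> max_atlas UNIV charts"
    and z: "(T, inv_value charts k l I B) \<in> max_atlas UNIV charts"
    and eq: "model_map charts k l I A ` S = model_map charts k l I B ` T"
  defines "\<psi> \<equiv> psi_map charts k l I A S B T"
  shows "\<And>p. p \<in> S \<Longrightarrow> the (\<psi> p) \<in> T"
    and "\<And>p. p \<in> S \<Longrightarrow> model_map charts k l I B (the (\<psi> p)) = model_map charts k l I A p"
    and "\<And>q. q \<in> T \<Longrightarrow> \<exists>p\<in>S. \<psi> p = Some q"
    and "dom \<psi> = S" "ran \<psi> = T" "local_diffeo charts \<psi>"
proof -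
  have dom: "dom \<psi> = S" by (auto simp: \<psi>_def psi_map_def dom_def)
  have injB: "inj_on (model_map charts k l I B) T"
    by (rule inj_on_model_map[OF z])
  have 1: "the (\<psi> p) \<in> T" "model_map charts k l I B (the (\<psi> p)) = model_map charts k l I A p" if "p \<in> S" for p
  proof -
    have "model_map charts k l I A p \<in> model_map charts k l I B ` T" using that eq by blast
    then show "the (\<psi> p) \<in> T" "model_map charts k l I B (the (\<psi> p)) = model_map charts k l I A p"
      using that by (simp_all add: \<psi>_def psi_map_def inv_into_into f_inv_into_f)
  qed
  have inv: "inv_value charts k l I B (the (\<psi> p)) = inv_value charts k l I A p" if "p \<in> S" for p
    using 1(2)[OF that] by (metis model_map_fst)
  have surj: "\<exists>p\<in>S. \<psi> p = Some q" if q: "q \<in> T" for q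
  proof -
    have "model_map charts k l I B q \<in> model_map charts k l I A ` S" using q eq by blast
    then obtain p where p: "p \<in> S" "model_map charts k l I A p = model_map charts k l I B q" by force
    have "\<psi> p = Some q"
      using p inv_into_f_f[OF injB q] by (simp add: \<psi>_def psi_map_def)
    then show ?thesis using p(1) by blast
  qed
  have inj: "inj_on (\<lambda>p. the (\<psi> p)) S"
  proof (rule inj_onI)
    fix p p' assume "p \<in> S" "p' \<in> S" "the (\<psi> p) = the (\<psi> p')"
    then show "p = p'" using inj_onD[OF max_chart_facts(1)[OF y]] inv by metis
  qed
  have ran: "ran \<psi> = T"
  proof
    show "ran \<psi> \<subseteq> T"
    proof
      fix q assume "q \<in> ran \<psi>"
      then obtain p where p: "\<psi> p = Some q" by (auto simp: ran_def)
      then have "p \<in> S" using dom by blast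
      from 1(1)[OF this] show "q \<in> T" using p by simp
    qed
    show "T \<subseteq> ran \<psi>" using surj by (auto intro: ranI)
  qed
  have "bij_betw (\<lambda>p. the (\<psi> p)) S T"
    unfolding bij_betw_def
  proof (intro conjI inj set_eqI iffI)
    fix q assume "q \<in> T"
    then obtain p where "p \<in> S" "\<psi> p = Some q" using surj by blast
    then show "q \<in> (\<lambda>p. the (\<psi> p)) ` S" by force
  qed (use 1(1) in blast)
  from local_diffeo_of_charts[OF M y \<open>open S\<close> z \<open>open T\<close> dom ran this inv]
  show "local_diffeo charts \<psi>" .
  show "dom \<psi> = S" "ran \<psi> = T" by (fact dom ran)+
  show "\<And>p. p \<in> S \<Longrightarrow> the (\<psi> p) \<in> T"
    "\<And>p. p \<in> S \<Longrightarrow> model_map charts k l I B (the (\<psi> p)) = model_map charts k l I A p"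
    "\<And>q. q \<in> T \<Longrightarrow> \<exists>p\<in>S. \<psi> p = Some q"
    by (fact 1 surj)+
qed

text \<open>
  An element of the pseudogroup carrying \<open>A\<close> to \<open>B\<close> carries the invariants of \<open>A\<close> to those of \<open>B\<close>,
  including the \<open>Y\<^sub>\<alpha>\<close>, which are values of the operators on functions of the former.
\<close>

lemma models_of_equivalent:
  fixes charts :: "('m::{t2_space,second_countable_topology}, 'n::{finite,linorder}) chart set"
  assumes M: "smooth_manifold charts" and I: "\<And>i. rational_invariant charts P k l (I i)"
    and A: "diff_op charts k UNIV A" and B: "diff_op charts k UNIV B" and "open S" "open T"
    and y: "(S, inv_value charts k l I A) \<in> max_atlas UNIV charts"
    and z: "(T, inv_value charts k l I B) \<in> max_atlas UNIV charts"
    and domA: "\<And>p i. p \<in> S \<Longrightarrow> ojet charts k l A p \<in> dom (I i)"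
    and domB: "\<And>p i. p \<in> T \<Longrightarrow> ojet charts k l B p \<in> dom (I i)"
    and \<psi>: "\<psi> \<in> P" "local_diffeo charts \<psi>" "dom \<psi> = S" "ran \<psi> = T"
    and eq: "op_equal_on charts T (pushforward \<psi> A) B" and p: "\<psi> p = Some q"
  shows "model_map charts k l I B q = model_map charts k l I A p"
proof -
  have inv: "inv_value charts k l I B q = inv_value charts k l I A p" if "\<psi> p = Some q" for p q
  proof
    fix i
    have "p \<in> UNIV \<inter> dom \<psi>" "the (\<psi> p) = q" "q \<in> T" using that \<psi>(4) by (auto intro: ranI)
    moreover have "\<forall>\<phi>\<in>P. \<forall>V A p. open V \<longrightarrow> diff_op charts k V A \<longrightarrow> p \<in> V \<inter> dom \<phi> \<longrightarrow>
        I i (ojet charts k l (pushforward \<phi> A) (the (\<phi> p))) = I i (ojet charts k l A p)"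
      using I[of i] by (simp add: rational_invariant_def)
    ultimately have "I i (ojet charts k l (pushforward \<psi> A) q) = I i (ojet charts k l A p)"
      using \<psi>(1) A open_UNIV by blast
    then show "inv_value charts k l I B q i = inv_value charts k l I A p i"
      using ojet_cong_op[OF M \<open>open T\<close> \<open>q \<in> T\<close> eq] by (simp add: inv_value_def)
  qed
  have pS: "p \<in> S" and qT: "q \<in> T" using p \<psi>(3,4) by (auto intro: ranI)
  have multi: "inv_multi charts k l I \<alpha> (ojet charts k (l + k) B q) = inv_multi charts k l I \<alpha> (ojet charts k (l + k) A p)" for \<alpha>
  proof -
    have smA: "smooth_scalar UNIV charts S (\<lambda>q. midx_divpow (inv_value charts k l I A q) \<alpha>)"
      using smooth_scalar_midx_divpow[OF M \<open>open S\<close> smooth_scalar_max_chart[OF y], where v = "\<lambda>_. 0"] by simp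
    have smB: "smooth_scalar UNIV charts T (\<lambda>q. midx_divpow (inv_value charts k l I B q) \<alpha>)"
      using smooth_scalar_midx_divpow[OF M \<open>open T\<close> smooth_scalar_max_chart[OF z], where v = "\<lambda>_. 0"] by simp
    have "inv_multi charts k l I \<alpha> (ojet charts k (l + k) B q) = B (\<lambda>q. midx_divpow (inv_value charts k l I B q) \<alpha>) q"
      by (rule inv_multi_eq[OF M I B \<open>open T\<close> z domB qT])
    also have "\<dots> = pushforward \<psi> A (\<lambda>q. midx_divpow (inv_value charts k l I B q) \<alpha>) q"
      using eq \<open>open T\<close> smB qT unfolding op_equal_on_def by simp
    also have "\<dots> = A (\<lambda>p. midx_divpow (inv_value charts k l I B (the (\<psi> p))) \<alpha>) p"
      by (simp add: pushforward_def pinv_apply[OF \<psi>(2) p])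
    also have "\<dots> = A (\<lambda>q. midx_divpow (inv_value charts k l I A q) \<alpha>) p"
    proof (rule diff_op_cong_on[OF M A \<open>open S\<close> subset_UNIV smA pS, symmetric])
      fix p' assume "p' \<in> S"
      then obtain q' where "\<psi> p' = Some q'" using \<psi>(3) by blast
      then show "midx_divpow (inv_value charts k l I A p') \<alpha> = midx_divpow (inv_value charts k l I B (the (\<psi> p'))) \<alpha>"
        using inv by simp
    qed
    also have "\<dots> = inv_multi charts k l I \<alpha> (ojet charts k (l + k) A p)"
      by (rule inv_multi_eq[OF M I A \<open>open S\<close> y domA pS, symmetric])
    finally show ?thesis .
  qed
  show ?thesis by (simp only: model_map_def inv[OF p] multi)
qed

text \<open>
  In the coordinates given by the invariants, the coefficients of \<open>A\<close> are expressed through the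
  coordinates \<open>Y\<^sub>\<gamma>\<close> of the model, by expanding the divided powers of \<open>y - v\<close>.
\<close>

lemma diff_op_divpow_eq_of_models:
  fixes charts :: "('m::{t2_space,second_countable_topology}, 'n::{finite,linorder}) chart set"
  assumes M: "smooth_manifold charts" and I: "\<And>i. rational_invariant charts P k l (I i)"
    and A: "diff_op charts k UNIV A" and S: "open S" "(S, inv_value charts k l I A) \<in> max_atlas UNIV charts"
    and dom: "\<And>p i. p \<in> S \<Longrightarrow> ojet charts k l A p \<in> dom (I i)" and p: "p \<in> S" and \<alpha>: "\<alpha> \<in> midx_le k"
  shows "A (\<lambda>q. midx_divpow (\<lambda>j. inv_value charts k l I A q j - v j) \<alpha>) p =
     (\<Sum>\<gamma>\<in>PiE UNIV (\<lambda>i. {..\<alpha> i}). (\<Prod>i\<in>UNIV. (- v i) ^ (\<alpha> i - \<gamma> i) / fact (\<alpha> i - \<gamma> i)) *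
        snd (model_map charts k l I A p) \<gamma>)"
proof -
  have sm: "smooth_scalar UNIV charts S (\<lambda>q. midx_divpow (inv_value charts k l I A q) \<gamma>)" for \<gamma>
    using smooth_scalar_midx_divpow[OF M S(1) smooth_scalar_max_chart[OF S(2)], where v = "\<lambda>_. 0"] by simp
  have le: "\<gamma> \<in> midx_le k" if "\<gamma> \<in> PiE UNIV (\<lambda>i. {..\<alpha> i})" for \<gamma>
  proof -
    have "(\<Sum>i\<in>UNIV. \<gamma> i) \<le> (\<Sum>i\<in>UNIV. \<alpha> i)" using that by (intro sum_mono) (auto simp: PiE_def Pi_def)
    then show ?thesis using \<alpha> by (simp add: midx_le_def)
  qed
  show ?thesis
    unfolding midx_divpow_binomial diff_op_sum[OF M A S(1) subset_UNIV sm p]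
    by (rule sum.cong[OF refl]) (simp add: model_map_def le inv_multi_eq[OF M I A S dom p])
qed

text \<open>
  In the coordinates given by the invariants, \<open>psi_map\<close> is the identity and \<open>A\<close> and \<open>B\<close> have the same
  coefficients.
\<close>

lemma equivalent_of_models:
  fixes charts :: "('m::{t2_space,second_countable_topology}, 'n::{finite,linorder}) chart set"
  assumes M: "smooth_manifold charts" and I: "\<And>i. rational_invariant charts P k l (I i)"
    and A: "diff_op charts k UNIV A" and B: "diff_op charts k UNIV B" and "open S" "open T"
    and y: "(S, inv_value charts k l I A) \<in> max_atlas UNIV charts"
    and z: "(T, inv_value charts k l I B) \<in> max_atlas UNIV charts"
    and domA: "\<And>p i. p \<in> S \<Longrightarrow> ojet charts k l A p \<in> dom (I i)"
    and domB: "\<And>p i. p \<in> T \<Longrightarrow> ojet charts k l B p \<in> dom (I i)"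
    and eq: "model_map charts k l I A ` S = model_map charts k l I B ` T"
  shows "op_equal_on charts T (pushforward (psi_map charts k l I A S B T) A) B"
  unfolding op_equal_on_def
proof (intro allI impI)
  fix W f q assume W: "open W" "W \<subseteq> T" and f: "smooth_scalar UNIV charts W f" and q: "q \<in> W"
  let ?\<psi> = "psi_map charts k l I A S B T"
  let ?h = "\<lambda>p. the (?\<psi> p)"
  let ?y = "inv_value charts k l I A" and ?z = "inv_value charts k l I B"
  note \<psi> = psi_map_of_equal_models[OF M \<open>open S\<close> \<open>open T\<close> y z eq]
  obtain p where p: "p \<in> S" "?\<psi> p = Some q" using \<psi>(3) q W(2) by blast
  have hy: "?z (?h p') = ?y p'" if "p' \<in> S" for p' using \<psi>(2)[OF that] by (metis model_map_fst)
  have invz: "inv_into T ?z (?y p') = ?h p'" if "p' \<in> S" for p'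
    using hy[OF that] \<psi>(1)[OF that] max_chart_facts(1)[OF z] by (metis inv_into_f_f)
  have invy: "inv_into S ?y (?y p') = p'" if "p' \<in> S" for p'
    using that max_chart_facts(1)[OF y] by (simp add: inv_into_f_f)
  define v where "v = ?y p"
  have v: "?z q = v" using hy[OF p(1)] p(2) by (simp add: v_def)
  obtain V x' where x': "(V, x') \<in> charts" "q \<in> V" by (rule chart_exists[OF M])
  obtain U x where x: "(U, x) \<in> charts" "p \<in> U" by (rule chart_exists[OF M])
  define W1 where "W1 = W \<inter> V"
  have W1: "open W1" "W1 \<subseteq> T" "W1 \<subseteq> V" "q \<in> W1"
    using W q x' chart_facts(1)[OF M x'(1)] by (auto simp: W1_def)
  have f1: "smooth_scalar UNIV charts W1 f" by (rule smooth_scalar_mono[OF f]) (simp add: W1_def)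
  have N: "ropen UNIV (?z ` W1)" by (rule max_chart_image_open[OF M z x'(1) W1(1-3)])
  have g: "smooth_fun UNIV (?z ` W1) (\<lambda>u. f (inv_into T ?z u))"
    by (rule smooth_fun_of_scalar[OF M z x'(1) W1(1-3) f1])
  \<comment> \<open>The points of \<open>S\<close> near \<open>p\<close> that \<open>psi_map\<close> sends into \<open>W1\<close>.\<close>
  define S1 where "S1 = {p' \<in> S \<inter> U. ?y p' \<in> ?z ` W1}"
  have "open S1" unfolding S1_def by (rule open_max_chart_preimage[OF M y x(1) N])
  have S1: "S1 \<subseteq> S" "S1 \<subseteq> U" by (auto simp: S1_def)
  have "v \<in> ?z ` W1" using W1(4) v by blast
  then have pS1: "p \<in> S1" using p(1) x(2) by (simp add: S1_def v_def)
  have F: "smooth_scalar UNIV charts S1 (\<lambda>p'. f (?h p'))"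
  proof (rule smooth_scalar_cong[OF M _ \<open>open S1\<close>])
    show "smooth_scalar UNIV charts S1 (\<lambda>p'. f (inv_into T ?z (?y p')))"
      by (rule smooth_scalar_comp_max_chart[OF M y N g \<open>open S1\<close> S1(1)]) (auto simp: S1_def)
  qed (use invz S1(1) in auto)
  have "pushforward ?\<psi> A f q = A (\<lambda>p'. f (?h p')) p"
    by (simp add: pushforward_def pinv_apply[OF \<psi>(6) p(2)])
  also have "\<dots> = (\<Sum>\<alpha>\<in>midx_le k. iter_deriv partial \<alpha> (\<lambda>u. f (?h (inv_into S ?y u))) v *
                   A (\<lambda>p'. midx_divpow (\<lambda>j. ?y p' j - v j) \<alpha>) p)"
    unfolding v_def by (rule diff_op_taylor[OF M A y \<open>open S1\<close> subset_UNIV S1(1) F pS1])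
  also have "\<dots> = (\<Sum>\<alpha>\<in>midx_le k. iter_deriv partial \<alpha> (\<lambda>u. f (inv_into T ?z u)) v *
                   B (\<lambda>q'. midx_divpow (\<lambda>j. ?z q' j - v j) \<alpha>) q)"
  proof (rule sum.cong[OF refl])
    fix \<alpha> :: "'n midx" assume \<alpha>: "\<alpha> \<in> midx_le k"
    have "iter_deriv partial \<alpha> (\<lambda>u. f (?h (inv_into S ?y u))) v = iter_deriv partial \<alpha> (\<lambda>u. f (inv_into T ?z u)) v"
      unfolding iter_deriv_eq_fold
    proof (rule fold_partial_cong_on[OF max_chart_image_open[OF M y x(1) \<open>open S1\<close> S1(1,2)] subset_UNIV])
      show "f (?h (inv_into S ?y u)) = f (inv_into T ?z u)" if "u \<in> ?y ` S1" for u
        using that invy invz S1(1) by auto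
      show "v \<in> ?y ` S1" using pS1 by (simp add: v_def)
    qed
    moreover have "A (\<lambda>p'. midx_divpow (\<lambda>j. ?y p' j - v j) \<alpha>) p = B (\<lambda>q'. midx_divpow (\<lambda>j. ?z q' j - v j) \<alpha>) q"
    proof -
      have "model_map charts k l I B q = model_map charts k l I A p" using \<psi>(2)[OF p(1)] p(2) by simp
      moreover have "q \<in> T" using q W(2) by blast
      ultimately show ?thesis
        using diff_op_divpow_eq_of_models[OF M I A \<open>open S\<close> y domA p(1) \<alpha>]
          diff_op_divpow_eq_of_models[OF M I B \<open>open T\<close> z domB _ \<alpha>] by simp
    qed
    ultimately show "iter_deriv partial \<alpha> (\<lambda>u. f (?h (inv_into S ?y u))) v * A (\<lambda>p'. midx_divpow (\<lambda>j. ?y p' j - v j) \<alpha>) p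
        = iter_deriv partial \<alpha> (\<lambda>u. f (inv_into T ?z u)) v * B (\<lambda>q'. midx_divpow (\<lambda>j. ?z q' j - v j) \<alpha>) q" by simp
  qed
  also have "\<dots> = B f q"
    using diff_op_taylor[OF M B z W(1) subset_UNIV W(2) f q] by (simp add: v)
  finally show "pushforward ?\<psi> A f q = B f q" .
qed


theorem theorem2:
  fixes charts :: "('m::{t2_space,second_countable_topology}, 'n::{finite,linorder}) chart set"
    and P :: "('m \<rightharpoonup> 'm) set"
    and k l :: nat
    and I :: "'n \<Rightarrow> 'm ojet \<rightharpoonup> real"
    and Om :: "'m ojet set"
    and A B :: "'m oper"
    and Oa Ob :: "'m set"
  assumes "smooth_manifold charts"
    and "connected (UNIV :: 'm set)"
    and "lie_pseudogroup charts P"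
    and "transitive_pseudogroup P"
    and "\<And>i. rational_invariant charts P k l (I i)"
    and "mopen (ojet_idx k l) (ojet_atlas charts k l) Om"
    and "general_position charts k l I Om"
    and "diff_op charts k UNIV A"
    and "diff_op charts k UNIV B"
    and "open Oa"
    and "open Ob"
    and "adjusted charts k l I Om A Oa"
    and "adjusted charts k l I Om B Ob"
  shows "let \<psi> = psi_map charts k l I A Oa B Ob in
         (model_map charts k l I A ` Oa = model_map charts k l I B ` Ob \<longrightarrow>
            local_diffeo charts \<psi> \<and> dom \<psi> = Oa \<and> ran \<psi> = Ob \<and>
            (\<forall>p\<in>Oa. \<forall>i. inv_value charts k l I B (the (\<psi> p)) i = inv_value charts k l I A p i)) \<and>
         (op_equivalent charts P A Oa B Ob \<longleftrightarrow>
            model_map charts k l I A ` Oa = model_map charts k l I B ` Ob \<and> \<psi> \<in> P)"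
proof -
  note M = assms(1) and I = assms(5) and A = assms(8) and B = assms(9) and op = assms(10,11)
  have y: "(Oa, inv_value charts k l I A) \<in> max_atlas UNIV charts"
    and z: "(Ob, inv_value charts k l I B) \<in> max_atlas UNIV charts"
    using assms(12,13) by (auto simp: adjusted_def)
  have domA: "ojet charts k l A p \<in> dom (I i)" if "p \<in> Oa" for p i
    using assms(7,12) that unfolding adjusted_def general_position_def by blast
  have domB: "ojet charts k l B p \<in> dom (I i)" if "p \<in> Ob" for p i
    using assms(7,13) that unfolding adjusted_def general_position_def by blast
  have P: "local_diffeo charts \<phi>" if "\<phi> \<in> P" for \<phi>
    using assms(3) that by (simp add: lie_pseudogroup_def regular_pseudogroup_def pseudogroup_def)
  define \<psi> where "\<psi> = psi_map charts k l I A Oa B Ob"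
  have part1: "local_diffeo charts \<psi> \<and> dom \<psi> = Oa \<and> ran \<psi> = Ob \<and>
      (\<forall>p\<in>Oa. \<forall>i. inv_value charts k l I B (the (\<psi> p)) i = inv_value charts k l I A p i)"
    if eq: "model_map charts k l I A ` Oa = model_map charts k l I B ` Ob"
  proof -
    note facts = psi_map_of_equal_models[OF M op y z eq, folded \<psi>_def]
    have "inv_value charts k l I B (the (\<psi> p)) = inv_value charts k l I A p" if "p \<in> Oa" for p
      using facts(2)[OF that] by (metis model_map_fst)
    then show ?thesis using facts(4-6) by simp
  qed
  have "model_map charts k l I A ` Oa = model_map charts k l I B ` Ob \<and> \<psi> \<in> P"
    if equiv: "op_equivalent charts P A Oa B Ob"
  proof -
    obtain \<phi> where \<phi>: "\<phi> \<in> P" "dom \<phi> = Oa" "ran \<phi> = Ob" "op_equal_on charts Ob (pushforward \<phi> A) B"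
      using equiv unfolding op_equivalent_def by blast
    have model: "model_map charts k l I B q = model_map charts k l I A p" if "\<phi> p = Some q" for p q
      by (rule models_of_equivalent[OF M I A B op y z domA domB \<phi>(1) P[OF \<phi>(1)] \<phi>(2-4) that])
    have injB: "inj_on (model_map charts k l I B) Ob"
      by (rule inj_on_model_map[OF z])
    have eq: "\<psi> p = \<phi> p" for p
    proof (cases "p \<in> Oa")
      case True
      then obtain q where q: "\<phi> p = Some q" using \<phi>(2) by blast
      then have "q \<in> Ob" using \<phi>(3) by (auto intro: ranI)
      then show ?thesis
        using True q model[OF q] inv_into_f_f[OF injB, of q] by (simp add: \<psi>_def psi_map_def)
    next
      case False
      then have "\<phi> p = None" using \<phi>(2) by blast
      then show ?thesis using False by (simp add: \<psi>_def psi_map_def)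
    qed
    have "model_map charts k l I A ` Oa = model_map charts k l I B ` Ob"
    proof (intro set_eqI iffI)
      fix m assume "m \<in> model_map charts k l I A ` Oa"
      then obtain p where p: "p \<in> Oa" "m = model_map charts k l I A p" by blast
      then obtain q where q: "\<phi> p = Some q" using \<phi>(2) by blast
      then have "q \<in> Ob" using \<phi>(3) by (auto intro: ranI)
      then show "m \<in> model_map charts k l I B ` Ob" using p(2) model[OF q] by (metis imageI)
    next
      fix m assume "m \<in> model_map charts k l I B ` Ob"
      then obtain q where q: "q \<in> Ob" "m = model_map charts k l I B q" by blast
      then obtain p where p: "\<phi> p = Some q" using \<phi>(3) by (auto simp: ran_def)
      then have "p \<in> Oa" using \<phi>(2) by blast
      then show "m \<in> model_map charts k l I A ` Oa" using q(2) model[OF p] by (metis imageI)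
    qed
    moreover have "\<psi> = \<phi>" using eq by (rule ext)
    ultimately show ?thesis using \<phi>(1) by simp
  qed
  moreover have "op_equivalent charts P A Oa B Ob"
    if eq: "model_map charts k l I A ` Oa = model_map charts k l I B ` Ob" and "\<psi> \<in> P"
    using equivalent_of_models[OF M I A B op y z domA domB eq] part1[OF eq] that(2)
    unfolding op_equivalent_def \<psi>_def by blast
  ultimately show ?thesis unfolding Let_def \<psi>_def[symmetric] using part1 by blast
qed

end
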